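(* Let $n\ge 1$, let $P\subset\mathbb{R}^2$ be a polygon with $n+2$ edges $E_1,\dots,E_{n+2}$ and vertices $v_1,\dots,v_{n+2}$, labelled cyclically so that $E_i$ joins $v_i$ to $v_{i+1}$ (with $v_{n+3}=v_1$). Let $\lambda$ be a characteristic function on $P$, write $\lambda(E_i)=(a_i,b_i)\in\mathbb{Z}^2$, and let $X(P,\lambda)$ be the associated $4$-dimensional toric orbifold. Suppose that $v_{n+2}$ is a smooth vertex and that $\lambda(E_{n+1})=(1,0)$ and $\lambda(E_{n+2})=(0,1)$. Then the reduced integral cohomology $\tilde{H}^*(X(P,\lambda);\mathbb{Z})$ is torsion-free and has a basis $$\{u_1,\ldots,u_n;v\}$$ with $\deg u_i=2$ for $i=1,\dots,n$ and $\deg v=4$ such that $$u_i\cup u_j=a_ib_j\,v\qquad\text{for } 1\leq i\leq j\leq n.$$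
   Context: Let $T^2=(S^1)^2$. A characteristic function on a polygon $P$ is a map $\lambda\colon\{E_1,\dots,E_{n+2}\}\to\mathbb{Z}^2$ such that each $\lambda(E_i)$ is a primitive vector and $\lambda(E_i),\lambda(E_j)$ are linearly independent whenever the distinct edges $E_i,E_j$ share a vertex. For a face $E$ of $P$ define a subtorus $T_E\le T^2$: $T_P$ is trivial; $T_{E_i}$ is the one-parameter subgroup $\{\exp(t\lambda(E_i))\mid t\in\mathbb{R}\}$, where $\exp\colon\mathbb{R}^2\to T^2$ is $(x_1,x_2)\mapsto(e^{2\pi\sqrt{-1}x_1},e^{2\pi\sqrt{-1}x_2})$; and $T_v=T^2$ for a vertex $v$. The toric orbifold is the quotient space $X(P,\lambda)=P\times T^2/_\sim$, where $(x,t)\sim(y,s)$ if and only if $x=y$ and $t^{-1}s\in T_{E(x)}$, with $E(x)$ the minimal face of $P$ containing $x$ in its relative interior. A vertex $v_i$ is a smooth vertex if $\{\lambda(E_{i-1}),\lambda(E_i)\}$ is a $\mathbb{Z}$-basis of $\mathbb{Z}^2$ (indices mod $n+2$); thus $v_{n+2}=E_{n+1}\cap E_{n+2}$ is smooth if $\{\lambda(E_{n+1}),\lambda(E_{n+2})\}$ is a basis of $\mathbb{Z}^2$. *)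

theory Defs
  imports "HOL-Analysis.Analysis" "HOL-Homology.Homology"
begin

section \<open>Singular cohomology with integer coefficients\<close>

text \<open>A \<open>p\<close>-cochain is an integer-valued function on the singular \<open>p\<close>-simplices,
  extended by 0 to functions that are not singular \<open>p\<close>-simplices of \<open>X\<close>.\<close>

type_synonym 'a cochain = "((nat \<Rightarrow> real) \<Rightarrow> 'a) \<Rightarrow> int"

definition singular_cochain :: "nat \<Rightarrow> 'a topology \<Rightarrow> 'a cochain \<Rightarrow> bool"
  where "singular_cochain p X \<phi> \<longleftrightarrow> (\<forall>f. \<not> singular_simplex p X f \<longrightarrow> \<phi> f = 0)"

definition cochain_eval :: "'a cochain \<Rightarrow> 'a chain \<Rightarrow> int"
  where "cochain_eval \<phi> c = (\<Sum>f\<in>Poly_Mapping.keys c. Poly_Mapping.lookup c f * \<phi> f)"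

definition coboundary :: "nat \<Rightarrow> 'a topology \<Rightarrow> 'a cochain \<Rightarrow> 'a cochain"
  where "coboundary p X \<phi> =
    (\<lambda>f. if singular_simplex (Suc p) X f
         then cochain_eval \<phi> (chain_boundary (Suc p) (frag_of f)) else 0)"

definition cocycle_group :: "nat \<Rightarrow> 'a topology \<Rightarrow> 'a cochain monoid"
  where "cocycle_group p X =
    \<lparr>carrier = {\<phi>. singular_cochain p X \<phi> \<and> coboundary p X \<phi> = (\<lambda>f. 0)},
     monoid.mult = (\<lambda>\<phi> \<psi> f. \<phi> f + \<psi> f), one = (\<lambda>f. 0)\<rparr>"

definition coboundary_set :: "nat \<Rightarrow> 'a topology \<Rightarrow> 'a cochain set"
  where "coboundary_set p X =
    (case p of 0 \<Rightarrow> {\<lambda>f. 0} | Suc q \<Rightarrow> coboundary q X ` Collect (singular_cochain q X))"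

definition cohomology_group :: "nat \<Rightarrow> 'a topology \<Rightarrow> 'a cochain set monoid"
  where "cohomology_group p X = cocycle_group p X Mod coboundary_set p X"

text \<open>Reduced cohomology is the cohomology of the augmented cochain complex
  \<open>\<int> \<rightarrow> C\<^sup>0 \<rightarrow> C\<^sup>1 \<rightarrow> \<dots>\<close>,
  whose augmentation sends an integer to the constant 0-cochain.\<close>

definition reduced_coboundary_set :: "nat \<Rightarrow> 'a topology \<Rightarrow> 'a cochain set"
  where "reduced_coboundary_set p X =
    (if p = 0 then range (\<lambda>m f. if singular_simplex 0 X f then m else 0) else coboundary_set p X)"

definition reduced_cohomology_group :: "nat \<Rightarrow> 'a topology \<Rightarrow> 'a cochain set monoid"
  where "reduced_cohomology_group p X = cocycle_group p X Mod reduced_coboundary_set p X"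

lemma reduced_cohomology_group_pos:
  "p > 0 \<Longrightarrow> reduced_cohomology_group p X = cohomology_group p X"
  by (simp add: reduced_cohomology_group_def cohomology_group_def reduced_coboundary_set_def)

subsection \<open>Cup product\<close>

definition front_face :: "nat \<Rightarrow> ((nat \<Rightarrow> real) \<Rightarrow> 'a) \<Rightarrow> (nat \<Rightarrow> real) \<Rightarrow> 'a"
  where "front_face p f = restrict f (standard_simplex p)"

text \<open>The restriction of a \<open>(p + q)\<close>-simplex to the face spanned by its vertices
  \<open>p, \<dots>, p + q\<close>.\<close>

definition back_face :: "nat \<Rightarrow> nat \<Rightarrow> ((nat \<Rightarrow> real) \<Rightarrow> 'a) \<Rightarrow> (nat \<Rightarrow> real) \<Rightarrow> 'a"
  where "back_face p q f =
    restrict (\<lambda>x. f (\<lambda>i. if i < p then 0 else x (i - p))) (standard_simplex q)"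

definition cup_cochain :: "nat \<Rightarrow> nat \<Rightarrow> 'a topology \<Rightarrow> 'a cochain \<Rightarrow> 'a cochain \<Rightarrow> 'a cochain"
  where "cup_cochain p q X \<phi> \<psi> =
    (\<lambda>f. if singular_simplex (p + q) X f then \<phi> (front_face p f) * \<psi> (back_face p q f) else 0)"

text \<open>On cohomology classes, the union below is that of a single repeated coset;
  see \<open>cup_product_class\<close>.\<close>

definition cup_product ::
    "nat \<Rightarrow> nat \<Rightarrow> 'a topology \<Rightarrow> 'a cochain set \<Rightarrow> 'a cochain set \<Rightarrow> 'a cochain set"
  where "cup_product p q X c d =
    (\<Union>\<phi>\<in>c. \<Union>\<psi>\<in>d. coboundary_set (p + q) X #>\<^bsub>cocycle_group (p + q) X\<^esub> cup_cochain p q X \<phi> \<psi>)"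

subsection \<open>Well-definedness\<close>

lemma cochain_eval_extend:
  assumes "finite A" "Poly_Mapping.keys c \<subseteq> A"
  shows "cochain_eval \<phi> c = (\<Sum>f\<in>A. Poly_Mapping.lookup c f * \<phi> f)"
  unfolding cochain_eval_def
  by (rule sum.mono_neutral_left) (use assms in \<open>auto simp: in_keys_iff\<close>)

lemma cochain_eval_0 [simp]: "cochain_eval \<phi> 0 = 0"
  by (simp add: cochain_eval_def)

lemma cochain_eval_of [simp]: "cochain_eval \<phi> (frag_of f) = \<phi> f"
  by (simp add: cochain_eval_def)

lemma cochain_eval_add: "cochain_eval \<phi> (c + d) = cochain_eval \<phi> c + cochain_eval \<phi> d"
proof -
  let ?A = "Poly_Mapping.keys c \<union> Poly_Mapping.keys d"
  have "Poly_Mapping.keys (c + d) \<subseteq> ?A"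
    by (rule keys_add)
  then show ?thesis
    by (simp add: cochain_eval_extend [of ?A] lookup_add distrib_right sum.distrib)
qed

lemma cochain_eval_cmul: "cochain_eval \<phi> (frag_cmul k c) = k * cochain_eval \<phi> c"
proof -
  have "Poly_Mapping.keys (frag_cmul k c) \<subseteq> Poly_Mapping.keys c"
    by (simp add: keys_cmul)
  then show ?thesis
    by (simp add: cochain_eval_extend [of "Poly_Mapping.keys c"] sum_distrib_left mult.assoc)
qed

lemma cochain_eval_sum: "cochain_eval \<phi> (sum g I) = (\<Sum>i\<in>I. cochain_eval \<phi> (g i))"
  by (induction I rule: infinite_finite_induct) (auto simp: cochain_eval_add)

lemma coboundary_simplex:
  assumes "singular_simplex (Suc p) X f"
  shows "coboundary p X \<phi> f = (\<Sum>k\<le>Suc p. (-1) ^ k * \<phi> (singular_face (Suc p) k f))"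
  using assms
  by (simp only: coboundary_def chain_boundary_of if_True nat.simps if_False
      cochain_eval_sum cochain_eval_cmul cochain_eval_of)

lemma singular_simplex_face_Suc:
  "singular_simplex (Suc p) X f \<Longrightarrow> k \<le> Suc p \<Longrightarrow> singular_simplex p X (singular_face (Suc p) k f)"
  using singular_simplex_singular_face [of "Suc p" X f k] by simp

lemma singular_cochain_coboundary: "singular_cochain (Suc p) X (coboundary p X \<phi>)"
  by (simp add: singular_cochain_def coboundary_def)

lemma cochain_eval_coboundary:
  assumes "singular_chain (Suc p) X c"
  shows "cochain_eval (coboundary p X \<phi>) c = cochain_eval \<phi> (chain_boundary (Suc p) c)"
proof -
  have "Poly_Mapping.keys c \<subseteq> singular_simplex_set (Suc p) X"
    using assms by (simp add: singular_chain_def)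
  then show ?thesis
  proof (induction c rule: frag_induction)
    case (one f)
    then show ?case by (simp add: coboundary_def)
  next
    case (diff c d)
    have minus: "cochain_eval \<phi> (x - y) = cochain_eval \<phi> x - cochain_eval \<phi> y"
      for \<phi> :: "'a cochain" and x y
      using cochain_eval_add [of \<phi> "x - y" y] by simp
    show ?case
      using diff by (simp add: chain_boundary_diff minus)
  qed auto
qed

lemma coboundary_coboundary: "coboundary (Suc p) X (coboundary p X \<phi>) = (\<lambda>f. 0)"
proof
  fix f
  show "coboundary (Suc p) X (coboundary p X \<phi>) f = 0"
  proof (cases "singular_simplex (Suc (Suc p)) X f")
    case True
    then have c: "singular_chain (Suc (Suc p)) X (frag_of f)"
      by (simp add: singular_chain_of)
    have "coboundary (Suc p) X (coboundary p X \<phi>) f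
        = cochain_eval \<phi> (chain_boundary (Suc p) (chain_boundary (Suc (Suc p)) (frag_of f)))"
      using True singular_chain_boundary_alt [OF c]
      by (simp add: coboundary_def [of "Suc p"] cochain_eval_coboundary)
    also have "\<dots> = 0"
      using chain_boundary_boundary_alt [OF c] by simp
    finally show ?thesis .
  qed (simp add: coboundary_def)
qed

lemma coboundary_add: "coboundary p X (\<lambda>f. \<phi> f + \<psi> f) = (\<lambda>f. coboundary p X \<phi> f + coboundary p X \<psi> f)"
  by (rule ext) (simp add: coboundary_def cochain_eval_def distrib_left sum.distrib)

lemma coboundary_uminus: "coboundary p X (\<lambda>f. - \<phi> f) = (\<lambda>f. - coboundary p X \<phi> f)"
  by (rule ext) (simp add: coboundary_def cochain_eval_def sum_negf)

lemma coboundary_zero [simp]: "coboundary p X (\<lambda>f. 0) = (\<lambda>f. 0)"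
  by (rule ext) (simp add: coboundary_def cochain_eval_def)

lemma cocycle_group_simps [simp]:
  "carrier (cocycle_group p X) = {\<phi>. singular_cochain p X \<phi> \<and> coboundary p X \<phi> = (\<lambda>f. 0)}"
  "monoid.mult (cocycle_group p X) = (\<lambda>\<phi> \<psi> f. \<phi> f + \<psi> f)"
  "one (cocycle_group p X) = (\<lambda>f. 0)"
  by (simp_all add: cocycle_group_def)

lemma comm_group_cocycle_group: "comm_group (cocycle_group p X)"
proof (rule comm_groupI)
  fix \<phi> assume "\<phi> \<in> carrier (cocycle_group p X)"
  then show "\<exists>\<psi>\<in>carrier (cocycle_group p X). \<psi> \<otimes>\<^bsub>cocycle_group p X\<^esub> \<phi> = \<one>\<^bsub>cocycle_group p X\<^esub>"
    by (intro bexI [of _ "\<lambda>f. - \<phi> f"]) (auto simp: singular_cochain_def coboundary_uminus)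
qed (auto simp: singular_cochain_def coboundary_add fun_eq_iff)

lemma inv_cocycle_group:
  assumes "\<phi> \<in> carrier (cocycle_group p X)"
  shows "inv\<^bsub>cocycle_group p X\<^esub> \<phi> = (\<lambda>f. - \<phi> f)"
proof -
  interpret comm_group "cocycle_group p X" by (rule comm_group_cocycle_group)
  show ?thesis
    by (rule inv_equality) (use assms in \<open>auto simp: singular_cochain_def coboundary_uminus\<close>)
qed

lemma subgroup_coboundary_set: "subgroup (coboundary_set p X) (cocycle_group p X)"
proof -
  interpret comm_group "cocycle_group p X" by (rule comm_group_cocycle_group)
  have sub: "coboundary_set p X \<subseteq> carrier (cocycle_group p X)"
    by (cases p) (auto simp: coboundary_set_def singular_cochain_coboundary coboundary_coboundary,
        simp_all add: singular_cochain_def)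
  have add: "(\<lambda>f. \<phi> f + \<psi> f) \<in> coboundary_set p X"
    if \<phi>: "\<phi> \<in> coboundary_set p X" and \<psi>: "\<psi> \<in> coboundary_set p X" for \<phi> \<psi>
  proof (cases p)
    case (Suc q)
    obtain \<alpha> where "singular_cochain q X \<alpha>" "\<phi> = coboundary q X \<alpha>"
      using \<phi> Suc by (auto simp: coboundary_set_def)
    moreover obtain \<beta> where "singular_cochain q X \<beta>" "\<psi> = coboundary q X \<beta>"
      using \<psi> Suc by (auto simp: coboundary_set_def)
    ultimately have "(\<lambda>f. \<phi> f + \<psi> f) = coboundary q X (\<lambda>f. \<alpha> f + \<beta> f)"
      "singular_cochain q X (\<lambda>f. \<alpha> f + \<beta> f)"
      by (simp_all add: coboundary_add singular_cochain_def)
    then show ?thesis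
      by (auto simp: Suc coboundary_set_def)
  qed (use that in \<open>auto simp: coboundary_set_def\<close>)
  have neg: "(\<lambda>f. - \<phi> f) \<in> coboundary_set p X" if \<phi>: "\<phi> \<in> coboundary_set p X" for \<phi>
  proof (cases p)
    case (Suc q)
    obtain \<alpha> where "singular_cochain q X \<alpha>" "\<phi> = coboundary q X \<alpha>"
      using \<phi> Suc by (auto simp: coboundary_set_def)
    then have "(\<lambda>f. - \<phi> f) = coboundary q X (\<lambda>f. - \<alpha> f)" "singular_cochain q X (\<lambda>f. - \<alpha> f)"
      by (simp_all add: coboundary_uminus singular_cochain_def)
    then show ?thesis
      by (auto simp: Suc coboundary_set_def)
  qed (use that in \<open>auto simp: coboundary_set_def\<close>)
  have zero: "(\<lambda>f. 0) \<in> coboundary_set p X"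
    by (cases p) (auto simp: coboundary_set_def singular_cochain_def
        intro!: image_eqI [of _ _ "\<lambda>f. 0"])
  show ?thesis
  proof (rule subgroupI)
    fix \<phi> assume \<phi>: "\<phi> \<in> coboundary_set p X"
    then have "\<phi> \<in> carrier (cocycle_group p X)" using sub by blast
    then show "inv\<^bsub>cocycle_group p X\<^esub> \<phi> \<in> coboundary_set p X"
      using neg [OF \<phi>] by (simp only: inv_cocycle_group)
  qed (use sub add zero in auto)
qed

lemma subgroup_reduced_coboundary_set: "subgroup (reduced_coboundary_set p X) (cocycle_group p X)"
proof (cases "p = 0")
  case True
  interpret comm_group "cocycle_group 0 X" by (rule comm_group_cocycle_group)
  let ?c = "\<lambda>m f. if singular_simplex 0 X f then m else (0::int)"
  have "coboundary 0 X (?c m) f = 0" for m f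
  proof (cases "singular_simplex (Suc 0) X f")
    case True
    then show ?thesis
      by (simp add: coboundary_simplex singular_simplex_face_Suc)
  qed (simp add: coboundary_def)
  then have sub: "range ?c \<subseteq> carrier (cocycle_group 0 X)"
    by (auto simp: singular_cochain_def)
  have "subgroup (range ?c) (cocycle_group 0 X)"
  proof (rule subgroupI)
    fix \<phi> assume \<phi>: "\<phi> \<in> range ?c"
    then obtain m where m: "\<phi> = ?c m" by blast
    have "\<phi> \<in> carrier (cocycle_group 0 X)" using sub \<phi> by blast
    then have "inv\<^bsub>cocycle_group 0 X\<^esub> \<phi> = ?c (- m)"
      by (simp only: inv_cocycle_group) (auto simp: m)
    then show "inv\<^bsub>cocycle_group 0 X\<^esub> \<phi> \<in> range ?c" by blast
  next
    fix \<phi> \<psi> assume "\<phi> \<in> range ?c" "\<psi> \<in> range ?c"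
    then obtain m k where "\<phi> = ?c m" "\<psi> = ?c k" by blast
    then have "\<phi> \<otimes>\<^bsub>cocycle_group 0 X\<^esub> \<psi> = ?c (m + k)" by auto
    then show "\<phi> \<otimes>\<^bsub>cocycle_group 0 X\<^esub> \<psi> \<in> range ?c" by blast
  qed (use sub in auto)
  then show ?thesis using True by (simp add: reduced_coboundary_set_def)
next
  case False
  then show ?thesis by (simp add: reduced_coboundary_set_def subgroup_coboundary_set)
qed

lemma comm_group_reduced_cohomology_group: "comm_group (reduced_cohomology_group p X)"
  unfolding reduced_cohomology_group_def
  by (intro comm_group.abelian_FactGroup comm_group_cocycle_group subgroup_reduced_coboundary_set)

lemma singular_simplex_front_face:
  assumes "singular_simplex (p + q) X f"
  shows "singular_simplex p X (front_face p f)"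
proof -
  have "continuous_map (subtopology (powertop_real UNIV) (standard_simplex p)) X f"
    using assms standard_simplex_mono [of p "p + q"]
    by (auto simp: singular_simplex_def intro: continuous_map_from_subtopology_mono)
  then show ?thesis
    by (simp add: singular_simplex_def front_face_def)
qed

lemma shift_in_standard_simplex:
  assumes "x \<in> standard_simplex q"
  shows "(\<lambda>i. if i < p then 0 else x (i - p)) \<in> standard_simplex (p + q)"
proof -
  have "(\<Sum>i\<le>p + q. if i < p then 0 else x (i - p)) = (\<Sum>i\<in>{p..p + q}. x (i - p))"
    by (rule sum.mono_neutral_cong_right) auto
  also have "\<dots> = (\<Sum>i\<le>q. x i)"
    by (rule sum.reindex_bij_witness [of _ "\<lambda>i. i + p" "\<lambda>i. i - p"]) auto
  finally show ?thesis
    using assms by (auto simp: standard_simplex_def)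
qed

lemma singular_simplex_back_face:
  assumes "singular_simplex (p + q) X f"
  shows "singular_simplex q X (back_face p q f)"
proof -
  let ?PT = "powertop_real UNIV"
  let ?s = "\<lambda>x i. if i < p then 0 else x (i - p) :: real"
  have s: "continuous_map (subtopology ?PT (standard_simplex q))
      (subtopology ?PT (standard_simplex (p + q))) ?s"
    unfolding continuous_map_in_subtopology continuous_map_componentwise_UNIV
  proof (intro conjI allI)
    show "continuous_map (subtopology ?PT (standard_simplex q)) euclideanreal (\<lambda>x. ?s x i)" for i
      by (cases "i < p") (auto intro: continuous_map_from_subtopology continuous_map_product_projection)
  qed (auto simp: shift_in_standard_simplex)
  have "continuous_map (subtopology ?PT (standard_simplex q)) X (f \<circ> ?s)"
    using assms s continuous_map_compose by (auto simp: singular_simplex_def)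
  then show ?thesis
    by (simp add: singular_simplex_def back_face_def o_def)
qed

lemma standard_simplex_subset_add: "x \<in> standard_simplex p \<Longrightarrow> x \<in> standard_simplex (p + q)"
  using standard_simplex_mono [of p "p + q"] by auto

lemma face_front_face:
  assumes "k \<le> Suc p"
  shows "front_face p (singular_face (Suc (p + q)) k f) = singular_face (Suc p) k (front_face (Suc p) f)"
  using assms simplical_face_in_standard_simplex [of "Suc p" k]
  by (auto simp: front_face_def singular_face_def restrict_def fun_eq_iff standard_simplex_subset_add)

lemma back_face_low:
  assumes "k \<le> p"
  shows "back_face p q (singular_face (Suc (p + q)) k f) = back_face (Suc p) q f"
proof -
  have "simplical_face k (\<lambda>i. if i < p then 0 else x (i - p)) = (\<lambda>i. if i < Suc p then 0 else x (i - Suc p))"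
    for x :: "nat \<Rightarrow> real"
    using assms by (auto simp: simplical_face_def fun_eq_iff)
  then show ?thesis
    by (intro ext) (simp add: back_face_def singular_face_def restrict_def shift_in_standard_simplex)
qed

lemma back_face_high:
  assumes "j \<le> Suc q"
  shows "back_face p q (singular_face (Suc (p + q)) (p + j) f) = singular_face (Suc q) j (back_face p (Suc q) f)"
proof -
  have "simplical_face (p + j) (\<lambda>i. if i < p then 0 else x (i - p)) =
      (\<lambda>i. if i < p then 0 else simplical_face j x (i - p))" for x :: "nat \<Rightarrow> real"
    by (auto simp: simplical_face_def fun_eq_iff)
  then show ?thesis
    using assms simplical_face_in_standard_simplex [of "Suc q" j]
    by (intro ext) (simp add: back_face_def singular_face_def restrict_def shift_in_standard_simplex)
qed

lemma front_face_high:
  assumes "0 < j"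
  shows "front_face p (singular_face (Suc (p + q)) (p + j) f) = front_face p f"
proof -
  have "simplical_face (p + j) x = x" if "x \<in> standard_simplex p" for x
    using assms that by (force simp: simplical_face_def standard_simplex_def)
  then show ?thesis
    by (intro ext) (simp add: front_face_def singular_face_def restrict_def standard_simplex_subset_add)
qed

lemma cup_cochain_zero [simp]:
  "cup_cochain p q X (\<lambda>f. 0) \<psi> = (\<lambda>f. 0)" "cup_cochain p q X \<phi> (\<lambda>f. 0) = (\<lambda>f. 0)"
  by (auto simp: cup_cochain_def)

lemma coboundary_cup_cochain:
  "coboundary (p + q) X (cup_cochain p q X \<phi> \<psi>) =
    (\<lambda>f. cup_cochain (Suc p) q X (coboundary p X \<phi>) \<psi> f +
         (-1) ^ p * cup_cochain p (Suc q) X \<phi> (coboundary q X \<psi>) f)" (is "?L = ?R")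
proof
  fix f
  show "?L f = ?R f"
  proof (cases "singular_simplex (Suc (p + q)) X f")
    case True
    define F where "F = (\<lambda>k. singular_face (Suc (p + q)) k f)"
    define A where "A = (\<lambda>k. (-1) ^ k * (\<phi> (singular_face (Suc p) k (front_face (Suc p) f)) *
        \<psi> (back_face (Suc p) q f)))"
    define B where "B = (\<lambda>j. (-1) ^ (p + j) * (\<phi> (front_face p f) *
        \<psi> (singular_face (Suc q) j (back_face p (Suc q) f))))"
    define T where "T = (\<lambda>k. (-1) ^ k * (\<phi> (front_face p (F k)) * \<psi> (back_face p q (F k))))"
    have TA: "T k = A k" if "k \<le> p" for k
      using that by (simp add: T_def A_def F_def face_front_face back_face_low)
    have TB: "T (p + j) = B j" if "0 < j" "j \<le> Suc q" for j
      using that by (simp add: T_def B_def F_def front_face_high back_face_high)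
    have AB: "A (Suc p) + B 0 = 0"
    proof -
      have "singular_face (Suc p) (Suc p) (front_face (Suc p) f) = front_face p f"
        using face_front_face [of "Suc p" p q f] front_face_high [of 1 p q f] by simp
      moreover have "singular_face (Suc q) 0 (back_face p (Suc q) f) = back_face (Suc p) q f"
        using back_face_high [of 0 q p f] back_face_low [of p p q f] by simp
      ultimately show ?thesis by (simp add: A_def B_def)
    qed
    have front: "singular_simplex (Suc p) X (front_face (Suc p) f)"
      using singular_simplex_front_face [of "Suc p" q] True by simp
    have bk: "singular_simplex (Suc q) X (back_face p (Suc q) f)"
      using singular_simplex_back_face [of p "Suc q"] True by simp
    have "?L f = (\<Sum>k\<le>Suc (p + q). T k)"
      unfolding coboundary_simplex [OF True] T_def F_def
      by (rule sum.cong) (use True singular_simplex_face_Suc in \<open>auto simp: cup_cochain_def\<close>)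
    also have "{..Suc (p + q)} = {..p} \<union> {p + 1..p + Suc q}" by auto
    also have "sum T \<dots> = (\<Sum>k\<le>p. T k) + (\<Sum>k=p + 1..p + Suc q. T k)"
      by (rule sum.union_disjoint) auto
    also have "(\<Sum>k=p + 1..p + Suc q. T k) = (\<Sum>j=1..Suc q. T (p + j))"
      using sum.shift_bounds_cl_nat_ivl [of T 1 p "Suc q"] by (simp add: add.commute)
    also have "\<dots> = (\<Sum>j=1..Suc q. B j)"
      by (rule sum.cong) (auto simp: TB)
    also have "(\<Sum>k\<le>p. T k) = (\<Sum>k\<le>p. A k)"
      by (rule sum.cong) (auto simp: TA)
    also have "(\<Sum>k\<le>p. A k) + (\<Sum>j=1..Suc q. B j) = (\<Sum>k\<le>Suc p. A k) + (\<Sum>j\<le>Suc q. B j)"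
    proof -
      have "(\<Sum>j\<le>Suc q. B j) = B 0 + (\<Sum>j=1..Suc q. B j)"
        using sum.atLeast_Suc_atMost [of 0 "Suc q" B] by (simp add: atMost_atLeast0)
      then show ?thesis using AB by simp
    qed
    also have "(\<Sum>k\<le>Suc p. A k) = cup_cochain (Suc p) q X (coboundary p X \<phi>) \<psi> f"
      using True front unfolding A_def
      by (simp only: cup_cochain_def coboundary_simplex add_Suc if_True sum_distrib_right mult.assoc)
    also have "(\<Sum>j\<le>Suc q. B j) = (-1) ^ p * cup_cochain p (Suc q) X \<phi> (coboundary q X \<psi>) f"
      using True bk unfolding B_def
      by (simp only: cup_cochain_def coboundary_simplex add_Suc_right if_True sum_distrib_left
          power_add ac_simps)
    finally show ?thesis .
  next
    case False
    then show ?thesis by (simp add: coboundary_def [of "p + q"] cup_cochain_def)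
  qed
qed

lemma singular_cochain_cup: "singular_cochain (p + q) X (cup_cochain p q X \<phi> \<psi>)"
  by (simp add: singular_cochain_def cup_cochain_def)

lemma cup_cocycle:
  assumes "\<phi> \<in> carrier (cocycle_group p X)" "\<psi> \<in> carrier (cocycle_group q X)"
  shows "cup_cochain p q X \<phi> \<psi> \<in> carrier (cocycle_group (p + q) X)"
  using assms by (simp add: singular_cochain_cup coboundary_cup_cochain)

lemma cup_coboundary_left:
  assumes "\<beta> \<in> coboundary_set p X" "\<psi> \<in> carrier (cocycle_group q X)"
  shows "cup_cochain p q X \<beta> \<psi> \<in> coboundary_set (p + q) X"
proof (cases p)
  case 0
  then show ?thesis
    using assms subgroup.one_closed [OF subgroup_coboundary_set, of q X]
    by (simp add: coboundary_set_def)
next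
  case (Suc r)
  obtain \<alpha> where \<alpha>: "\<beta> = coboundary r X \<alpha>"
    using assms Suc by (auto simp: coboundary_set_def)
  have "cup_cochain p q X \<beta> \<psi> = coboundary (r + q) X (cup_cochain r q X \<alpha> \<psi>)"
    using assms by (simp add: coboundary_cup_cochain \<alpha> Suc)
  then show ?thesis
    by (auto simp: Suc coboundary_set_def singular_cochain_cup)
qed

lemma cup_coboundary_right:
  assumes "\<phi> \<in> carrier (cocycle_group p X)" "\<beta> \<in> coboundary_set q X"
  shows "cup_cochain p q X \<phi> \<beta> \<in> coboundary_set (p + q) X"
proof (cases q)
  case 0
  then show ?thesis
    using assms subgroup.one_closed [OF subgroup_coboundary_set, of p X]
    by (simp add: coboundary_set_def)
next
  case (Suc r)
  obtain \<alpha> where \<alpha>: "\<beta> = coboundary r X \<alpha>"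
    using assms Suc by (auto simp: coboundary_set_def)
  define \<gamma> where "\<gamma> = (\<lambda>f. (-1) ^ p * \<alpha> f)"
  have "coboundary r X \<gamma> = (\<lambda>f. (-1) ^ p * coboundary r X \<alpha> f)"
    by (rule ext) (simp add: \<gamma>_def coboundary_def cochain_eval_def sum_distrib_left ac_simps)
  moreover have "(-1) ^ p * (x * ((-1) ^ p * y)) = x * y" for x y :: int
    by (cases "even p") simp_all
  moreover have "coboundary p X \<phi> = (\<lambda>f. 0)"
    using assms by simp
  ultimately have "cup_cochain p q X \<phi> \<beta> = coboundary (p + r) X (cup_cochain p r X \<phi> \<gamma>)"
    unfolding coboundary_cup_cochain \<alpha> Suc by (auto simp: cup_cochain_def)
  then show ?thesis
    by (auto simp: Suc coboundary_set_def singular_cochain_cup)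
qed

lemma cup_product_class:
  assumes c: "c \<in> carrier (cohomology_group p X)" and d: "d \<in> carrier (cohomology_group q X)"
    and \<phi>: "\<phi> \<in> c" and \<psi>: "\<psi> \<in> d"
  shows "cup_product p q X c d = coboundary_set (p + q) X #>\<^bsub>cocycle_group (p + q) X\<^esub> cup_cochain p q X \<phi> \<psi>"
    and "cup_product p q X c d \<in> carrier (cohomology_group (p + q) X)"
proof -
  have rep: "x \<in> carrier (cocycle_group r X) \<and> (\<exists>\<beta>\<in>coboundary_set r X. y = (\<lambda>f. \<beta> f + x f))"
    if e: "e \<in> carrier (cohomology_group r X)" and xy: "x \<in> e" "y \<in> e" for r e x y
  proof -
    interpret C: comm_group "cocycle_group r X" by (rule comm_group_cocycle_group)
    note sg = subgroup_coboundary_set [of r X]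
    obtain z where z: "z \<in> carrier (cocycle_group r X)" "e = coboundary_set r X #>\<^bsub>cocycle_group r X\<^esub> z"
      using e by (auto simp: cohomology_group_def FactGroup_def RCOSETS_def)
    have x: "x \<in> carrier (cocycle_group r X)"
      using C.r_coset_subset_G [OF subgroup.subset [OF sg]] z xy by blast
    have "e = coboundary_set r X #>\<^bsub>cocycle_group r X\<^esub> x"
      using C.repr_independence [OF _ z(1) sg] z(2) xy(1) by simp
    then show ?thesis using x xy(2) by (auto simp: r_coset_def)
  qed
  interpret C: comm_group "cocycle_group (p + q) X" by (rule comm_group_cocycle_group)
  note sg = subgroup_coboundary_set [of "p + q" X]
  let ?K = "\<lambda>x y. coboundary_set (p + q) X #>\<^bsub>cocycle_group (p + q) X\<^esub> cup_cochain p q X x y"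
  have eq: "?K x y = ?K \<phi> \<psi>" if xy: "x \<in> c" "y \<in> d" for x y
  proof -
    obtain \<beta> \<gamma> where \<beta>: "\<beta> \<in> coboundary_set p X" "x = (\<lambda>f. \<beta> f + \<phi> f)"
      and \<gamma>: "\<gamma> \<in> coboundary_set q X" "y = (\<lambda>f. \<gamma> f + \<psi> f)"
      using rep [OF c \<phi> xy(1)] rep [OF d \<psi> xy(2)] by blast
    have cyc: "\<phi> \<in> carrier (cocycle_group p X)" "y \<in> carrier (cocycle_group q X)"
        "\<psi> \<in> carrier (cocycle_group q X)"
      using rep [OF c \<phi> \<phi>] rep [OF d xy(2) xy(2)] rep [OF d \<psi> \<psi>] by auto
    have "cup_cochain p q X x y =
        (\<lambda>f. (cup_cochain p q X \<beta> y f + cup_cochain p q X \<phi> \<gamma> f) + cup_cochain p q X \<phi> \<psi> f)"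
      by (auto simp: cup_cochain_def \<beta>(2) \<gamma>(2) fun_eq_iff algebra_simps)
    moreover have "(\<lambda>f. cup_cochain p q X \<beta> y f + cup_cochain p q X \<phi> \<gamma> f) \<in> coboundary_set (p + q) X"
      using subgroup.m_closed [OF sg cup_coboundary_left [OF \<beta>(1) cyc(2)] cup_coboundary_right [OF cyc(1) \<gamma>(1)]]
      by simp
    ultimately have "cup_cochain p q X x y \<in> ?K \<phi> \<psi>"
      by (auto simp: r_coset_def)
    then show ?thesis
      using C.repr_independence [OF _ cup_cocycle [OF cyc(1,3)] sg] by simp
  qed
  show *: "cup_product p q X c d = ?K \<phi> \<psi>"
    unfolding cup_product_def using \<phi> \<psi> eq by blast
  have "cup_cochain p q X \<phi> \<psi> \<in> carrier (cocycle_group (p + q) X)"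
    using rep [OF c \<phi> \<phi>] rep [OF d \<psi> \<psi>] cup_cocycle by blast
  then show "cup_product p q X c d \<in> carrier (cohomology_group (p + q) X)"
    unfolding * cohomology_group_def FactGroup_def RCOSETS_def by auto
qed

section \<open>Torsion and bases of abelian groups\<close>

definition torsion_free :: "('a, 'b) monoid_scheme \<Rightarrow> bool"
  where "torsion_free G \<longleftrightarrow>
    (\<forall>x\<in>carrier G. \<forall>k::nat. k > 0 \<and> x [^]\<^bsub>G\<^esub> k = \<one>\<^bsub>G\<^esub> \<longrightarrow> x = \<one>\<^bsub>G\<^esub>)"

text \<open>The finite family \<open>(b i)\<^sub>i\<^sub>\<in>\<^sub>I\<close> is a \<open>\<int>\<close>-basis of the abelian group \<open>G\<close>,
  which is written multiplicatively as usual in \<open>HOL-Algebra\<close>.\<close>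

definition int_basis :: "('a, 'b) monoid_scheme \<Rightarrow> 'i set \<Rightarrow> ('i \<Rightarrow> 'a) \<Rightarrow> bool"
  where "int_basis G I b \<longleftrightarrow> finite I \<and> b \<in> I \<rightarrow> carrier G \<and>
    (\<forall>x\<in>carrier G. \<exists>!c. c \<in> I \<rightarrow>\<^sub>E (UNIV :: int set) \<and> x = (\<Otimes>\<^bsub>G\<^esub>i\<in>I. b i [^]\<^bsub>G\<^esub> c i))"

section \<open>Quotient spaces\<close>

text \<open>The quotient topology on \<open>q ` topspace X\<close> induced by a map \<open>q\<close>.\<close>

definition quotient_topology :: "'a topology \<Rightarrow> ('a \<Rightarrow> 'b) \<Rightarrow> 'b topology"
  where "quotient_topology X q =
    topology (\<lambda>U. U \<subseteq> q ` topspace X \<and> openin X {x \<in> topspace X. q x \<in> U})"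

lemma openin_quotient_topology:
  "openin (quotient_topology X q) U \<longleftrightarrow>
    U \<subseteq> q ` topspace X \<and> openin X {x \<in> topspace X. q x \<in> U}"
proof -
  let ?L = "\<lambda>U. U \<subseteq> q ` topspace X \<and> openin X {x \<in> topspace X. q x \<in> U}"
  have "istopology ?L"
    unfolding istopology_def
  proof (intro conjI allI impI)
    fix S T assume "?L S" "?L T"
    moreover have "{x \<in> topspace X. q x \<in> S \<inter> T} =
        {x \<in> topspace X. q x \<in> S} \<inter> {x \<in> topspace X. q x \<in> T}" by auto
    ultimately show "S \<inter> T \<subseteq> q ` topspace X" "openin X {x \<in> topspace X. q x \<in> S \<inter> T}"
      by auto
  next
    fix \<K> assume K: "\<forall>K\<in>\<K>. ?L K"
    then show "\<Union>\<K> \<subseteq> q ` topspace X" by blast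
    have "{x \<in> topspace X. q x \<in> \<Union>\<K>} = (\<Union>K\<in>\<K>. {x \<in> topspace X. q x \<in> K})" by auto
    then show "openin X {x \<in> topspace X. q x \<in> \<Union>\<K>}" using K by auto
  qed
  then show ?thesis by (simp add: quotient_topology_def)
qed

lemma topspace_quotient_topology [simp]: "topspace (quotient_topology X q) = q ` topspace X"
proof
  have "{x \<in> topspace X. q x \<in> q ` topspace X} = topspace X" by auto
  then have "openin (quotient_topology X q) (q ` topspace X)"
    by (simp add: openin_quotient_topology)
  then show "q ` topspace X \<subseteq> topspace (quotient_topology X q)"
    by (rule openin_subset)
  show "topspace (quotient_topology X q) \<subseteq> q ` topspace X"
    using openin_topspace [of "quotient_topology X q"] unfolding openin_quotient_topology
    by (rule conjunct1)
qed

lemma quotient_map_quotient_topology: "quotient_map X (quotient_topology X q) q"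
  by (simp add: quotient_map_def openin_quotient_topology)

section \<open>Polygons and characteristic functions\<close>

text \<open>A (convex) polygon with \<open>m\<close> edges \<open>E 1, \<dots>, E m\<close> and vertices \<open>v 1, \<dots>, v m\<close>, labelled
  cyclically so that \<open>E i\<close> joins \<open>v i\<close> to \<open>v (i + 1)\<close>, where \<open>v (m + 1)\<close> is read as \<open>v 1\<close>.\<close>

definition labelled_polygon ::
    "(real^2) set \<Rightarrow> nat \<Rightarrow> (nat \<Rightarrow> (real^2) set) \<Rightarrow> (nat \<Rightarrow> real^2) \<Rightarrow> bool"
  where "labelled_polygon P m E v \<longleftrightarrow>
    polytope P \<and> aff_dim P = 2 \<and>
    bij_betw E {1..m} {F. F edge_of P} \<and>
    bij_betw v {1..m} {x. x extreme_point_of P} \<and>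
    (\<forall>i\<in>{1..m}. E i = closed_segment (v i) (v (if i = m then 1 else i + 1)))"

definition primitive :: "int \<times> int \<Rightarrow> bool"
  where "primitive w \<longleftrightarrow> gcd (fst w) (snd w) = 1"

definition lin_indep :: "int \<times> int \<Rightarrow> int \<times> int \<Rightarrow> bool"
  where "lin_indep w z \<longleftrightarrow>
    (\<forall>r s. (r * fst w + s * fst z, r * snd w + s * snd z) = (0, 0) \<longrightarrow> r = 0 \<and> s = 0)"

definition lattice_basis :: "int \<times> int \<Rightarrow> int \<times> int \<Rightarrow> bool"
  where "lattice_basis w z \<longleftrightarrow>
    (\<forall>x. \<exists>!(r, s). x = (r * fst w + s * fst z, r * snd w + s * snd z))"

definition characteristic_function :: "(real^2) set \<Rightarrow> ((real^2) set \<Rightarrow> int \<times> int) \<Rightarrow> bool"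
  where "characteristic_function P lam \<longleftrightarrow>
    (\<forall>F. F edge_of P \<longrightarrow> primitive (lam F)) \<and>
    (\<forall>F G. F edge_of P \<and> G edge_of P \<and> F \<noteq> G \<and> (\<exists>x. x extreme_point_of P \<and> x \<in> F \<and> x \<in> G)
       \<longrightarrow> lin_indep (lam F) (lam G))"

text \<open>The vertex \<open>v i = E (i - 1) \<inter> E i\<close> is smooth, with indices read modulo \<open>m\<close>.\<close>

definition smooth_vertex ::
    "nat \<Rightarrow> (nat \<Rightarrow> (real^2) set) \<Rightarrow> ((real^2) set \<Rightarrow> int \<times> int) \<Rightarrow> nat \<Rightarrow> bool"
  where "smooth_vertex m E lam i \<longleftrightarrow> lattice_basis (lam (E (if i = 1 then m else i - 1))) (lam (E i))"

section \<open>Toric orbifolds\<close>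

definition torus :: "(complex \<times> complex) set"
  where "torus = sphere 0 1 \<times> sphere 0 1"

definition torus_exp :: "real \<times> real \<Rightarrow> complex \<times> complex"
  where "torus_exp x = (exp (2 * of_real pi * \<i> * of_real (fst x)), exp (2 * of_real pi * \<i> * of_real (snd x)))"

text \<open>For a polygon \<open>P\<close>, the nonempty faces other than \<open>P\<close> and its edges are the vertices
  \<open>{x}\<close>, so the last case below is that of a vertex.\<close>

definition face_torus ::
    "(real^2) set \<Rightarrow> ((real^2) set \<Rightarrow> int \<times> int) \<Rightarrow> (real^2) set \<Rightarrow> (complex \<times> complex) set"
  where "face_torus P lam F =
    (if F = P then {(1, 1)}
     else if F edge_of P then range (\<lambda>t::real. torus_exp (t * real_of_int (fst (lam F)), t * real_of_int (snd (lam F))))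
     else torus)"

text \<open>The relative interiors of the faces of a polytope partition it, so exactly one face
  contains \<open>x\<close> in its relative interior.\<close>

definition minimal_face :: "(real^2) set \<Rightarrow> real^2 \<Rightarrow> (real^2) set"
  where "minimal_face P x = (THE F. F face_of P \<and> x \<in> rel_interior F)"

definition orbifold_rel ::
    "(real^2) set \<Rightarrow> ((real^2) set \<Rightarrow> int \<times> int) \<Rightarrow>
      ((real^2) \<times> (complex \<times> complex)) rel"
  where "orbifold_rel P lam =
    {((x, t), (y, s)). x \<in> P \<and> y \<in> P \<and> t \<in> torus \<and> s \<in> torus \<and> x = y \<and>
       (inverse (fst t) * fst s, inverse (snd t) * snd s) \<in> face_torus P lam (minimal_face P x)}"

definition toric_orbifold ::
    "(real^2) set \<Rightarrow> ((real^2) set \<Rightarrow> int \<times> int) \<Rightarrow> ((real^2) \<times> (complex \<times> complex)) set topology"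
  where "toric_orbifold P lam =
    quotient_topology (top_of_set (P \<times> torus)) (\<lambda>z. orbifold_rel P lam `` {z})"

lemma face_torus_group:
  shows "face_torus P lam F \<subseteq> torus" and "(1, 1) \<in> face_torus P lam F"
    and "t \<in> face_torus P lam F \<Longrightarrow> (inverse (fst t), inverse (snd t)) \<in> face_torus P lam F"
    and "t \<in> face_torus P lam F \<Longrightarrow> s \<in> face_torus P lam F \<Longrightarrow>
           (fst t * fst s, snd t * snd s) \<in> face_torus P lam F"
proof -
  define e where "e = (\<lambda>t::real. torus_exp (t * real_of_int (fst (lam F)), t * real_of_int (snd (lam F))))"
  have e: "e 0 = (1, 1)" "(inverse (fst (e x)), inverse (snd (e x))) = e (- x)"
      "(fst (e x) * fst (e y), snd (e x) * snd (e y)) = e (x + y)" for x y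
    by (simp_all add: e_def torus_exp_def exp_minus exp_add [symmetric] algebra_simps)
  have T: "face_torus P lam F = (if F = P then {(1, 1)} else if F edge_of P then range e else torus)"
    by (simp add: face_torus_def e_def)
  have "e x \<in> torus" for x
    by (simp add: e_def torus_def torus_exp_def)
  then have "range e \<subseteq> torus"
    by blast
  then show "face_torus P lam F \<subseteq> torus"
    by (simp add: T torus_def)
  show "(1, 1) \<in> face_torus P lam F"
    using rangeI [of e 0] by (simp add: T torus_def e(1))
  have inv_e: "(inverse (fst z), inverse (snd z)) \<in> range e" if "z \<in> range e" for z
  proof -
    obtain x where z: "z = e x" using \<open>z \<in> range e\<close> by blast
    show ?thesis unfolding z e by (rule rangeI)
  qed
  have mult_e: "(fst z * fst w, snd z * snd w) \<in> range e" if "z \<in> range e" "w \<in> range e" for z w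
  proof -
    obtain x y where zw: "z = e x" "w = e y"
      using \<open>z \<in> range e\<close> \<open>w \<in> range e\<close> by blast
    show ?thesis unfolding zw e by (rule rangeI)
  qed
  have inv_T: "(inverse (fst z), inverse (snd z)) \<in> torus" if "z \<in> torus" for z
    using that by (auto simp: torus_def norm_inverse)
  have mult_T: "(fst z * fst w, snd z * snd w) \<in> torus" if "z \<in> torus" "w \<in> torus" for z w
    using that by (auto simp: torus_def norm_mult)
  show "(inverse (fst t), inverse (snd t)) \<in> face_torus P lam F" if "t \<in> face_torus P lam F"
    using that inv_e [of t] inv_T [of t] unfolding T by (simp split: if_split_asm)
  show "(fst t * fst s, snd t * snd s) \<in> face_torus P lam F"
    if "t \<in> face_torus P lam F" "s \<in> face_torus P lam F"
    using that mult_e [of t s] mult_T [of t s] unfolding T by (simp split: if_split_asm)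
qed

lemma equiv_orbifold_rel: "equiv (P \<times> torus) (orbifold_rel P lam)"
proof (rule equivI)
  show "orbifold_rel P lam \<subseteq> (P \<times> torus) \<times> (P \<times> torus)"
    by (auto simp: orbifold_rel_def)
  have nz: "inverse (fst t) * fst t = 1" "inverse (snd t) * snd t = 1" if "t \<in> torus" for t
    using that by (auto simp: torus_def intro!: left_inverse)
  have mem: "((x, t), (y, s)) \<in> orbifold_rel P lam \<longleftrightarrow>
      x \<in> P \<and> y \<in> P \<and> t \<in> torus \<and> s \<in> torus \<and> x = y \<and>
      (inverse (fst t) * fst s, inverse (snd t) * snd s) \<in> face_torus P lam (minimal_face P x)"
    for x t y s
    by (simp add: orbifold_rel_def)
  show "refl_on (P \<times> torus) (orbifold_rel P lam)"
  proof (rule refl_onI)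
    fix a assume "a \<in> P \<times> torus"
    then show "(a, a) \<in> orbifold_rel P lam"
      by (cases a) (simp only: mem mem_Sigma_iff nz face_torus_group(2) simp_thms)
  qed
  show "sym (orbifold_rel P lam)"
  proof (rule symI)
    fix a b assume ab: "(a, b) \<in> orbifold_rel P lam"
    obtain x t y s where [simp]: "a = (x, t)" "b = (y, s)"
      by (metis surj_pair)
    show "(b, a) \<in> orbifold_rel P lam"
      using ab face_torus_group(3) [of "(inverse (fst t) * fst s, inverse (snd t) * snd s)" P lam "minimal_face P x"]
      by (auto simp: mem mult.commute)
  qed
  show "trans (orbifold_rel P lam)"
  proof (rule transI)
    fix a b c assume ab: "(a, b) \<in> orbifold_rel P lam" and bc: "(b, c) \<in> orbifold_rel P lam"
    obtain x t y s z r where [simp]: "a = (x, t)" "b = (y, s)" "c = (z, r)"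
      by (metis surj_pair)
    have s: "fst s \<noteq> 0" "snd s \<noteq> 0"
      using ab by (auto simp: mem torus_def)
    have "inverse (fst t) * fst s * (inverse (fst s) * fst r) = inverse (fst t) * fst r"
      "inverse (snd t) * snd s * (inverse (snd s) * snd r) = inverse (snd t) * snd r"
      using s by simp_all
    note eq = this
    have [simp]: "y = x" "z = x"
      using ab bc by (auto simp: mem)
    have "(inverse (fst t) * fst r, inverse (snd t) * snd r) \<in> face_torus P lam (minimal_face P x)"
      using ab bc face_torus_group(4) [of "(inverse (fst t) * fst s, inverse (snd t) * snd s)" P lam
          "minimal_face P x" "(inverse (fst s) * fst r, inverse (snd s) * snd r)"]
      unfolding fst_conv snd_conv eq by (simp add: mem)
    then show "(a, c) \<in> orbifold_rel P lam"
      using ab bc by (simp add: mem)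
  qed
qed

end

theory Submission
  imports Defs
begin

text \<open>
  The orbifold \<open>X\<close> is covered by the open stars of the vertices: the parts lying over the points
  of \<open>P\<close> that are on no edge other than the two at the given vertex. Pushing a star of \<open>P\<close> towards
  its centre is compatible with the identifications that define \<open>X\<close>. So \<open>X\<close> is contractible over
  the star of a vertex; over the star of an edge \<open>E i\<close> it is the circle \<open>T\<^sup>2 / T\<^sub>E\<close>, via the character
  \<open>chi i\<close> of \<open>T\<^sup>2\<close> with kernel \<open>T\<^sub>E\<close>; and over the interior it is the torus (\<open>region_modelI\<close>). If the
  stars of the vertices 1 to \<open>n + 1\<close> are glued one after the other, each new one meets the previous
  ones over an edge, that is, in a circle. By the Mayer-Vietoris sequence it adds one class of
  degree 2, the sphere \<open>sphere_cycle i\<close> formed by two disks with the same boundary loop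
  (\<open>chain_star_homology\<close>). The star of the last vertex is glued along a punctured neighbourhood of
  the point over that vertex. Smoothness makes this a 3-sphere, the union of two solid tori, so
  that one class of degree 4 is added and nothing else (\<open>X_homology\<close>).

  The homology is thus free, with explicit bases, and a cohomology class of positive degree is the
  same as an arbitrary assignment of values to the basis cycles (\<open>cocycle_with_values\<close>,
  \<open>coboundary_if_vanishes_on_cycles\<close>). This rests on the splitting of the boundary map of the
  singular complex: its image, a subgroup of a free abelian group, is free
  (\<open>free_abelian_section\<close>). The classes \<open>u i\<close> and \<open>v\<close> are dual to the spheres and to the
  fundamental cycle.

  To evaluate \<open>u i \<union> u j\<close> for \<open>i \<le> j\<close> (\<open>cup_fundamental_cycle\<close>), note that \<open>u i\<close> is zero on the
  spheres with index greater than \<open>i\<close>, and is therefore represented by a cocycle that vanishes on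
  the stars of the vertices \<open>i + 1\<close> to \<open>n + 1\<close>. Likewise \<open>u j\<close> is represented by a cocycle that
  vanishes on the stars of the vertices 1 to \<open>j\<close>. As \<open>i \<le> j\<close>, the product of the two cocycles lives
  over the star of the smooth vertex. There they are coboundaries, of \<open>\<beta>\<close> and \<open>\<gamma>\<close>, and two
  applications of the Leibniz rule reduce the product first to the 3-sphere and then to the torus
  along which the two solid tori meet. On the torus, the value of \<open>\<beta> \<union> \<gamma>\<close> is
  \<open>\<beta> (1, 0) \<gamma> (0, 1) - \<beta> (0, 1) \<gamma> (1, 0)\<close>, where \<open>(1, 0)\<close> and \<open>(0, 1)\<close> stand for the coordinate
  loops; and the value of \<open>\<beta>\<close> or \<open>\<gamma>\<close> on a loop is that of the cocycle for \<open>u i\<close> or \<open>u j\<close> on a disk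
  which the loop bounds. Each coordinate loop bounds over one of the edges at the smooth vertex, so
  the disk can be moved to the star of the vertex 1, for \<open>(0, 1)\<close>, or \<open>n + 1\<close>, for \<open>(1, 0)\<close>. On the
  first the cocycle for \<open>u j\<close> vanishes, and on the second that for \<open>u i\<close>; in particular
  \<open>\<beta> (1, 0) = 0\<close>. Now two disks with boundary the loop \<open>\<mu>\<close>, in the stars of the vertices 1 and
  \<open>n + 1\<close>, differ up to boundaries by the sum of the spheres with coefficients \<open>det (\<lambda> (E k), \<mu>)\<close>
  (\<open>disk_relation\<close>). These determinants are \<open>a k\<close> for \<open>\<mu> = (0, 1)\<close> and \<open>- b k\<close> for \<open>\<mu> = (1, 0)\<close>,
  so \<open>\<beta> (0, 1) = a i\<close> and \<open>\<gamma> (1, 0) = b j\<close>. A sign from the Leibniz rule turns the resulting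
  \<open>- a i * b j\<close> into \<open>a i * b j\<close>.
\<close>

section \<open>Bases of singular homology\<close>

abbreviation cycle :: "nat \<Rightarrow> 'a topology \<Rightarrow> 'a chain \<Rightarrow> bool"
  where "cycle p X \<equiv> singular_relcycle p X {}"

abbreviation bounds :: "nat \<Rightarrow> 'a topology \<Rightarrow> 'a chain \<Rightarrow> bool"
  where "bounds p X \<equiv> singular_relboundary p X {}"

abbreviation comb :: "'i set \<Rightarrow> ('i \<Rightarrow> int) \<Rightarrow> ('i \<Rightarrow> 'a chain) \<Rightarrow> 'a chain"
  where "comb I c h \<equiv> (\<Sum>i\<in>I. frag_cmul (c i) (h i))"

text \<open>Cycles whose classes form a \<open>\<int>\<close>-basis of the homology in degree \<open>p\<close>. Working with the cycles
  themselves, rather than with their classes, allows cochains to be evaluated on them and on the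
  chains that they bound.\<close>

definition homology_basis :: "nat \<Rightarrow> 'a topology \<Rightarrow> 'i set \<Rightarrow> ('i \<Rightarrow> 'a chain) \<Rightarrow> bool"
  where "homology_basis p X I h \<longleftrightarrow> finite I \<and> (\<forall>i\<in>I. cycle p X (h i)) \<and>
    (\<forall>z. cycle p X z \<longrightarrow> (\<exists>c. bounds p X (z - comb I c h))) \<and>
    (\<forall>c. bounds p X (comb I c h) \<longrightarrow> (\<forall>i\<in>I. c i = 0))"

lemma homology_basisD:
  assumes "homology_basis p X I h"
  shows "finite I" "\<And>i. i \<in> I \<Longrightarrow> cycle p X (h i)"
    "\<And>c i. bounds p X (comb I c h) \<Longrightarrow> i \<in> I \<Longrightarrow> c i = 0"
  using assms by (auto simp: homology_basis_def)

lemma homology_basis_span: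
  assumes "homology_basis p X I h" "cycle p X z"
  obtains c where "bounds p X (z - comb I c h)"
  using assms unfolding homology_basis_def by blast

lemma bounds_sum: "(\<And>i. i \<in> I \<Longrightarrow> bounds p X (f i)) \<Longrightarrow> bounds p X (sum f I)"
  by (induction I rule: infinite_finite_induct) (auto simp: singular_relboundary_add)

lemma bounds_iff: "bounds p X c \<longleftrightarrow> (\<exists>d. singular_chain (Suc p) X d \<and> chain_boundary (Suc p) d = c)"
  by (rule singular_boundary)

lemma bounds_boundary: "singular_chain (Suc p) X d \<Longrightarrow> bounds p X (chain_boundary (Suc p) d)"
  by (auto simp: bounds_iff)

lemma bounds_imp_cycle: "bounds p X c \<Longrightarrow> cycle p X c"
  by (simp add: singular_relboundary_imp_relcycle)

lemma comb_cycle: "(\<And>i. i \<in> I \<Longrightarrow> cycle p X (h i)) \<Longrightarrow> cycle p X (comb I c h)"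
  by (intro singular_relcycle_sum singular_relcycle_cmul)

lemma comb_chain: "(\<And>i. i \<in> I \<Longrightarrow> singular_chain p X (h i)) \<Longrightarrow> singular_chain p X (comb I c h)"
  by (intro singular_chain_sum singular_chain_cmul)

lemma chain_boundary_comb: "chain_boundary p (comb I c h) = comb I c (\<lambda>i. chain_boundary p (h i))"
  by (simp add: chain_boundary_sum chain_boundary_cmul o_def)

lemma comb_diff: "comb I c h - comb I d h = comb I (\<lambda>i. c i - d i) h"
  by (simp add: sum_subtractf frag_cmul_diff_distrib)

lemma comb_add: "comb I c h + comb I d h = comb I (\<lambda>i. c i + d i) h"
  by (simp add: sum.distrib frag_cmul_distrib)

lemma bounds_trans:
  "bounds p X (x - y) \<Longrightarrow> bounds p X (y - z) \<Longrightarrow> bounds p X (x - z)"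
  using singular_relboundary_add by fastforce

lemma bounds_commute: "bounds p X (x - y) \<Longrightarrow> bounds p X (y - x)"
  by (metis minus_diff_eq singular_relboundary_minus)

lemma homology_basis_emptyI:
  assumes "\<And>z. cycle p X z \<Longrightarrow> bounds p X z"
  shows "homology_basis p X {} h"
  using assms by (simp add: homology_basis_def)

lemma homology_basis_emptyD: "homology_basis p X {} h \<Longrightarrow> cycle p X z \<Longrightarrow> bounds p X z"
  by (simp add: homology_basis_def)

lemma homology_basis_empty_any: "homology_basis p X {} h \<Longrightarrow> homology_basis p X {} h'"
  by (simp add: homology_basis_def)

lemma homology_basis_reindex:
  assumes h: "homology_basis p X I h" and f: "bij_betw f J I" and eq: "\<And>j. j \<in> J \<Longrightarrow> h (f j) = g j"
  shows "homology_basis p X J g"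
proof -
  define f' where "f' = the_inv_into J f"
  have I: "I = f ` J" and inj: "inj_on f J"
    using f by (auto simp: bij_betw_def)
  have comb: "comb I c h = comb J (c \<circ> f) g" for c
    unfolding I using inj by (simp add: sum.reindex eq)
  have "finite J"
    using h f bij_betw_finite by (auto simp: homology_basis_def)
  moreover have "cycle p X (g j)" if "j \<in> J" for j
    using that h eq I by (force simp: homology_basis_def)
  moreover have "\<exists>c. bounds p X (z - comb J c g)" if "cycle p X z" for z
    using homology_basis_span [OF h that] unfolding comb by metis
  moreover have "c j = 0" if "bounds p X (comb J c g)" "j \<in> J" for c j
  proof -
    have "comb I (c \<circ> f') h = comb J c g"
      unfolding comb by (rule sum.cong) (auto simp: f'_def the_inv_into_f_f inj)
    then have "(c \<circ> f') (f j) = 0"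
      using homology_basisD(3) [OF h] that I by force
    then show ?thesis
      using that by (simp add: f'_def the_inv_into_f_f inj)
  qed
  ultimately show ?thesis
    by (auto simp: homology_basis_def)
qed

lemma homology_basis_change:
  assumes h: "homology_basis p X I h" and g: "\<And>i. i \<in> I \<Longrightarrow> bounds p X (g i - h i)"
  shows "homology_basis p X I g"
proof -
  have diff: "bounds p X (comb I c g - comb I c h)" for c
  proof -
    have "comb I c g - comb I c h = (\<Sum>i\<in>I. frag_cmul (c i) (g i - h i))"
      by (simp add: sum_subtractf [symmetric]) (metis (no_types, lifting) add_diff_cancel_right' diff_add_cancel frag_cmul_distrib2)
    then show ?thesis
      by (simp add: bounds_sum g singular_relboundary_cmul)
  qed
  have "cycle p X (g i)" if "i \<in> I" for i
    using homology_basisD(2) [OF h that] bounds_imp_cycle [OF g [OF that]] singular_relcycle_add by fastforce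
  moreover have "\<exists>c. bounds p X (z - comb I c g)" if z: "cycle p X z" for z
  proof -
    obtain c where "bounds p X (z - comb I c h)"
      using homology_basis_span [OF h z] .
    then show ?thesis
      using bounds_trans bounds_commute diff by blast
  qed
  moreover have "c i = 0" if "bounds p X (comb I c g)" "i \<in> I" for c i
  proof -
    have "bounds p X (comb I c h)"
      using singular_relboundary_diff [OF that(1) diff [of c]] by simp
    then show ?thesis
      using homology_basisD(3) [OF h] that by blast
  qed
  ultimately show ?thesis
    using homology_basisD(1) [OF h] by (auto simp: homology_basis_def)
qed

section \<open>The Mayer-Vietoris sequence on chains\<close>

lemma singular_chain_Int:
  "singular_chain p (subtopology X U) c \<Longrightarrow> singular_chain p (subtopology X V) c
    \<Longrightarrow> singular_chain p (subtopology X (U \<inter> V)) c"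
  unfolding singular_chain_subtopology by blast

lemma singular_chain_Un:
  assumes "singular_chain p (subtopology X U) a" "singular_chain p (subtopology X V) b"
  shows "singular_chain p (subtopology X (U \<union> V)) (a + b)" 
  by (meson assms singular_chain_add singular_chain_mono sup_ge1 sup_ge2)

text \<open>Sufficiently fine barycentric subdivision makes every simplex small enough to lie in one of the
  two open sets.\<close>

lemma iterated_subdivision_splits:
  assumes U: "openin X U" and V: "openin X V" and e: "singular_chain p (subtopology X (U \<union> V)) e"
  obtains n a b where "singular_chain p (subtopology X U) a" "singular_chain p (subtopology X V) b"
    "(singular_subdivision p ^^ n) e = a + b"
proof -
  let ?W = "subtopology X (U \<union> V)"
  have op: "openin ?W S" if "S \<in> {U, V}" for S
    using that U V by (auto intro: openin_subtopology_Int2 simp: openin_subtopology_alt)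
  have cov: "topspace ?W \<subseteq> \<Union>{U, V}"
    by auto
  obtain n where n: "\<And>m f. \<lbrakk>n \<le> m; f \<in> Poly_Mapping.keys ((singular_subdivision p ^^ m) e)\<rbrakk>
                      \<Longrightarrow> \<exists>V \<in> {U, V}. f \<in> (standard_simplex p) \<rightarrow> V"
    by (rule sufficient_iterated_singular_subdivision_exists [OF op cov e]) blast+
  let ?e = "(singular_subdivision p ^^ n) e"
  have sc: "singular_chain p ?W ((singular_subdivision p ^^ m) e)" for m
    by (induction m) (auto simp: e singular_chain_singular_subdivision)
  have "Poly_Mapping.keys ?e \<subseteq> singular_simplex_set p (subtopology X U) \<union> singular_simplex_set p (subtopology X V)"
  proof
    fix f assume f: "f \<in> Poly_Mapping.keys ?e"
    then have "singular_simplex p X f"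
      using sc [of n] by (auto simp: singular_chain_def singular_simplex_subtopology)
    moreover have "f \<in> standard_simplex p \<rightarrow> U \<or> f \<in> standard_simplex p \<rightarrow> V"
      using n [OF order_refl f] by auto
    ultimately show "f \<in> singular_simplex_set p (subtopology X U) \<union> singular_simplex_set p (subtopology X V)"
      by (auto simp: singular_simplex_subtopology)
  qed
  then obtain a b where "?e = a + b" "Poly_Mapping.keys a \<subseteq> singular_simplex_set p (subtopology X U)"
    "Poly_Mapping.keys b \<subseteq> singular_simplex_set p (subtopology X V)"
    using frag_split by metis
  then show thesis
    using that by (simp add: singular_chain_def)
qed

lemma small_cycle_exists:
  assumes U: "openin X U" and V: "openin X V" and z: "cycle p (subtopology X (U \<union> V)) z"
  obtains a b where "singular_chain p (subtopology X U) a" "singular_chain p (subtopology X V) b"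
    "bounds p (subtopology X (U \<union> V)) (z - (a + b))"
proof -
  have zc: "singular_chain p (subtopology X (U \<union> V)) z" "chain_boundary p z = 0"
    using z by (auto simp: singular_cycle)
  obtain n a b where ab: "singular_chain p (subtopology X U) a" "singular_chain p (subtopology X V) b"
    "(singular_subdivision p ^^ n) z = a + b"
    using iterated_subdivision_splits [OF U V zc(1)] .
  obtain h where h: "\<And>p. h p 0 = (0 :: 'a chain)"
        "\<And>p X c. singular_chain p X c \<Longrightarrow> singular_chain (Suc p) X (h p c)"
        "\<And>p X c. singular_chain p X c
                 \<Longrightarrow> chain_boundary (Suc p) (h p c) + h (p - Suc 0) (chain_boundary p c)
                   = (singular_subdivision p ^^ n) c - c"
    using chain_homotopic_iterated_singular_subdivision [of n thesis] by blast
  have "chain_boundary (Suc p) (h p z) = (a + b) - z"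
    using h(3) [OF zc(1)] by (simp add: zc h ab)
  then have "bounds p (subtopology X (U \<union> V)) ((a + b) - z)"
    using h(2) [OF zc(1)] by (auto simp: bounds_iff)
  then show thesis
    using that ab bounds_commute by blast
qed

text \<open>Subdividing a chain bounded by \<open>x + y\<close> changes its boundary into the subdivision of \<open>x + y\<close>. The
  chain homotopy between subdivision and identity is natural, so it takes \<open>x\<close> to a chain in \<open>U\<close>
  and \<open>y\<close> to a chain in \<open>V\<close>, and these undo the change.\<close>

lemma small_boundary_exists:
  assumes U: "openin X U" and V: "openin X V"
    and x: "singular_chain p (subtopology X U) x" and y: "singular_chain p (subtopology X V) y"
    and xy: "bounds p (subtopology X (U \<union> V)) (x + y)"
  obtains a b where "singular_chain (Suc p) (subtopology X U) a" "singular_chain (Suc p) (subtopology X V) b"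
    "chain_boundary (Suc p) (a + b) = x + y"
proof -
  obtain e where e: "singular_chain (Suc p) (subtopology X (U \<union> V)) e" "chain_boundary (Suc p) e = x + y"
    using xy by (auto simp: bounds_iff)
  obtain n a b where ab: "singular_chain (Suc p) (subtopology X U) a" "singular_chain (Suc p) (subtopology X V) b"
    "(singular_subdivision (Suc p) ^^ n) e = a + b"
    using iterated_subdivision_splits [OF U V e(1)] .
  obtain h where h: "\<And>p. h p 0 = (0 :: 'a chain)"
        "\<And>p c1 c2. h p (c1-c2) = h p c1 - h p c2"
        "\<And>p X c. singular_chain p X c \<Longrightarrow> singular_chain (Suc p) X (h p c)"
        "\<And>p X c. singular_chain p X c
                 \<Longrightarrow> chain_boundary (Suc p) (h p c) + h (p - Suc 0) (chain_boundary p c)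
                   = (singular_subdivision p ^^ n) c - c"
    using chain_homotopic_iterated_singular_subdivision [of n thesis] by blast
  have add: "h p (x + y) = h p x + h p y"
    using h(2) [of p x "- y"] h(2) [of p 0 y] by (simp add: h(1))
  have "chain_boundary (Suc (Suc p)) (h (Suc p) e) + (h p x + h p y) = a + b - e"
    using h(4) [OF e(1)] by (simp add: e add ab)
  then have "chain_boundary (Suc p) (chain_boundary (Suc (Suc p)) (h (Suc p) e) + (h p x + h p y))
      = chain_boundary (Suc p) (a + b - e)"
    by simp
  moreover have "chain_boundary (Suc p) (chain_boundary (Suc (Suc p)) (h (Suc p) e)) = 0"
    using chain_boundary_boundary_alt h(3) e(1) by blast
  ultimately have "chain_boundary (Suc p) (h p x + h p y) = chain_boundary (Suc p) (a + b) - (x + y)"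
    by (simp add: chain_boundary_add chain_boundary_diff e)
  then have "chain_boundary (Suc p) ((a - h p x) + (b - h p y)) = x + y"
    by (simp add: chain_boundary_add chain_boundary_diff algebra_simps)
  moreover have "singular_chain (Suc p) (subtopology X U) (a - h p x)"
    "singular_chain (Suc p) (subtopology X V) (b - h p y)"
    using ab x y h by (auto intro: singular_chain_diff)
  ultimately show thesis
    using that by blast
qed

lemma comb_Plus:
  assumes "finite I" "finite K"
  shows "comb (I <+> K) c h = comb I (c \<circ> Inl) (h \<circ> Inl) + comb K (c \<circ> Inr) (h \<circ> Inr)"
  using assms by (simp add: sum.Plus)

text \<open>Exactness of \<open>H(U) \<oplus> H(V) \<rightarrow> H(U \<union> V) \<rightarrow> H(U \<inter> V) \<rightarrow> H(U) \<oplus> H(V)\<close> in terms of bases. The family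
  \<open>x\<close> is a basis of the image of the first map, and the boundaries of the chains \<open>a k\<close> are a basis
  of the kernel of the last one; they are lifted to \<open>H(U \<union> V)\<close> by filling them once in \<open>U\<close>, by
  \<open>a k\<close>, and once in \<open>V\<close>, by \<open>b k\<close>. That the first map need only be known on \<open>U \<union> V\<close> spares a
  separate description of the homology of \<open>U\<close> and \<open>V\<close>.\<close>

proposition mayer_vietoris_basis:
  fixes x :: "'i \<Rightarrow> 'a chain" and a b :: "'k \<Rightarrow> 'a chain"
  assumes U: "openin X U" and V: "openin X V" and fin: "finite I" "finite K"
    and x: "\<And>i. i \<in> I \<Longrightarrow> cycle (Suc p) (subtopology X U) (x i)"
    and spanU: "\<And>z. cycle (Suc p) (subtopology X U) z
        \<Longrightarrow> \<exists>c. bounds (Suc p) (subtopology X (U \<union> V)) (z - comb I c x)"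
    and spanV: "\<And>z. cycle (Suc p) (subtopology X V) z
        \<Longrightarrow> \<exists>c. bounds (Suc p) (subtopology X (U \<union> V)) (z - comb I c x)"
    and indep: "\<And>c i. bounds (Suc p) (subtopology X (U \<union> V)) (comb I c x) \<Longrightarrow> i \<in> I \<Longrightarrow> c i = 0"
    and a: "\<And>k. k \<in> K \<Longrightarrow> singular_chain (Suc p) (subtopology X U) (a k)"
    and b: "\<And>k. k \<in> K \<Longrightarrow> singular_chain (Suc p) (subtopology X V) (b k)"
    and ab: "\<And>k. k \<in> K \<Longrightarrow> chain_boundary (Suc p) (b k) = chain_boundary (Suc p) (a k)"
    and spanK: "\<And>m. \<lbrakk>cycle p (subtopology X (U \<inter> V)) m; bounds p (subtopology X U) m; bounds p (subtopology X V) m\<rbrakk>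
        \<Longrightarrow> \<exists>d. bounds p (subtopology X (U \<inter> V)) (m - comb K d (\<lambda>k. chain_boundary (Suc p) (a k)))"
    and indepK: "\<And>d k. bounds p (subtopology X (U \<inter> V)) (comb K d (\<lambda>k. chain_boundary (Suc p) (a k))) \<Longrightarrow> k \<in> K
        \<Longrightarrow> d k = 0"
  shows "homology_basis (Suc p) (subtopology X (U \<union> V)) (I <+> K) (case_sum x (\<lambda>k. a k - b k))"
proof -
  let ?W = "subtopology X (U \<union> V)" and ?M = "subtopology X (U \<inter> V)"
  let ?h = "case_sum x (\<lambda>k. a k - b k)"
  note up = singular_chain_mono [where S = "U \<union> V"] singular_cycle_mono [where S = "U \<union> V"]
  have comb: "comb (I <+> K) c ?h = comb I (c \<circ> Inl) x + comb K (c \<circ> Inr) (\<lambda>k. a k - b k)" for c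
    unfolding comb_Plus [OF fin] by simp
  have combK: "comb K d (\<lambda>k. a k - b k) = comb K d a - comb K d b" for d
    unfolding sum_subtractf [symmetric]
    by (rule sum.cong) (auto, metis (no_types, lifting) add_diff_cancel_right' diff_add_cancel frag_cmul_distrib2)
  have bdyK: "chain_boundary (Suc p) (comb K d b) = comb K d (\<lambda>k. chain_boundary (Suc p) (a k))"
    "chain_boundary (Suc p) (comb K d a) = comb K d (\<lambda>k. chain_boundary (Suc p) (a k))" for d
    unfolding chain_boundary_comb by (auto intro!: sum.cong simp: ab)
  have "cycle (Suc p) ?W (?h i)" if "i \<in> I <+> K" for i
  proof (cases i)
    case (Inl j)
    then show ?thesis using x [of j] that up(2) [of _ X U] by auto
  next
    case (Inr k)
    then have k: "k \<in> K" using that by auto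
    have "singular_chain (Suc p) ?W (a k - b k)"
      using a [OF k] b [OF k] by (auto intro!: singular_chain_diff elim: up(1))
    then show ?thesis
      using k by (simp add: Inr singular_cycle chain_boundary_diff ab)
  qed
  moreover have "\<exists>c. bounds (Suc p) ?W (z - comb (I <+> K) c ?h)" if z: "cycle (Suc p) ?W z" for z
  proof -
    obtain u v where u: "singular_chain (Suc p) (subtopology X U) u"
      and v: "singular_chain (Suc p) (subtopology X V) v"
      and zuv: "bounds (Suc p) ?W (z - (u + v))"
      using small_cycle_exists [OF U V z] .
    have "cycle (Suc p) ?W (u + v)"
      using singular_relcycle_diff [OF z bounds_imp_cycle [OF zuv]] by (simp add: add.commute)
    then have uv: "chain_boundary (Suc p) v = - chain_boundary (Suc p) u"
      by (simp add: singular_cycle chain_boundary_add eq_neg_iff_add_eq_0 add.commute)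
    \<comment> \<open>The connecting homomorphism takes the class of \<open>z\<close> to that of \<open>?m\<close>.\<close>
    let ?m = "chain_boundary (Suc p) u"
    have mU: "bounds p (subtopology X U) ?m"
      by (rule bounds_boundary [OF u])
    have mV: "bounds p (subtopology X V) ?m"
      using bounds_boundary [OF v] by (simp add: uv singular_relboundary_minus)
    have "cycle p ?M ?m"
      using bounds_imp_cycle [OF mU] bounds_imp_cycle [OF mV]
      by (auto simp: singular_cycle intro: singular_chain_Int)
    then obtain d where "bounds p ?M (?m - comb K d (\<lambda>k. chain_boundary (Suc p) (a k)))"
      using spanK [OF _ mU mV] by blast
    then obtain w where w: "singular_chain (Suc p) ?M w"
      and dw: "chain_boundary (Suc p) w = ?m - comb K d (\<lambda>k. chain_boundary (Suc p) (a k))"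
      by (auto simp: bounds_iff)
    have wUV: "singular_chain (Suc p) (subtopology X U) w" "singular_chain (Suc p) (subtopology X V) w"
      using w singular_chain_mono by blast+
    \<comment> \<open>With the lifted classes removed, the two pieces of \<open>z\<close> become cycles of \<open>U\<close> and of \<open>V\<close>.\<close>
    let ?u = "u - comb K d a - w" and ?v = "v + comb K d b + w"
    have "cycle (Suc p) (subtopology X U) ?u"
      using u a wUV by (auto simp: singular_cycle chain_boundary_diff bdyK dw
          intro!: singular_chain_diff comb_chain)
    moreover have "cycle (Suc p) (subtopology X V) ?v"
      using v b wUV by (auto simp: singular_cycle chain_boundary_add bdyK dw uv
          intro!: singular_chain_add comb_chain)
    ultimately obtain c c' where c: "bounds (Suc p) ?W (?u - comb I c x)"
      and c': "bounds (Suc p) ?W (?v - comb I c' x)"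
      using spanU spanV by meson
    define q where "q = case_sum (\<lambda>i. c i + c' i) d"
    have "z - comb (I <+> K) q ?h = (z - (u + v)) + ((?u - comb I c x) + (?v - comb I c' x))"
      unfolding comb combK by (simp add: q_def o_def algebra_simps comb_add [symmetric])
    then have "bounds (Suc p) ?W (z - comb (I <+> K) q ?h)"
      using zuv c c' by (simp only:) (intro singular_relboundary_add)
    then show ?thesis by (rule exI [of _ q])
  qed
  moreover have "c i = 0" if c: "bounds (Suc p) ?W (comb (I <+> K) c ?h)" and i: "i \<in> I <+> K" for c i
  proof -
    let ?x = "comb I (c \<circ> Inl) x + comb K (c \<circ> Inr) a" and ?y = "- comb K (c \<circ> Inr) b"
    have xU: "singular_chain (Suc p) (subtopology X U) ?x"
      using x a by (auto intro!: singular_chain_add comb_chain simp: singular_cycle)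
    have yV: "singular_chain (Suc p) (subtopology X V) ?y"
      using b by (auto intro!: comb_chain simp: singular_chain_minus)
    have eq: "comb (I <+> K) c ?h = ?x + ?y"
      unfolding comb combK by (simp add: algebra_simps)
    have "bounds (Suc p) ?W (?x + ?y)"
      using c unfolding eq .
    then obtain u v where u: "singular_chain (Suc (Suc p)) (subtopology X U) u"
      and v: "singular_chain (Suc (Suc p)) (subtopology X V) v"
      and duv: "chain_boundary (Suc (Suc p)) (u + v) = ?x + ?y"
      by (rule small_boundary_exists [OF U V xU yV])
    \<comment> \<open>\<open>w\<close> lies in the intersection and its boundary is the combination of the boundaries of the \<open>a k\<close>,
      which forces the coefficients of the lifted classes to vanish.\<close>
    define w where "w = ?x - chain_boundary (Suc (Suc p)) u"
    have w2: "w = chain_boundary (Suc (Suc p)) v - ?y"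
      using duv by (simp add: w_def chain_boundary_add algebra_simps)
    have "singular_chain (Suc p) (subtopology X U) w"
      unfolding w_def by (intro singular_chain_diff xU singular_chain_boundary_alt u)
    moreover have "singular_chain (Suc p) (subtopology X V) w"
      unfolding w2 by (intro singular_chain_diff yV singular_chain_boundary_alt v)
    ultimately have wM: "singular_chain (Suc p) ?M w"
      by (rule singular_chain_Int)
    have "chain_boundary (Suc p) (comb I (c \<circ> Inl) x) = 0"
      using comb_cycle [where I = I and c = "c \<circ> Inl" and h = x, OF x] by (simp add: singular_cycle)
    then have "chain_boundary (Suc p) w = comb K (c \<circ> Inr) (\<lambda>k. chain_boundary (Suc p) (a k))"
      by (simp add: w_def chain_boundary_diff chain_boundary_add bdyK chain_boundary_boundary_alt [OF u] del: o_apply)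
    then have "bounds p ?M (comb K (c \<circ> Inr) (\<lambda>k. chain_boundary (Suc p) (a k)))"
      using wM by (auto simp: bounds_iff)
    then have K0: "(c \<circ> Inr) k = 0" if "k \<in> K" for k
      using indepK [where d = "c \<circ> Inr" and k = k] that by (simp only:)
    then have "comb (I <+> K) c ?h = comb I (c \<circ> Inl) x"
      unfolding comb by simp
    then have "(c \<circ> Inl) i = 0" if "i \<in> I" for i
      using indep [where c = "c \<circ> Inl" and i = i] c that by (simp only:)
    with K0 show ?thesis
      using i by auto
  qed
  ultimately show ?thesis
    unfolding homology_basis_def using fin by (simp only: finite_Plus_iff) blast
qed

section \<open>Cocycles and functionals on cycles\<close>

text \<open>A homomorphism from a subgroup \<open>C\<close> of a free abelian group to a free abelian group splits over
  its image, because the image is a subgroup of a free abelian group and hence free. The section is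
  constructed directly: \<open>P S G\<close> expresses that \<open>G\<close> is the graph of a section over the elements of
  the image supported in \<open>S\<close>. By Zorn's lemma there is a maximal such pair. If \<open>S\<close> missed a
  generator \<open>e\<close>, the coefficients at \<open>e\<close> of the elements of the image supported in \<open>insert e S\<close>
  would form a subgroup of \<open>\<int>\<close>, and choosing any preimage of an element \<open>b0\<close> whose coefficient
  generates this subgroup would extend the section.\<close>

proposition free_abelian_section:
  fixes d :: "('b \<Rightarrow>\<^sub>0 int) \<Rightarrow> ('a \<Rightarrow>\<^sub>0 int)" and C :: "('b \<Rightarrow>\<^sub>0 int) set"
  assumes C0: "0 \<in> C" and Cd: "\<And>x y. x \<in> C \<Longrightarrow> y \<in> C \<Longrightarrow> x - y \<in> C"
    and Cm: "\<And>k x. x \<in> C \<Longrightarrow> frag_cmul k x \<in> C"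
    and dd: "\<And>x y. d (x - y) = d x - d y" and dm: "\<And>k x. d (frag_cmul k x) = frag_cmul k (d x)"
  obtains s where "\<And>b. b \<in> d ` C \<Longrightarrow> s b \<in> C \<and> d (s b) = b"
    "\<And>b b'. b \<in> d ` C \<Longrightarrow> b' \<in> d ` C \<Longrightarrow> s (b + b') = s b + s b'"
proof -
  define P where "P S G \<longleftrightarrow> (\<forall>(b, c)\<in>G. c \<in> C \<and> d c = b \<and> Poly_Mapping.keys b \<subseteq> S) \<and> (0, 0) \<in> G \<and>
     (\<forall>(b, c)\<in>G. \<forall>(b', c')\<in>G. (b - b', c - c') \<in> G) \<and>
     (\<forall>c. (0, c) \<in> G \<longrightarrow> c = 0) \<and>
     (\<forall>b\<in>d ` C. Poly_Mapping.keys b \<subseteq> S \<longrightarrow> b \<in> Domain G)"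
     for S :: "'a set" and G :: "(('a \<Rightarrow>\<^sub>0 int) \<times> ('b \<Rightarrow>\<^sub>0 int)) set"
  have d0: "d 0 = 0"
    using dd [of 0 0] by simp
  have PI: "P S G" if "\<And>b c. (b, c) \<in> G \<Longrightarrow> c \<in> C \<and> d c = b \<and> Poly_Mapping.keys b \<subseteq> S" "(0, 0) \<in> G"
    "\<And>b c b' c'. (b, c) \<in> G \<Longrightarrow> (b', c') \<in> G \<Longrightarrow> (b - b', c - c') \<in> G"
    "\<And>c. (0, c) \<in> G \<Longrightarrow> c = 0" "\<And>b. b \<in> d ` C \<Longrightarrow> Poly_Mapping.keys b \<subseteq> S \<Longrightarrow> b \<in> Domain G" for S G
    unfolding P_def using that by blast
  have PD: "c \<in> C" "d c = b" "Poly_Mapping.keys b \<subseteq> S" if "P S G" "(b, c) \<in> G" for S G b c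
    using that unfolding P_def by blast+
  have P0: "(0, 0) \<in> G" if "P S G" for S G
    using that unfolding P_def by blast
  have Pdiff: "(b - b', c - c') \<in> G" if "P S G" "(b, c) \<in> G" "(b', c') \<in> G" for S G b c b' c'
    using that unfolding P_def by blast
  have Psv: "c = 0" if "P S G" "(0, c) \<in> G" for S G c
    using that unfolding P_def by blast
  have Pdom: "b \<in> Domain G" if "P S G" "b \<in> d ` C" "Poly_Mapping.keys b \<subseteq> S" for S G b
    using that unfolding P_def by blast
  \<comment> \<open>The pair is coded as a subset of a sum type, so that componentwise inclusion becomes inclusion.\<close>
  define A where "A = {T. P (Inr -` T) (Inl -` T)}"
  have "\<exists>M\<in>A. \<forall>X\<in>A. M \<subseteq> X \<longrightarrow> X = M"
  proof (rule subset_Zorn_nonempty)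
    have "P {} {(0, 0)}"
      by (rule PI) (auto simp: d0 C0)
    then have "Inl ` {(0, 0)} \<in> A"
      unfolding A_def by (auto simp: vimage_def)
    then show "A \<noteq> {}" by blast
  next
    fix \<C> assume ne: "\<C> \<noteq> {}" and chain: "subset.chain A \<C>"
    then have CA: "P (Inr -` T) (Inl -` T)" if "T \<in> \<C>" for T
      using that by (auto simp: subset.chain_def A_def)
    have lin: "T \<subseteq> T' \<or> T' \<subseteq> T" if "T \<in> \<C>" "T' \<in> \<C>" for T T'
      using that chain by (auto simp: subset.chain_def)
    have fin: "\<exists>T\<in>\<C>. F \<subseteq> T" if "finite F" "F \<subseteq> \<Union>\<C>" for F
      using that
    proof (induction F rule: finite_induct)
      case empty
      then show ?case using ne by blast
    next
      case (insert x F)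
      obtain T where "T \<in> \<C>" "F \<subseteq> T" using insert by auto
      moreover obtain T' where "T' \<in> \<C>" "x \<in> T'" using insert.prems by auto
      ultimately show ?case using lin [of T T'] by blast
    qed
    have "P (Inr -` \<Union>\<C>) (Inl -` \<Union>\<C>)"
    proof (rule PI)
      fix b c assume "(b, c) \<in> Inl -` \<Union>\<C>"
      then obtain T where T: "T \<in> \<C>" "(b, c) \<in> Inl -` T" by blast
      then show "c \<in> C \<and> d c = b \<and> Poly_Mapping.keys b \<subseteq> Inr -` \<Union>\<C>"
        using PD [OF CA [OF T(1)] T(2)] by blast
    next
      show "(0, 0) \<in> Inl -` \<Union>\<C>"
        using ne P0 [OF CA] by blast
    next
      fix b c b' c' assume "(b, c) \<in> Inl -` \<Union>\<C>" "(b', c') \<in> Inl -` \<Union>\<C>"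
      then obtain T where T: "T \<in> \<C>" "{Inl (b, c), Inl (b', c')} \<subseteq> T"
        using fin [of "{Inl (b, c), Inl (b', c')}"] by blast
      then show "(b - b', c - c') \<in> Inl -` \<Union>\<C>"
        using Pdiff [OF CA [OF T(1)], of b c b' c'] by blast
    next
      fix c assume "(0, c) \<in> Inl -` \<Union>\<C>"
      then show "c = 0"
        using Psv CA by blast
    next
      fix b assume b: "b \<in> d ` C" "Poly_Mapping.keys b \<subseteq> Inr -` \<Union>\<C>"
      then have "Inr ` Poly_Mapping.keys b \<subseteq> \<Union>\<C>" by blast
      then obtain T where T: "T \<in> \<C>" "Inr ` Poly_Mapping.keys b \<subseteq> T"
        using fin [of "Inr ` Poly_Mapping.keys b"] by auto
      then have "b \<in> Domain (Inl -` T)"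
        using Pdom [OF CA [OF T(1)] b(1)] by blast
      then show "b \<in> Domain (Inl -` \<Union>\<C>)" using T by blast
    qed
    then show "\<Union>\<C> \<in> A" by (simp add: A_def)
  qed
  then obtain M where M: "M \<in> A" and max: "\<And>X. X \<in> A \<Longrightarrow> M \<subseteq> X \<Longrightarrow> X = M" by blast
  define S G where "S = Inr -` M" and "G = Inl -` M"
  have PSG: "P S G" using M by (simp add: A_def S_def G_def)
  have maxP: "S' \<subseteq> S" if "P S' G'" "S \<subseteq> S'" "G \<subseteq> G'" for S' G'
  proof -
    let ?X = "Inl ` G' \<union> Inr ` S'"
    have "Inl -` ?X = G'" "Inr -` ?X = S'" by auto
    then have "?X \<in> A" using that by (simp add: A_def)
    moreover have "M \<subseteq> ?X"
    proof
      fix y assume "y \<in> M"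
      then show "y \<in> ?X" using that by (cases y) (auto simp: S_def G_def)
    qed
    ultimately have "?X = M" by (rule max)
    then show ?thesis by (auto simp: S_def)
  qed
  have "S = UNIV"
  proof (rule ccontr)
    assume "S \<noteq> UNIV"
    then obtain e where e: "e \<notin> S" by blast
    let ?B = "{b \<in> d ` C. Poly_Mapping.keys b \<subseteq> insert e S}"
    let ?l = "\<lambda>b. Poly_Mapping.lookup b e"
    have Bd: "b - frag_cmul k b' \<in> ?B" if "b \<in> ?B" "b' \<in> ?B" for b b' k
    proof -
      obtain c c' where "c \<in> C" "c' \<in> C" "b = d c" "b' = d c'" using \<open>b \<in> ?B\<close> \<open>b' \<in> ?B\<close> by blast
      then have "b - frag_cmul k b' = d (c - frag_cmul k c')" "c - frag_cmul k c' \<in> C"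
        using Cd Cm by (auto simp: dd dm)
      moreover have "Poly_Mapping.keys (b - frag_cmul k b') \<subseteq> insert e S"
        using keys_diff [of b "frag_cmul k b'"] keys_cmul [of k b'] that by blast
      ultimately show ?thesis by blast
    qed
    have keysS: "Poly_Mapping.keys b \<subseteq> S" if "b \<in> ?B" "?l b = 0" for b
      using that by (auto simp: in_keys_iff)
    show False
    proof (cases "\<forall>b\<in>?B. ?l b = 0")
      case True
      have "P (insert e S) G"
      proof (rule PI)
        fix b assume "b \<in> d ` C" "Poly_Mapping.keys b \<subseteq> insert e S"
        then show "b \<in> Domain G" using Pdom [OF PSG] keysS True by simp
      qed (use PD [OF PSG] P0 [OF PSG] Pdiff [OF PSG] Psv [OF PSG] in blast)+
      then show False using maxP e by blast
    next
      case False
      let ?Q = "\<lambda>n. n > 0 \<and> (\<exists>b\<in>?B. \<bar>?l b\<bar> = int n)"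
      obtain b where b: "b \<in> ?B" "?l b \<noteq> 0" using False by blast
      have "?Q (nat \<bar>?l b\<bar>)" using b by force
      then have Q: "?Q (LEAST n. ?Q n)" by (rule LeastI)
      \<comment> \<open>The smallest positive absolute value of a coefficient at \<open>e\<close>: division with remainder shows
        that it divides every such coefficient.\<close>
      define m where "m = (LEAST n. ?Q n)"
      have least: "\<not> ?Q n" if "n < m" for n
        using not_less_Least that unfolding m_def by blast
      obtain b0 where b0: "b0 \<in> ?B" "\<bar>?l b0\<bar> = int m" "m > 0" using Q unfolding m_def by blast
      have dvd: "?l b0 dvd ?l b" if "b \<in> ?B" for b
      proof (rule ccontr)
        assume nd: "\<not> ?l b0 dvd ?l b"
        let ?b = "b - frag_cmul (?l b div ?l b0) b0"
        have l: "?l ?b = ?l b mod ?l b0"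
          by (simp add: lookup_minus minus_div_mult_eq_mod)
        have "?l ?b \<noteq> 0" using nd l by (simp add: dvd_eq_mod_eq_0)
        then have n0: "nat \<bar>?l ?b\<bar> > 0" by linarith
        have lt: "\<bar>?l ?b\<bar> < int m"
          using b0 unfolding l by (metis abs_mod_less abs_of_nat of_nat_0_less_iff zero_less_abs_iff)
        have "\<exists>b\<in>?B. \<bar>?l b\<bar> = int (nat \<bar>?l ?b\<bar>)"
          by (rule bexI [where x = ?b, OF _ Bd [OF that b0(1)]]) simp
        moreover have "nat \<bar>?l ?b\<bar> < m" using lt by linarith
        ultimately show False using least [of "nat \<bar>?l ?b\<bar>"] n0 by blast
      qed
      obtain c0 where c0: "c0 \<in> C" "d c0 = b0" using b0 by blast
      define G' where "G' = {(b + frag_cmul k b0, c + frag_cmul k c0) | b c k. (b, c) \<in> G}"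
      have l0: "?l b = 0" if "(b, c) \<in> G" for b c
        using PD(3) [OF PSG that] e by (auto simp: in_keys_iff)
      have add: "d (x + y) = d x + d y" for x y
        using dd [of x "- y"] dd [of 0 y] by (simp add: d0)
      have "P (insert e S) G'"
      proof (rule PI)
        fix b c assume "(b, c) \<in> G'"
        then obtain b1 c1 k where G1: "(b1, c1) \<in> G" "b = b1 + frag_cmul k b0" "c = c1 + frag_cmul k c0"
          by (auto simp: G'_def)
        have "c1 - frag_cmul (- k) c0 \<in> C"
          using PD [OF PSG G1(1)] c0 Cd Cm by blast
        moreover have "Poly_Mapping.keys b \<subseteq> insert e S"
          using PD(3) [OF PSG G1(1)] b0 keys_add [of b1 "frag_cmul k b0"] keys_cmul [of k b0] G1(2) by blast
        ultimately show "c \<in> C \<and> d c = b \<and> Poly_Mapping.keys b \<subseteq> insert e S"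
          using PD [OF PSG G1(1)] by (simp add: G1 add dm c0 minus_frag_cmul [symmetric] del: minus_frag_cmul)
      next
        have "(0, 0) = (0 + frag_cmul 0 b0, 0 + frag_cmul 0 c0)" by simp
        then show "(0, 0) \<in> G'"
          unfolding G'_def using P0 [OF PSG] by blast
      next
        fix b c b' c' assume "(b, c) \<in> G'" "(b', c') \<in> G'"
        then obtain b1 c1 k b1' c1' k' where G1: "(b1, c1) \<in> G" "b = b1 + frag_cmul k b0" "c = c1 + frag_cmul k c0"
          "(b1', c1') \<in> G" "b' = b1' + frag_cmul k' b0" "c' = c1' + frag_cmul k' c0"
          by (auto simp: G'_def)
        then have "(b - b', c - c') = ((b1 - b1') + frag_cmul (k - k') b0, (c1 - c1') + frag_cmul (k - k') c0)"
          by (simp add: frag_cmul_diff_distrib)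
        then show "(b - b', c - c') \<in> G'"
          unfolding G'_def using Pdiff [OF PSG G1(1,4)] by blast
      next
        fix c assume "(0, c) \<in> G'"
        then obtain b1 c1 k where G1: "(b1, c1) \<in> G" "0 = b1 + frag_cmul k b0" "c = c1 + frag_cmul k c0"
          by (auto simp: G'_def)
        have "?l (b1 + frag_cmul k b0) = 0" using G1(2) by (metis lookup_zero)
        then have k: "k = 0" using l0 [OF G1(1)] b0 by (auto simp: lookup_add)
        then have "b1 = 0" using G1(2) by simp
        then show "c = 0" using Psv [OF PSG] G1 k by simp
      next
        fix b assume b: "b \<in> d ` C" "Poly_Mapping.keys b \<subseteq> insert e S"
        then obtain q where q: "?l b = ?l b0 * q" using dvd by blast
        let ?b = "b - frag_cmul q b0"
        have "?b \<in> ?B" using Bd b b0 by blast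
        moreover have "?l ?b = 0" by (simp add: lookup_minus q)
        ultimately have "?b \<in> Domain G" using Pdom [OF PSG] keysS by blast
        then obtain c where "(?b, c) \<in> G" by blast
        then have "(?b + frag_cmul q b0, c + frag_cmul q c0) \<in> G'" unfolding G'_def by blast
        then show "b \<in> Domain G'" by auto
      qed
      moreover have "G \<subseteq> G'"
      proof clarify
        fix b c assume "(b, c) \<in> G"
        moreover have "(b, c) = (b + frag_cmul 0 b0, c + frag_cmul 0 c0)" by simp
        ultimately show "(b, c) \<in> G'" unfolding G'_def by blast
      qed
      ultimately show False using maxP e by blast
    qed
  qed
  define s where "s b = (SOME c. (b, c) \<in> G)" for b
  have s: "(b, s b) \<in> G" if "b \<in> d ` C" for b
    using Pdom [OF PSG that] unfolding s_def \<open>S = UNIV\<close> by (metis DomainE someI subset_UNIV)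
  have uniq: "c = c'" if "(b, c) \<in> G" "(b, c') \<in> G" for b c c'
    using Psv [OF PSG, of "c - c'"] Pdiff [OF PSG that] by simp
  show thesis
  proof (rule that)
    fix b assume "b \<in> d ` C"
    then show "s b \<in> C \<and> d (s b) = b" using s PD [OF PSG] by blast
  next
    fix b b' assume b: "b \<in> d ` C" "b' \<in> d ` C"
    have "(0 - b', 0 - s b') \<in> G"
      by (intro Pdiff [OF PSG] P0 [OF PSG] s b)
    then have "(b - (0 - b'), s b - (0 - s b')) \<in> G"
      by (rule Pdiff [OF PSG s [OF b(1)]])
    then have *: "(b + b', s b + s b') \<in> G" by simp
    then have "b + b' \<in> d ` C" using PD(1,2) [OF PSG *] by (metis imageI)
    then show "s (b + b') = s b + s b'" using uniq s * by blast
  qed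
qed

lemma boundary_section:
  "\<exists>s. (\<forall>b. bounds p X b \<longrightarrow> singular_chain (Suc p) X (s b) \<and> chain_boundary (Suc p) (s b) = b) \<and>
    (\<forall>b b'. bounds p X b \<longrightarrow> bounds p X b' \<longrightarrow> s (b + b') = s b + s b')"
proof -
  have eq: "b \<in> chain_boundary (Suc p) ` singular_chain_set (Suc p) X \<longleftrightarrow> bounds p X b" for b
    by (auto simp: bounds_iff)
  show ?thesis
    by (rule free_abelian_section [of "singular_chain_set (Suc p) X" "chain_boundary (Suc p)"])
      (auto simp: singular_chain_diff singular_chain_cmul chain_boundary_diff chain_boundary_cmul eq)
qed

text \<open>The additivity of this choice is what allows additive functions on cycles to be extended to
  all chains.\<close>

definition filling :: "nat \<Rightarrow> 'a topology \<Rightarrow> 'a chain \<Rightarrow> 'a chain"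
  where "filling p X = (SOME s.
    (\<forall>b. bounds p X b \<longrightarrow> singular_chain (Suc p) X (s b) \<and> chain_boundary (Suc p) (s b) = b) \<and>
    (\<forall>b b'. bounds p X b \<longrightarrow> bounds p X b' \<longrightarrow> s (b + b') = s b + s b'))"

lemma filling:
  shows "bounds p X b \<Longrightarrow> singular_chain (Suc p) X (filling p X b)"
    and "bounds p X b \<Longrightarrow> chain_boundary (Suc p) (filling p X b) = b"
    and "bounds p X b \<Longrightarrow> bounds p X b' \<Longrightarrow> filling p X (b + b') = filling p X b + filling p X b'"
  using someI_ex [OF boundary_section [of p X]] unfolding filling_def [symmetric] by blast+

lemma cochain_eval_diff: "cochain_eval \<phi> (x - y) = cochain_eval \<phi> x - cochain_eval \<phi> y"
  using cochain_eval_add [of \<phi> "x - y" y] by simp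

lemma cochain_eval_comb: "cochain_eval \<phi> (comb I c h) = (\<Sum>i\<in>I. c i * cochain_eval \<phi> (h i))"
  by (simp add: cochain_eval_sum cochain_eval_cmul)

lemma cochain_of_additive:
  assumes f: "\<And>c c'. singular_chain p X c \<Longrightarrow> singular_chain p X c' \<Longrightarrow> f (c + c') = f c + (f c' :: int)"
  obtains \<phi> where "singular_cochain p X \<phi>" "\<And>c. singular_chain p X c \<Longrightarrow> cochain_eval \<phi> c = f c"
proof -
  define \<phi> where "\<phi> = (\<lambda>\<sigma>. if singular_simplex p X \<sigma> then f (frag_of \<sigma>) else 0)"
  have f0: "f 0 = 0" using f [of 0 0] by simp
  have fd: "f (c - c') = f c - f c'" if "singular_chain p X c" "singular_chain p X c'" for c c'
    using f [of "c - c'" c'] that by (simp add: singular_chain_diff)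
  have "cochain_eval \<phi> c = f c" if "singular_chain p X c" for c
  proof -
    have "Poly_Mapping.keys c \<subseteq> singular_simplex_set p X"
      using that by (simp add: singular_chain_def)
    then have "cochain_eval \<phi> c = f c \<and> singular_chain p X c"
    proof (induction c rule: frag_induction)
      case (diff a b)
      then show ?case by (simp add: cochain_eval_diff fd singular_chain_diff)
    qed (auto simp: f0 \<phi>_def singular_chain_of)
    then show ?thesis by simp
  qed
  moreover have "singular_cochain p X \<phi>" by (simp add: singular_cochain_def \<phi>_def)
  ultimately show thesis using that by blast
qed

text \<open>Subtracting the filling of its boundary turns a chain into a cycle; this is an additive
  projection of the chains onto the cycles.\<close>

lemma cycle_functional_extends:
  assumes f: "\<And>c c'. cycle p X c \<Longrightarrow> cycle p X c' \<Longrightarrow> f (c + c') = f c + (f c' :: int)"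
  obtains \<phi> where "singular_cochain p X \<phi>" "\<And>z. cycle p X z \<Longrightarrow> cochain_eval \<phi> z = f z"
proof (cases p)
  case 0
  then have "cycle p X c \<longleftrightarrow> singular_chain p X c" for c
    by (simp add: singular_cycle chain_boundary_def)
  then show thesis using cochain_of_additive [of p X f] f that by metis
next
  case (Suc q)
  define s where "s = filling q X"
  note s = filling [of q X, folded s_def]
  define g where "g c = f (c - s (chain_boundary p c))" for c
  have cyc: "cycle p X (c - s (chain_boundary p c))" if "singular_chain p X c" for c
    using s(1,2) [OF bounds_boundary] that
    by (auto simp: singular_cycle Suc chain_boundary_diff singular_chain_diff)
  have gadd: "g (c + c') = g c + g c'" if c: "singular_chain p X c" "singular_chain p X c'" for c c'
  proof -
    have "c + c' - s (chain_boundary p (c + c'))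
        = (c - s (chain_boundary p c)) + (c' - s (chain_boundary p c'))"
      using s(3) [OF bounds_boundary bounds_boundary] c by (simp add: Suc chain_boundary_add)
    then show ?thesis unfolding g_def by (simp only: f cyc c)
  qed
  obtain \<phi> where \<phi>: "singular_cochain p X \<phi>" "\<And>c. singular_chain p X c \<Longrightarrow> cochain_eval \<phi> c = g c"
    using cochain_of_additive [of p X g, OF gadd] by blast
  have s0: "s 0 = 0" using s(3) [of 0 0] by simp
  show thesis
    by (rule that [OF \<phi>(1)]) (simp add: \<phi>(2) singular_cycle g_def s0)
qed

lemma cocycle_iff_vanishes_on_boundaries:
  "coboundary p X \<phi> = (\<lambda>f. 0) \<longleftrightarrow> (\<forall>b. bounds p X b \<longrightarrow> cochain_eval \<phi> b = 0)"
proof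
  assume c: "coboundary p X \<phi> = (\<lambda>f. 0)"
  show "\<forall>b. bounds p X b \<longrightarrow> cochain_eval \<phi> b = 0"
  proof (clarsimp simp: bounds_iff)
    fix d assume "singular_chain (Suc p) X d"
    then have "cochain_eval \<phi> (chain_boundary (Suc p) d) = cochain_eval (coboundary p X \<phi>) d"
      by (simp add: cochain_eval_coboundary)
    then show "cochain_eval \<phi> (chain_boundary (Suc p) d) = 0"
      by (simp add: c cochain_eval_def)
  qed
next
  assume b: "\<forall>b. bounds p X b \<longrightarrow> cochain_eval \<phi> b = 0"
  show "coboundary p X \<phi> = (\<lambda>f. 0)"
  proof
    fix f show "coboundary p X \<phi> f = 0"
      using b bounds_boundary [of p X "frag_of f"] by (auto simp: coboundary_def singular_chain_of)
  qed
qed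

abbreviation cocycle :: "nat \<Rightarrow> 'a topology \<Rightarrow> 'a cochain \<Rightarrow> bool"
  where "cocycle p X \<phi> \<equiv> singular_cochain p X \<phi> \<and> coboundary p X \<phi> = (\<lambda>f. 0)"

lemma cocycle_bounds: "cocycle p X \<phi> \<Longrightarrow> bounds p X b \<Longrightarrow> cochain_eval \<phi> b = 0"
  using cocycle_iff_vanishes_on_boundaries by blast

lemma cocycle_homologous: "cocycle p X \<phi> \<Longrightarrow> bounds p X (x - y) \<Longrightarrow> cochain_eval \<phi> x = cochain_eval \<phi> y"
  using cocycle_bounds [of p X \<phi> "x - y"] by (simp add: cochain_eval_diff)

definition coordinates :: "nat \<Rightarrow> 'a topology \<Rightarrow> 'i set \<Rightarrow> ('i \<Rightarrow> 'a chain) \<Rightarrow> 'a chain \<Rightarrow> 'i \<Rightarrow> int"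
  where "coordinates p X I h z = (SOME c. bounds p X (z - comb I c h))"

lemma coordinates:
  assumes h: "homology_basis p X I h"
  shows "cycle p X z \<Longrightarrow> bounds p X (z - comb I (coordinates p X I h z) h)"
    and "cycle p X z \<Longrightarrow> bounds p X (z - comb I c h) \<Longrightarrow> i \<in> I \<Longrightarrow> coordinates p X I h z i = c i"
    and "cycle p X z \<Longrightarrow> cycle p X z' \<Longrightarrow> i \<in> I \<Longrightarrow>
      coordinates p X I h (z + z') i = coordinates p X I h z i + coordinates p X I h z' i"
proof -
  define \<kappa> where "\<kappa> = coordinates p X I h"
  have 1: "bounds p X (z - comb I (\<kappa> z) h)" if "cycle p X z" for z
    unfolding \<kappa>_def coordinates_def by (rule homology_basis_span [OF h that]) (rule someI [where P = "\<lambda>c. bounds p X (z - comb I c h)"])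
  have 2: "\<kappa> z i = c i" if z: "cycle p X z" "bounds p X (z - comb I c h)" and i: "i \<in> I" for z c i
  proof -
    have "comb I (\<lambda>i. \<kappa> z i - c i) h = (z - comb I c h) - (z - comb I (\<kappa> z) h)"
      by (simp add: comb_diff [symmetric])
    then have "bounds p X (comb I (\<lambda>i. \<kappa> z i - c i) h)"
      using singular_relboundary_diff [OF z(2) 1 [OF z(1)]] by (simp only:)
    then show ?thesis using homology_basisD(3) [OF h _ i, of "\<lambda>i. \<kappa> z i - c i"] by simp
  qed
  have 3: "\<kappa> (z + z') i = \<kappa> z i + \<kappa> z' i" if "cycle p X z" "cycle p X z'" "i \<in> I" for z z' i
  proof (rule 2)
    have "z + z' - comb I (\<lambda>i. \<kappa> z i + \<kappa> z' i) h = (z - comb I (\<kappa> z) h) + (z' - comb I (\<kappa> z') h)"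
      by (simp add: comb_add [symmetric] algebra_simps)
    then show "bounds p X (z + z' - comb I (\<lambda>i. \<kappa> z i + \<kappa> z' i) h)"
      using singular_relboundary_add [OF 1 [OF that(1)] 1 [OF that(2)]] by (simp only:)
  qed (use that singular_relcycle_add in auto)
  show "cycle p X z \<Longrightarrow> bounds p X (z - comb I (coordinates p X I h z) h)"
    "cycle p X z \<Longrightarrow> bounds p X (z - comb I c h) \<Longrightarrow> i \<in> I \<Longrightarrow> coordinates p X I h z i = c i"
    "cycle p X z \<Longrightarrow> cycle p X z' \<Longrightarrow> i \<in> I \<Longrightarrow>
      coordinates p X I h (z + z') i = coordinates p X I h z i + coordinates p X I h z' i"
    using 1 2 3 unfolding \<kappa>_def by blast+
qed

text \<open>The evaluation map of the universal coefficient theorem is onto: coordinates with respect to the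
  basis are additive on cycles and vanish on boundaries, and such functions extend to cocycles.\<close>

proposition cocycle_with_values:
  assumes h: "homology_basis p X I h"
  obtains \<phi> where "cocycle p X \<phi>" "\<And>i. i \<in> I \<Longrightarrow> cochain_eval \<phi> (h i) = v i"
proof -
  define \<kappa> where "\<kappa> = coordinates p X I h"
  note \<kappa> = coordinates [OF h, folded \<kappa>_def]
  define f where "f z = (\<Sum>i\<in>I. \<kappa> z i * v i)" for z
  have add: "f (z + z') = f z + f z'" if "cycle p X z" "cycle p X z'" for z z'
    by (simp add: f_def \<kappa>(3) [OF that] distrib_right sum.distrib)
  obtain \<phi> where \<phi>: "singular_cochain p X \<phi>" "\<And>z. cycle p X z \<Longrightarrow> cochain_eval \<phi> z = f z"
    using cycle_functional_extends [of p X f, OF add] by blast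
  have fin: "finite I" by (rule homology_basisD(1) [OF h])
  have "cochain_eval \<phi> b = 0" if b: "bounds p X b" for b
  proof -
    have cb: "cycle p X b" using b by (rule bounds_imp_cycle)
    have "\<kappa> b i = 0" if "i \<in> I" for i
      using \<kappa>(2) [OF cb, of "\<lambda>i. 0"] b that by simp
    then show ?thesis by (simp add: \<phi>(2) [OF cb] f_def)
  qed
  then have "cocycle p X \<phi>"
    using \<phi>(1) cocycle_iff_vanishes_on_boundaries by blast
  moreover have "cochain_eval \<phi> (h i) = v i" if i: "i \<in> I" for i
  proof -
    have hi: "cycle p X (h i)" using homology_basisD(2) [OF h i] .
    have "\<kappa> (h i) j = (if j = i then 1 else 0)" if "j \<in> I" for j
    proof (rule \<kappa>(2) [OF hi _ that])
      have "comb I (\<lambda>j. if j = i then 1 else 0) h = (\<Sum>j\<in>I. if j = i then h j else 0)"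
        by (rule sum.cong) auto
      then have "comb I (\<lambda>j. if j = i then 1 else 0) h = h i"
        using fin i by simp
      then show "bounds p X (h i - comb I (\<lambda>j. if j = i then 1 else 0) h)" by simp
    qed
    then have "f (h i) = (\<Sum>j\<in>I. if j = i then v j else 0)"
      unfolding f_def by (intro sum.cong) auto
    then show ?thesis using fin i by (simp add: \<phi>(2) [OF hi])
  qed
  ultimately show thesis using that by blast
qed

lemma cocycle_vanishes_on_cycles:
  assumes h: "homology_basis p X I h" and \<phi>: "cocycle p X \<phi>"
    and 0: "\<And>i. i \<in> I \<Longrightarrow> cochain_eval \<phi> (h i) = 0" and z: "cycle p X z"
  shows "cochain_eval \<phi> z = 0"
proof -
  obtain c where "bounds p X (z - comb I c h)" using homology_basis_span [OF h z] .
  then have "cochain_eval \<phi> z = cochain_eval \<phi> (comb I c h)" by (rule cocycle_homologous [OF \<phi>])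
  then show ?thesis by (simp add: cochain_eval_comb 0)
qed

text \<open>The evaluation map is injective; the freeness of the homology one degree lower takes the place
  of the vanishing of \<open>Ext\<close>. On a boundary \<open>b\<close>, a primitive has to take the value of \<open>\<phi>\<close> on a chain
  bounded by \<open>b\<close>. This is extended to cycles by first subtracting from a cycle the combination of
  basis cycles homologous to it.\<close>

proposition coboundary_if_vanishes_on_cycles:
  assumes h: "homology_basis p X I h" and \<phi>: "singular_cochain (Suc p) X \<phi>"
    and 0: "\<And>z. cycle (Suc p) X z \<Longrightarrow> cochain_eval \<phi> z = 0"
  obtains \<psi> where "singular_cochain p X \<psi>" "coboundary p X \<psi> = \<phi>"
proof -
  define \<kappa> where "\<kappa> = coordinates p X I h"
  note \<kappa> = coordinates [OF h, folded \<kappa>_def]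
  define s where "s = filling p X"
  note s = filling [of p X, folded s_def]
  define f where "f z = cochain_eval \<phi> (s (z - comb I (\<kappa> z) h))" for z
  have add: "f (z + z') = f z + f z'" if z: "cycle p X z" "cycle p X z'" for z z'
  proof -
    have "comb I (\<kappa> (z + z')) h = comb I (\<kappa> z) h + comb I (\<kappa> z') h"
      unfolding comb_add by (rule sum.cong) (auto simp: \<kappa>(3) z)
    then have "z + z' - comb I (\<kappa> (z + z')) h = (z - comb I (\<kappa> z) h) + (z' - comb I (\<kappa> z') h)"
      by simp
    then show ?thesis
      unfolding f_def by (simp only: s(3) \<kappa>(1) z cochain_eval_add)
  qed
  obtain \<psi> where \<psi>: "singular_cochain p X \<psi>" "\<And>z. cycle p X z \<Longrightarrow> cochain_eval \<psi> z = f z"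
    using cycle_functional_extends [of p X f, OF add] by blast
  have "coboundary p X \<psi> \<sigma> = \<phi> \<sigma>" for \<sigma>
  proof (cases "singular_simplex (Suc p) X \<sigma>")
    case True
    then have c: "singular_chain (Suc p) X (frag_of \<sigma>)" by (simp add: singular_chain_of)
    let ?b = "chain_boundary (Suc p) (frag_of \<sigma>)"
    have b: "bounds p X ?b" "cycle p X ?b"
      using bounds_boundary [OF c] bounds_imp_cycle by auto
    have "\<kappa> ?b i = 0" if "i \<in> I" for i
      using \<kappa>(2) [OF b(2), of "\<lambda>i. 0"] b that by simp
    then have "comb I (\<kappa> ?b) h = 0" by simp
    then have "coboundary p X \<psi> \<sigma> = cochain_eval \<phi> (s ?b)"
      using True by (simp add: coboundary_def \<psi>(2) [OF b(2)] f_def)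
    also have "\<dots> = cochain_eval \<phi> (frag_of \<sigma>)"
    proof -
      have "cycle (Suc p) X (s ?b - frag_of \<sigma>)"
        using s(1,2) [OF b(1)] c by (simp add: singular_cycle singular_chain_diff chain_boundary_diff)
      then show ?thesis using 0 [of "s ?b - frag_of \<sigma>"] by (simp add: cochain_eval_diff)
    qed
    finally show ?thesis by simp
  next
    case False
    then show ?thesis using \<phi> by (simp add: coboundary_def singular_cochain_def)
  qed
  then show thesis using that \<psi>(1) by blast
qed

section \<open>Cohomology classes are determined by their values on cycles\<close>

abbreviation cohomology_class :: "nat \<Rightarrow> 'a topology \<Rightarrow> 'a cochain \<Rightarrow> 'a cochain set"
  where "cohomology_class p X \<phi> \<equiv> reduced_coboundary_set p X #>\<^bsub>cocycle_group p X\<^esub> \<phi>"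

lemma carrier_reduced_cohomology_group:
  "carrier (reduced_cohomology_group p X) = cohomology_class p X ` {\<phi>. cocycle p X \<phi>}"
  by (simp add: reduced_cohomology_group_def carrier_FactGroup)

lemma normal_reduced_coboundary_set: "reduced_coboundary_set p X \<lhd> cocycle_group p X"
  by (simp add: comm_group.normal_iff_subgroup comm_group_cocycle_group subgroup_reduced_coboundary_set)

lemma cohomology_class_mult:
  assumes "cocycle p X \<phi>" "cocycle p X \<psi>"
  shows "cohomology_class p X \<phi> \<otimes>\<^bsub>reduced_cohomology_group p X\<^esub> cohomology_class p X \<psi>
    = cohomology_class p X (\<lambda>f. \<phi> f + \<psi> f)"
  using normal.rcos_sum [OF normal_reduced_coboundary_set, of \<phi> p X \<psi>] assms
  by (simp add: reduced_cohomology_group_def)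

lemma cohomology_class_one:
  "\<one>\<^bsub>reduced_cohomology_group p X\<^esub> = cohomology_class p X (\<lambda>f. 0)"
proof -
  interpret C: comm_group "cocycle_group p X" by (rule comm_group_cocycle_group)
  show ?thesis
    using C.coset_mult_one [OF subgroup.subset [OF subgroup_reduced_coboundary_set]]
    by (simp add: reduced_cohomology_group_def)
qed

lemma cocycle_nat_pow:
  assumes "cocycle p X \<phi>"
  shows "\<phi> [^]\<^bsub>cocycle_group p X\<^esub> (k::nat) = (\<lambda>f. int k * \<phi> f)"
  by (induction k) (auto simp: fun_eq_iff algebra_simps)

lemma cocycle_scale:
  assumes "cocycle p X \<phi>"
  shows "cocycle p X (\<lambda>f. k * \<phi> f)"
proof -
  have "coboundary p X (\<lambda>f. k * \<phi> f) = (\<lambda>f. k * coboundary p X \<phi> f)"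
    by (rule ext) (simp add: coboundary_def cochain_eval_def sum_distrib_left ac_simps)
  then show ?thesis
    using assms by (simp add: singular_cochain_def)
qed

lemma cocycle_add:
  "cocycle p X \<phi> \<Longrightarrow> cocycle p X \<psi> \<Longrightarrow> cocycle p X (\<lambda>f. \<phi> f + \<psi> f)"
  by (simp add: singular_cochain_def coboundary_add)

lemma cocycle_minus:
  "cocycle p X \<phi> \<Longrightarrow> cocycle p X \<psi> \<Longrightarrow> cocycle p X (\<lambda>f. \<phi> f - \<psi> f)"
  using cocycle_add [of p X \<phi> "\<lambda>f. - 1 * \<psi> f"] cocycle_scale [of p X \<psi> "- 1"] by simp

lemma cocycle_sum:
  assumes "\<And>i. i \<in> I \<Longrightarrow> cocycle p X (\<phi> i)"
  shows "cocycle p X (\<lambda>f. \<Sum>i\<in>I. \<phi> i f)"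
  using assms by (induction I rule: infinite_finite_induct) (auto intro: cocycle_add simp: singular_cochain_def coboundary_add)

lemma cocycle_int_pow:
  assumes "cocycle p X \<phi>"
  shows "\<phi> [^]\<^bsub>cocycle_group p X\<^esub> (k::int) = (\<lambda>f. k * \<phi> f)"
proof (cases "k \<ge> 0")
  case True
  then show ?thesis by (auto simp: int_pow_def2 cocycle_nat_pow [OF assms])
next
  case False
  then show ?thesis
    using inv_cocycle_group [of "\<lambda>f. int (nat (- k)) * \<phi> f" p X] cocycle_scale [OF assms, of "int (nat (- k))"]
    by (auto simp: int_pow_def2 cocycle_nat_pow [OF assms])
qed

lemma cohomology_class_int_pow:
  assumes "cocycle p X \<phi>"
  shows "cohomology_class p X \<phi> [^]\<^bsub>reduced_cohomology_group p X\<^esub> (k::int) = cohomology_class p X (\<lambda>f. k * \<phi> f)"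
  using normal.FactGroup_int_pow [OF normal_reduced_coboundary_set, of \<phi> p X k] assms
  by (simp add: reduced_cohomology_group_def cocycle_int_pow)

lemma cohomology_class_finprod:
  assumes "finite I" "\<And>i. i \<in> I \<Longrightarrow> cocycle p X (\<phi> i)"
  shows "(\<Otimes>\<^bsub>reduced_cohomology_group p X\<^esub>i\<in>I. cohomology_class p X (\<phi> i))
    = cohomology_class p X (\<lambda>f. \<Sum>i\<in>I. \<phi> i f)"
  using assms
proof (induction I rule: finite_induct)
  interpret H: comm_group "reduced_cohomology_group p X" by (rule comm_group_reduced_cohomology_group)
  case empty
  then show ?case by (simp add: cohomology_class_one)
next
  interpret H: comm_group "reduced_cohomology_group p X" by (rule comm_group_reduced_cohomology_group)
  case (insert i I)
  then have "(\<lambda>i. cohomology_class p X (\<phi> i)) \<in> insert i I \<rightarrow> carrier (reduced_cohomology_group p X)"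
    by (auto simp: carrier_reduced_cohomology_group)
  then show ?case
    using insert by (simp add: cohomology_class_mult cocycle_sum)
qed

lemma cohomology_class_eq_iff:
  assumes "cocycle p X \<phi>" "cocycle p X \<psi>"
  shows "cohomology_class p X \<phi> = cohomology_class p X \<psi> \<longleftrightarrow> (\<lambda>f. \<phi> f - \<psi> f) \<in> reduced_coboundary_set p X"
proof -
  interpret C: comm_group "cocycle_group p X" by (rule comm_group_cocycle_group)
  note sg = subgroup_reduced_coboundary_set [of p X]
  have mem: "\<phi> \<in> cohomology_class p X \<psi> \<longleftrightarrow> (\<lambda>f. \<phi> f - \<psi> f) \<in> reduced_coboundary_set p X"
  proof
    assume "\<phi> \<in> cohomology_class p X \<psi>"
    then obtain \<beta> where \<beta>: "\<beta> \<in> reduced_coboundary_set p X" "\<phi> = (\<lambda>f. \<beta> f + \<psi> f)"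
      by (auto simp: r_coset_def)
    then have "(\<lambda>f. \<phi> f - \<psi> f) = \<beta>" by auto
    then show "(\<lambda>f. \<phi> f - \<psi> f) \<in> reduced_coboundary_set p X" using \<beta> by simp
  next
    assume "(\<lambda>f. \<phi> f - \<psi> f) \<in> reduced_coboundary_set p X"
    then show "\<phi> \<in> cohomology_class p X \<psi>"
      by (auto simp: r_coset_def intro!: bexI [of _ "\<lambda>f. \<phi> f - \<psi> f"])
  qed
  show ?thesis
    using C.repr_independence [OF _ _ sg, of \<phi> \<psi>] C.rcos_self [OF _ sg, of \<phi>] assms
    unfolding mem [symmetric] by auto
qed

lemma cochain_eval_minus_cochain:
  "cochain_eval (\<lambda>f. \<phi> f - \<psi> f) c = cochain_eval \<phi> c - cochain_eval \<psi> c"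
  by (simp add: cochain_eval_def algebra_simps sum_subtractf)

lemma cochain_eval_sum_cochain:
  "cochain_eval (\<lambda>f. \<Sum>i\<in>I. k i * \<phi> i f) c = (\<Sum>i\<in>I. k i * cochain_eval (\<phi> i) c)"
  unfolding cochain_eval_def sum_distrib_left
  by (subst sum.swap) (simp add: ac_simps)

lemma cohomology_class_eq_iff_values:
  assumes g: "homology_basis p X J g" and h: "homology_basis (Suc p) X I h"
    and \<phi>: "cocycle (Suc p) X \<phi>" and \<psi>: "cocycle (Suc p) X \<psi>"
  shows "cohomology_class (Suc p) X \<phi> = cohomology_class (Suc p) X \<psi>
    \<longleftrightarrow> (\<forall>i\<in>I. cochain_eval \<phi> (h i) = cochain_eval \<psi> (h i))"
proof -
  let ?\<delta> = "\<lambda>f. \<phi> f - \<psi> f"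
  have \<delta>: "cocycle (Suc p) X ?\<delta>" by (rule cocycle_minus [OF \<phi> \<psi>])
  have B: "reduced_coboundary_set (Suc p) X = coboundary p X ` Collect (singular_cochain p X)"
    by (simp add: reduced_coboundary_set_def coboundary_set_def)
  have "?\<delta> \<in> reduced_coboundary_set (Suc p) X \<longleftrightarrow> (\<forall>i\<in>I. cochain_eval ?\<delta> (h i) = 0)"
  proof
    assume "?\<delta> \<in> reduced_coboundary_set (Suc p) X"
    then obtain \<beta> where \<beta>: "?\<delta> = coboundary p X \<beta>" unfolding B by blast
    show "\<forall>i\<in>I. cochain_eval ?\<delta> (h i) = 0"
    proof
      fix i assume "i \<in> I"
      then have "singular_chain (Suc p) X (h i)" "chain_boundary (Suc p) (h i) = 0"
        using homology_basisD(2) [OF h] by (auto simp: singular_cycle)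
      then show "cochain_eval ?\<delta> (h i) = 0"
        unfolding \<beta> by (simp add: cochain_eval_coboundary)
    qed
  next
    assume 0: "\<forall>i\<in>I. cochain_eval ?\<delta> (h i) = 0"
    have "cochain_eval ?\<delta> z = 0" if "cycle (Suc p) X z" for z
      using cocycle_vanishes_on_cycles [OF h \<delta> _ that] 0 by blast
    then obtain \<beta> where "singular_cochain p X \<beta>" "coboundary p X \<beta> = ?\<delta>"
      using coboundary_if_vanishes_on_cycles [OF g] \<delta> by blast
    then show "?\<delta> \<in> reduced_coboundary_set (Suc p) X"
      unfolding B by (metis image_eqI mem_Collect_eq)
  qed
  then show ?thesis
    using cohomology_class_eq_iff [OF \<phi> \<psi>] by (simp add: cochain_eval_minus_cochain)
qed

text \<open>The coefficients of a class with respect to the dual cocycles are its values on the basis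
  cycles.\<close>

proposition int_basis_of_dual_cocycles:
  assumes g: "homology_basis p X J g" and h: "homology_basis (Suc p) X I h"
    and \<phi>: "\<And>i. i \<in> I \<Longrightarrow> cocycle (Suc p) X (\<phi> i)"
    and dual: "\<And>i j. i \<in> I \<Longrightarrow> j \<in> I \<Longrightarrow> cochain_eval (\<phi> i) (h j) = (if i = j then 1 else 0)"
  shows "int_basis (reduced_cohomology_group (Suc p) X) I (\<lambda>i. cohomology_class (Suc p) X (\<phi> i))"
proof -
  let ?G = "reduced_cohomology_group (Suc p) X"
  have fin: "finite I" by (rule homology_basisD(1) [OF h])
  have prod: "(\<Otimes>\<^bsub>?G\<^esub>i\<in>I. cohomology_class (Suc p) X (\<phi> i) [^]\<^bsub>?G\<^esub> c i)
      = cohomology_class (Suc p) X (\<lambda>f. \<Sum>i\<in>I. c i * \<phi> i f)" (is "?P c = _") for c :: "_ \<Rightarrow> int"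
  proof -
    interpret H: comm_group ?G by (rule comm_group_reduced_cohomology_group)
    have "?P c = (\<Otimes>\<^bsub>?G\<^esub>i\<in>I. cohomology_class (Suc p) X (\<lambda>f. c i * \<phi> i f))"
      by (rule H.finprod_cong) (auto simp: carrier_reduced_cohomology_group cohomology_class_int_pow \<phi> cocycle_scale simp_implies_def)
    also have "\<dots> = cohomology_class (Suc p) X (\<lambda>f. \<Sum>i\<in>I. c i * \<phi> i f)"
      by (rule cohomology_class_finprod [OF fin]) (simp add: \<phi> cocycle_scale)
    finally show ?thesis .
  qed
  have comb: "cocycle (Suc p) X (\<lambda>f. \<Sum>i\<in>I. c i * \<phi> i f)" for c
    by (rule cocycle_sum) (simp add: \<phi> cocycle_scale)
  have eq: "cohomology_class (Suc p) X \<psi> = ?P c \<longleftrightarrow> (\<forall>j\<in>I. c j = cochain_eval \<psi> (h j))"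
    if \<psi>: "cocycle (Suc p) X \<psi>" for \<psi> c
  proof -
    have "cochain_eval (\<lambda>f. \<Sum>i\<in>I. c i * \<phi> i f) (h j) = c j" if "j \<in> I" for j
    proof -
      have "cochain_eval (\<lambda>f. \<Sum>i\<in>I. c i * \<phi> i f) (h j) = (\<Sum>i\<in>I. if i = j then c i else 0)"
        unfolding cochain_eval_sum_cochain by (rule sum.cong) (auto simp: dual that)
      then show ?thesis using fin that by simp
    qed
    then show ?thesis
      unfolding prod cohomology_class_eq_iff_values [OF g h \<psi> comb] by auto
  qed
  show ?thesis
    unfolding int_basis_def
  proof (intro conjI ballI)
    show "finite I" by (rule fin)
    show "(\<lambda>i. cohomology_class (Suc p) X (\<phi> i)) \<in> I \<rightarrow> carrier ?G"
      using \<phi> by (auto simp: carrier_reduced_cohomology_group)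
    fix x assume "x \<in> carrier ?G"
    then obtain \<psi> where \<psi>: "cocycle (Suc p) X \<psi>" "x = cohomology_class (Suc p) X \<psi>"
      by (auto simp: carrier_reduced_cohomology_group)
    let ?c = "restrict (\<lambda>j. cochain_eval \<psi> (h j)) I"
    have c: "?c \<in> I \<rightarrow>\<^sub>E UNIV" by auto
    show "\<exists>!c. c \<in> I \<rightarrow>\<^sub>E UNIV \<and> x = ?P c"
    proof (rule ex1I [of _ ?c])
      show "?c \<in> I \<rightarrow>\<^sub>E UNIV \<and> x = ?P ?c"
        using c unfolding \<psi>(2) eq [OF \<psi>(1)] by simp
      fix c' assume "c' \<in> I \<rightarrow>\<^sub>E UNIV \<and> x = ?P c'"
      then have c': "c' \<in> I \<rightarrow>\<^sub>E UNIV" "\<forall>j\<in>I. c' j = cochain_eval \<psi> (h j)"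
        unfolding \<psi>(2) eq [OF \<psi>(1)] by auto
      show "c' = ?c"
        by (rule PiE_ext [OF c'(1) c]) (use c'(2) in simp)
    qed
  qed
qed

lemma torsion_free_reduced_cohomology:
  assumes g: "homology_basis p X J g" and h: "homology_basis (Suc p) X I h"
  shows "torsion_free (reduced_cohomology_group (Suc p) X)"
  unfolding torsion_free_def
proof (intro ballI allI impI)
  let ?G = "reduced_cohomology_group (Suc p) X"
  fix x and k :: nat assume x: "x \<in> carrier ?G" and k: "0 < k \<and> x [^]\<^bsub>?G\<^esub> k = \<one>\<^bsub>?G\<^esub>"
  obtain \<psi> where \<psi>: "cocycle (Suc p) X \<psi>" "x = cohomology_class (Suc p) X \<psi>"
    using x by (auto simp: carrier_reduced_cohomology_group)
  have zero: "cocycle (Suc p) X (\<lambda>f. 0)" by (simp add: singular_cochain_def)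
  note iff = cohomology_class_eq_iff_values [OF g h _ zero]
  have "cohomology_class (Suc p) X (\<lambda>f. int k * \<psi> f) = cohomology_class (Suc p) X (\<lambda>f. 0)"
    using k cohomology_class_int_pow [OF \<psi>(1), of "int k"]
    by (simp add: \<psi>(2) cohomology_class_one int_pow_int)
  moreover have "cochain_eval (\<lambda>f. int k * \<psi> f) c = int k * cochain_eval \<psi> c" for c
    by (simp add: cochain_eval_def sum_distrib_left ac_simps)
  ultimately have "\<forall>i\<in>I. cochain_eval \<psi> (h i) = cochain_eval (\<lambda>f. 0) (h i)"
    using k unfolding iff [OF cocycle_scale [OF \<psi>(1)]] by (simp add: cochain_eval_def)
  then show "x = \<one>\<^bsub>?G\<^esub>"
    using iff [OF \<psi>(1)] by (simp only: \<psi>(2) cohomology_class_one)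
qed

lemma trivial_image: "z \<in> A \<Longrightarrow> (\<And>x. x \<in> A \<Longrightarrow> f x = f z) \<Longrightarrow> f ` A = {f z}"
  by blast

lemma trivial_reduced_cohomology:
  assumes g: "homology_basis p X J g" and h: "homology_basis (Suc p) X {} (h :: unit \<Rightarrow> 'a chain)"
  shows "trivial_group (reduced_cohomology_group (Suc p) X)"
proof -
  interpret H: comm_group "reduced_cohomology_group (Suc p) X" by (rule comm_group_reduced_cohomology_group)
  have zero: "cocycle (Suc p) X (\<lambda>f. 0)" by (simp add: singular_cochain_def)
  have "cohomology_class (Suc p) X \<psi> = cohomology_class (Suc p) X (\<lambda>f. 0)" if "cocycle (Suc p) X \<psi>" for \<psi>
     using cohomology_class_eq_iff_values [OF g h that zero] by simp
  note triv = this
  have eq: "carrier (reduced_cohomology_group (Suc p) X) = {\<one>\<^bsub>reduced_cohomology_group (Suc p) X\<^esub>}"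
    unfolding carrier_reduced_cohomology_group cohomology_class_one
    by (rule trivial_image) (use zero in blast, erule CollectE, erule triv)
  show ?thesis
    unfolding trivial_group_def using H.is_group eq by (rule conjI)
qed

lemma augmentation_boundary:
  assumes "bounds 0 X c"
  shows "cochain_eval (\<lambda>f. if singular_simplex 0 X f then 1 else 0) c = 0"
proof -
  let ?\<epsilon> = "\<lambda>f. if singular_simplex 0 X f then 1 else (0::int)"
  have "?\<epsilon> \<in> reduced_coboundary_set 0 X"
    by (auto simp: reduced_coboundary_set_def)
  then have "cocycle 0 X ?\<epsilon>"
    using subgroup.subset [OF subgroup_reduced_coboundary_set [of 0 X]] by auto
  then show ?thesis using assms cocycle_bounds by blast
qed

lemma cycle_0: "cycle 0 X c \<longleftrightarrow> singular_chain 0 X c"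
  by (simp add: singular_cycle chain_boundary_def)

lemma homology_basis_0I:
  assumes s: "singular_simplex 0 X s"
    and conn: "\<And>f. singular_simplex 0 X f \<Longrightarrow> bounds 0 X (frag_of f - frag_of s)"
  shows "homology_basis 0 X {()} (\<lambda>_. frag_of s)"
proof -
  have "\<exists>c::unit \<Rightarrow> int. bounds 0 X (z - frag_cmul (c ()) (frag_of s))" if z: "singular_chain 0 X z" for z
  proof -
    have "Poly_Mapping.keys z \<subseteq> singular_simplex_set 0 X"
      using z by (simp add: singular_chain_def)
    then have "\<exists>k. bounds 0 X (z - frag_cmul k (frag_of s))"
    proof (induction z rule: frag_induction)
      case zero
      then show ?case by (auto intro: exI [of _ 0])
    next
      case (one f)
      then show ?case using conn by (auto intro: exI [of _ 1])
    next
      case (diff a b)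
      then obtain k l where "bounds 0 X (a - frag_cmul k (frag_of s))" "bounds 0 X (b - frag_cmul l (frag_of s))"
        by blast
      then have "bounds 0 X ((a - frag_cmul k (frag_of s)) - (b - frag_cmul l (frag_of s)))"
        by (rule singular_relboundary_diff)
      moreover have "(a - frag_cmul k (frag_of s)) - (b - frag_cmul l (frag_of s)) = (a - b) - frag_cmul (k - l) (frag_of s)"
        by (simp add: frag_cmul_diff_distrib)
      ultimately show ?case by metis
    qed
    then obtain k where "bounds 0 X (z - frag_cmul k (frag_of s))" ..
    then show ?thesis by (intro exI [where x = "\<lambda>_. k"])
  qed
  moreover have "k = 0" if "bounds 0 X (frag_cmul k (frag_of s))" for k
    using augmentation_boundary [OF that] s by (simp add: cochain_eval_cmul)
  ultimately show ?thesis
    using s by (simp add: homology_basis_def cycle_0 singular_chain_of)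
qed

lemma homology_basis_0D:
  assumes h: "homology_basis 0 X {()} (\<lambda>_. frag_of s)" and f: "singular_simplex 0 X f"
  shows "bounds 0 X (frag_of f - frag_of s)"
proof -
  have s: "singular_simplex 0 X s"
    using h by (simp add: homology_basis_def cycle_0 singular_chain_of)
  have "cycle 0 X (frag_of f)" using f by (simp add: cycle_0 singular_chain_of)
  then obtain c where c: "bounds 0 X (frag_of f - comb {()} c (\<lambda>_. frag_of s))"
    using homology_basis_span [OF h] by blast
  then have "c () = 1"
    using augmentation_boundary [OF c] s f by (simp add: cochain_eval_diff cochain_eval_cmul)
  then show ?thesis using c by simp
qed

lemma trivial_reduced_cohomology_0:
  assumes h: "homology_basis 0 X {()} (\<lambda>_. frag_of s)"
  shows "trivial_group (reduced_cohomology_group 0 X)"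
proof -
  interpret H: comm_group "reduced_cohomology_group 0 X" by (rule comm_group_reduced_cohomology_group)
  have zero: "cocycle 0 X (\<lambda>f. 0)" by (simp add: singular_cochain_def)
  have "cohomology_class 0 X \<psi> = cohomology_class 0 X (\<lambda>f. 0)" if \<psi>: "cocycle 0 X \<psi>" for \<psi>
  proof -
    have "\<psi> f = (if singular_simplex 0 X f then \<psi> s else 0)" for f
    proof (cases "singular_simplex 0 X f")
      case True
      then show ?thesis
        using cocycle_homologous [OF \<psi> homology_basis_0D [OF h True]] by simp
    qed (use \<psi> in \<open>simp add: singular_cochain_def\<close>)
    then have "\<psi> = (\<lambda>f. if singular_simplex 0 X f then \<psi> s else 0)" by blast
    then have "\<psi> \<in> reduced_coboundary_set 0 X"
      by (simp add: reduced_coboundary_set_def image_iff) blast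
    then show ?thesis
      unfolding cohomology_class_eq_iff [OF \<psi> zero] by simp
  qed
  note triv = this
  have eq: "carrier (reduced_cohomology_group 0 X) = {\<one>\<^bsub>reduced_cohomology_group 0 X\<^esub>}"
    unfolding carrier_reduced_cohomology_group cohomology_class_one
    by (rule trivial_image) (use zero in blast, erule CollectE, erule triv)
  show ?thesis
    unfolding trivial_group_def using H.is_group eq by (rule conjI)
qed

lemma torsion_free_trivial_group: "trivial_group G \<Longrightarrow> torsion_free G"
  by (auto simp: trivial_group_def torsion_free_def)

lemma cup_product_cohomology_class:
  assumes p: "0 < p" "0 < q" and \<phi>: "cocycle p X \<phi>" and \<psi>: "cocycle q X \<psi>"
  shows "cup_product p q X (cohomology_class p X \<phi>) (cohomology_class q X \<psi>)
    = cohomology_class (p + q) X (cup_cochain p q X \<phi> \<psi>)"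
proof -
  have red: "reduced_coboundary_set r X = coboundary_set r X" if "0 < r" for r
    using that by (simp add: reduced_coboundary_set_def)
  have self: "\<theta> \<in> cohomology_class r X \<theta>" if "cocycle r X \<theta>" for r \<theta>
  proof -
    interpret C: comm_group "cocycle_group r X" by (rule comm_group_cocycle_group)
    show ?thesis using C.rcos_self [OF _ subgroup_reduced_coboundary_set] that by simp
  qed
  have mem: "cohomology_class r X \<theta> \<in> carrier (cohomology_group r X)" if "cocycle r X \<theta>" "0 < r" for r \<theta>
    using that by (auto simp: reduced_cohomology_group_pos [symmetric] carrier_reduced_cohomology_group)
  show ?thesis
    using cup_product_class(1) [OF mem [OF \<phi> p(1)] mem [OF \<psi> p(2)] self [OF \<phi>] self [OF \<psi>]] p
    by (simp add: red)
qed

section \<open>Homology bases under homotopy equivalence\<close>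

lemma cycle_chain_map: "cycle p X z \<Longrightarrow> continuous_map X Y f \<Longrightarrow> cycle p Y (chain_map p f z)"
  using singular_relcycle_chain_map [of p X "{}" z Y f "{}"] by simp

lemma bounds_chain_map: "bounds p X z \<Longrightarrow> continuous_map X Y f \<Longrightarrow> bounds p Y (chain_map p f z)"
  using singular_relboundary_chain_map [of p X "{}" z Y f "{}"] by simp

lemma chain_map_comb: "finite I \<Longrightarrow> chain_map p f (comb I c h) = comb I c (\<lambda>i. chain_map p f (h i))"
  by (simp add: chain_map_sum o_def)

lemma homotopic_chain_maps_bound:
  assumes "homotopic_with (\<lambda>_. True) X Y f g" "cycle p X z"
  shows "bounds p Y (chain_map p f z - chain_map p g z)"
proof -
  have "homologous_rel p Y {} (chain_map p f z) (chain_map p g z)"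
    by (rule homotopic_imp_homologous_rel_chain_maps [where T = "{}" and S = X])
      (use assms in simp_all)
  then show ?thesis by (simp add: homologous_rel_def)
qed

lemma homotopic_id_bounds:
  assumes gf: "homotopic_with (\<lambda>_. True) X X (g \<circ> f) id" and z: "cycle p X z"
  shows "bounds p X (chain_map p g (chain_map p f z) - z)"
  using homotopic_chain_maps_bound [OF gf z] chain_map_ident [of p X z] z
  by (simp add: chain_map_compose singular_cycle)

text \<open>The inverse equivalence \<open>g\<close> serves only to show that a cycle of \<open>X\<close> bounds if its image does; so
  a basis of \<open>X\<close> can be any family that \<open>f\<close> takes to the given one up to boundaries.\<close>

proposition homology_basis_homotopy_equivalence:
  assumes f: "continuous_map X Y f" and g: "continuous_map Y X g"
    and gf: "homotopic_with (\<lambda>_. True) X X (g \<circ> f) id" and fg: "homotopic_with (\<lambda>_. True) Y Y (f \<circ> g) id"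
    and h: "homology_basis p Y I h" and k: "\<And>i. i \<in> I \<Longrightarrow> cycle p X (k i)"
    and kh: "\<And>i. i \<in> I \<Longrightarrow> bounds p Y (chain_map p f (k i) - h i)"
  shows "homology_basis p X I k"
proof -
  have fin: "finite I" using homology_basisD(1) [OF h] .
  have inj: "bounds p X z" if "cycle p X z" "bounds p Y (chain_map p f z)" for z
    using singular_relboundary_diff [OF bounds_chain_map [OF that(2) g] homotopic_id_bounds [OF gf that(1)]] by simp
  have h': "homology_basis p Y I (\<lambda>i. chain_map p f (k i))"
    by (rule homology_basis_change [OF h kh])
  have "\<exists>c. bounds p X (z - comb I c k)" if z: "cycle p X z" for z
  proof -
    obtain c where "bounds p Y (chain_map p f z - comb I c (\<lambda>i. chain_map p f (k i)))"
      using homology_basis_span [OF h' cycle_chain_map [OF z f]] .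
    then have "bounds p Y (chain_map p f (z - comb I c k))"
      by (simp add: chain_map_diff chain_map_comb fin)
    moreover have "cycle p X (z - comb I c k)"
      by (intro singular_relcycle_diff z comb_cycle k)
    ultimately show ?thesis using inj by blast
  qed
  moreover have "c i = 0" if "bounds p X (comb I c k)" "i \<in> I" for c i
    using bounds_chain_map [OF that(1) f] homology_basisD(3) [OF h' _ that(2), of c]
    by (simp add: chain_map_comb fin)
  ultimately show ?thesis
    using fin k by (auto simp: homology_basis_def)
qed

lemma homology_basis_contractible:
  assumes "contractible_space X"
  shows "homology_basis (Suc p) X {} h"
proof (rule homology_basis_emptyI)
  fix z assume z: "cycle (Suc p) X z"
  obtain a where a: "homotopic_with (\<lambda>x. True) X X id (\<lambda>x. a)"
    using assms by (auto simp: contractible_space_def)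
  have b: "bounds (Suc p) X (z - chain_map (Suc p) (\<lambda>x. a) z)"
    using homotopic_chain_maps_bound [OF a z] chain_map_ident [of "Suc p" X z] z by (simp add: singular_cycle)
  show "bounds (Suc p) X z"
  proof (cases "topspace X = {}")
    case True
    then show ?thesis using z by (simp add: singular_cycle singular_chain_empty)
  next
    case False
    have c: "continuous_map X X (\<lambda>x. a)"
      using homotopic_with_imp_continuous_maps [OF a] by simp
    then have a': "a \<in> topspace X"
      using False by (auto simp: continuous_map_def)
    then have "continuous_map X (subtopology X {a}) (\<lambda>x. a)"
      using c by (simp add: continuous_map_in_subtopology)
    then have "cycle (Suc p) (subtopology X {a}) (chain_map (Suc p) (\<lambda>x. a) z)"
      by (rule cycle_chain_map [OF z])
    then have "bounds (Suc p) (subtopology X {a}) (chain_map (Suc p) (\<lambda>x. a) z)"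
      using singular_boundary_eq_cycle_singleton [of "subtopology X {a}" a "Suc p"] a' by auto
    then have "bounds (Suc p) X (chain_map (Suc p) (\<lambda>x. a) z)"
      using singular_boundary_mono [of "{a}" "topspace X" "Suc p" X] a' by simp
    then show ?thesis
      using singular_relboundary_add [OF b, of "chain_map (Suc p) (\<lambda>x. a) z"] by simp
  qed
qed

section \<open>Affine simplices\<close>

text \<open>The map \<open>e\<close> will mostly be the universal covering of the circle or of the torus: simplices are
  described by their vertices upstairs, where they are affine.\<close>

definition affine_simplex :: "('v::real_vector \<Rightarrow> 'a) \<Rightarrow> nat \<Rightarrow> (nat \<Rightarrow> 'v) \<Rightarrow> (nat \<Rightarrow> real) \<Rightarrow> 'a"
  where "affine_simplex e p A = restrict (\<lambda>x. e (\<Sum>i\<le>p. x i *\<^sub>R A i)) (standard_simplex p)"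

lemma singular_simplex_affine:
  fixes e :: "'v::real_normed_vector \<Rightarrow> 'a"
  assumes e: "continuous_map (top_of_set K) T e" and K: "convex K" "\<And>i. i \<le> p \<Longrightarrow> A i \<in> K"
  shows "singular_simplex p T (affine_simplex e p A)"
proof -
  have "continuous_on (standard_simplex p) (\<lambda>x. \<Sum>i\<le>p. x i *\<^sub>R A i)"
    by (intro continuous_intros continuous_on_subset [OF continuous_on_product_coordinates]) auto
  moreover have "(\<Sum>i\<le>p. x i *\<^sub>R A i) \<in> K" if "x \<in> standard_simplex p" for x
    using that K by (intro convex_sum) (auto simp: standard_simplex_def)
  ultimately have c: "continuous_map (top_of_set (standard_simplex p)) (top_of_set K) (\<lambda>x. \<Sum>i\<le>p. x i *\<^sub>R A i)"
    by auto
  have "continuous_map (top_of_set (standard_simplex p)) T (\<lambda>x. e (\<Sum>i\<le>p. x i *\<^sub>R A i))"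
    using continuous_map_compose [OF c e] by (simp add: o_def)
  then show ?thesis
    by (simp add: singular_simplex_def affine_simplex_def euclidean_product_topology)
qed

lemma singular_face_affine:
  assumes "1 \<le> p" "k \<le> p"
  shows "singular_face p k (affine_simplex e p A)
    = affine_simplex e (p - 1) (\<lambda>i. A (if i < k then i else Suc i))"
proof -
  obtain q where q: "p = Suc q" using assms by (cases p) auto
  have "(\<Sum>i\<le>p. simplical_face k x i *\<^sub>R A i) = (\<Sum>i\<le>q. x i *\<^sub>R A (if i < k then i else Suc i))"
    for x :: "nat \<Rightarrow> real"
  proof -
    have "(\<Sum>i\<le>p. simplical_face k x i *\<^sub>R A i) = (\<Sum>i\<in>{..p} - {k}. simplical_face k x i *\<^sub>R A i)"
      by (rule sum.mono_neutral_right) (auto simp: simplical_face_def)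
    also have "\<dots> = (\<Sum>i\<le>q. x i *\<^sub>R A (if i < k then i else Suc i))"
      by (rule sum.reindex_bij_witness [of _ "\<lambda>i. if i < k then i else Suc i" "\<lambda>i. if i < k then i else i - 1"])
        (use assms q in \<open>auto simp: simplical_face_def\<close>)
    finally show ?thesis .
  qed
  then show ?thesis
    using assms simplical_face_in_standard_simplex [of p k]
    by (auto simp: singular_face_def affine_simplex_def restrict_def fun_eq_iff q)
qed

lemma simplex_map_affine: "simplex_map p f (affine_simplex e p A) = affine_simplex (f \<circ> e) p A"
  by (auto simp: simplex_map_def affine_simplex_def restrict_def fun_eq_iff)

lemma affine_simplex_cong: "(\<And>i. i \<le> p \<Longrightarrow> A i = B i) \<Longrightarrow> affine_simplex e p A = affine_simplex e p B"
  unfolding affine_simplex_def by (intro restrict_ext arg_cong [where f = e] sum.cong) auto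

lemma affine_simplex_translate:
  assumes "\<And>v. e (v + w) = e v"
  shows "affine_simplex e p (\<lambda>i. A i + w) = affine_simplex e p A"
proof -
  have "(\<Sum>i\<le>p. x i *\<^sub>R (A i + w)) = (\<Sum>i\<le>p. x i *\<^sub>R A i) + w" if "x \<in> standard_simplex p" for x
    using that by (simp add: scaleR_add_right sum.distrib scaleR_left.sum [symmetric] standard_simplex_def)
  then show ?thesis
    by (auto simp: affine_simplex_def restrict_def fun_eq_iff assms)
qed

lemma front_face_affine: "front_face p (affine_simplex e (p + q) A) = affine_simplex e p A"
proof -
  have "(\<Sum>i\<le>p + q. x i *\<^sub>R A i) = (\<Sum>i\<le>p. x i *\<^sub>R A i)" if "x \<in> standard_simplex p" for x
    by (rule sum.mono_neutral_right) (use that in \<open>auto simp: standard_simplex_def\<close>)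
  then show ?thesis
    using standard_simplex_subset_add [of _ p q]
    by (auto simp: front_face_def affine_simplex_def restrict_def fun_eq_iff)
qed

lemma back_face_affine: "back_face p q (affine_simplex e (p + q) A) = affine_simplex e q (\<lambda>i. A (p + i))"
proof -
  have "(\<Sum>i\<le>p + q. (if i < p then 0 else x (i - p)) *\<^sub>R A i) = (\<Sum>i\<le>q. x i *\<^sub>R A (p + i))" for x :: "nat \<Rightarrow> real"
  proof -
    have "(\<Sum>i\<le>p + q. (if i < p then 0 else x (i - p)) *\<^sub>R A i)
        = (\<Sum>i\<in>{p..p + q}. (if i < p then 0 else x (i - p)) *\<^sub>R A i)"
      by (rule sum.mono_neutral_right) auto
    also have "\<dots> = (\<Sum>i\<le>q. x i *\<^sub>R A (p + i))"
      by (rule sum.reindex_bij_witness [of _ "\<lambda>i. p + i" "\<lambda>i. i - p"]) auto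
    finally show ?thesis .
  qed
  then show ?thesis
    using shift_in_standard_simplex [of _ q p]
    by (auto simp: back_face_def affine_simplex_def restrict_def fun_eq_iff)
qed

definition vertex :: "('v::real_vector \<Rightarrow> 'a) \<Rightarrow> 'v \<Rightarrow> 'a chain"
  where "vertex e x = frag_of (affine_simplex e 0 (\<lambda>_. x))"

definition segment :: "('v::real_vector \<Rightarrow> 'a) \<Rightarrow> 'v \<Rightarrow> 'v \<Rightarrow> 'a chain"
  where "segment e x y = frag_of (affine_simplex e 1 (\<lambda>i. if i = 0 then x else y))"

definition triangle :: "('v::real_vector \<Rightarrow> 'a) \<Rightarrow> 'v \<Rightarrow> 'v \<Rightarrow> 'v \<Rightarrow> 'a chain"
  where "triangle e x y z = frag_of (affine_simplex e 2 (\<lambda>i. if i = 0 then x else if i = 1 then y else z))"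

lemma vertex_eq: "vertex e x = frag_of (restrict (\<lambda>_. e x) (standard_simplex 0))"
  unfolding vertex_def affine_simplex_def
  by (intro arg_cong [where f = frag_of] restrict_ext) (auto simp: standard_simplex_0)

lemma singular_face_affine':
  assumes "k \<le> Suc q" "\<And>i. i \<le> q \<Longrightarrow> A (if i < k then i else Suc i) = B i"
  shows "singular_face (Suc q) k (affine_simplex e (Suc q) A) = affine_simplex e q B"
  using assms by (simp add: singular_face_affine) (rule affine_simplex_cong, simp)

lemma boundary_segment: "chain_boundary (Suc 0) (segment e x y) = vertex e y - vertex e x"
proof -
  let ?A = "\<lambda>i::nat. if i = 0 then x else y"
  have "singular_face (Suc 0) 0 (affine_simplex e (Suc 0) ?A) = affine_simplex e 0 (\<lambda>_. y)"
    by (rule singular_face_affine') auto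
  moreover have "singular_face (Suc 0) (Suc 0) (affine_simplex e (Suc 0) ?A) = affine_simplex e 0 (\<lambda>_. x)"
    by (rule singular_face_affine') auto
  ultimately show ?thesis
    by (simp add: segment_def vertex_def chain_boundary_of)
qed

lemma boundary_triangle:
  "chain_boundary (Suc (Suc 0)) (triangle e x y z) = segment e y z - segment e x z + segment e x y"
proof -
  let ?A = "\<lambda>i::nat. if i = 0 then x else if i = 1 then y else z" and ?s = "Suc (Suc 0)"
  have "singular_face ?s 0 (affine_simplex e ?s ?A) = affine_simplex e (Suc 0) (\<lambda>i. if i = 0 then y else z)"
    by (rule singular_face_affine') auto
  moreover have "singular_face ?s (Suc 0) (affine_simplex e ?s ?A) = affine_simplex e (Suc 0) (\<lambda>i. if i = 0 then x else z)"
    by (rule singular_face_affine') auto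
  moreover have "singular_face ?s ?s (affine_simplex e ?s ?A) = affine_simplex e (Suc 0) (\<lambda>i. if i = 0 then x else y)"
    by (rule singular_face_affine') auto
  ultimately show ?thesis
    by (simp add: segment_def triangle_def chain_boundary_of numeral_2_eq_2)
qed

lemma chain_map_affine [simp]:
  "chain_map 0 f (vertex e x) = vertex (f \<circ> e) x"
  "chain_map (Suc 0) f (segment e x y) = segment (f \<circ> e) x y"
  "chain_map (Suc (Suc 0)) f (triangle e x y z) = triangle (f \<circ> e) x y z"
  by (simp_all add: vertex_def segment_def triangle_def simplex_map_affine numeral_2_eq_2)

lemma singular_chain_affine:
  fixes e :: "'v::real_normed_vector \<Rightarrow> 'a"
  assumes "continuous_map (top_of_set K) T e" "convex K"
  shows "x \<in> K \<Longrightarrow> singular_chain 0 T (vertex e x)"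
    and "x \<in> K \<Longrightarrow> y \<in> K \<Longrightarrow> singular_chain (Suc 0) T (segment e x y)"
    and "x \<in> K \<Longrightarrow> y \<in> K \<Longrightarrow> z \<in> K \<Longrightarrow> singular_chain (Suc (Suc 0)) T (triangle e x y z)"
  using singular_simplex_affine [OF assms]
  by (simp_all add: vertex_def segment_def triangle_def singular_chain_of numeral_2_eq_2)

lemma segment_concat:
  fixes e :: "'v::real_normed_vector \<Rightarrow> 'a"
  assumes "continuous_map (top_of_set K) T e" "convex K" "x \<in> K" "y \<in> K" "z \<in> K"
  shows "bounds (Suc 0) T (segment e x z - (segment e x y + segment e y z))"
proof -
  have "bounds (Suc 0) T (chain_boundary (Suc (Suc 0)) (triangle e x y z))"
    by (intro bounds_boundary singular_chain_affine [OF assms(1,2)] assms)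
  moreover have "chain_boundary (Suc (Suc 0)) (triangle e x y z) = - (segment e x z - (segment e x y + segment e y z))"
    by (simp add: boundary_triangle algebra_simps)
  ultimately show ?thesis by (simp only: singular_relboundary_minus)
qed

lemma segment_translate:
  assumes "\<And>v. e (v + w) = e v"
  shows "segment e (x + w) (y + w) = segment e x y"
proof -
  have "affine_simplex e 1 (\<lambda>i. if i = 0 then x + w else y + w) = affine_simplex e 1 (\<lambda>i. (if i = 0 then x else y) + w)"
    by (rule affine_simplex_cong) auto
  then show ?thesis
    by (simp add: segment_def affine_simplex_translate [of e w, OF assms])
qed

lemma vertex_translate: "(\<And>v. e (v + w) = e v) \<Longrightarrow> vertex e (x + w) = vertex e x"
  by (simp add: vertex_eq)

lemma loop_cycle:
  fixes e :: "'v::real_normed_vector \<Rightarrow> 'a"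
  assumes "continuous_map euclidean T e" and per: "\<And>v. e (v + \<mu>) = e v"
  shows "cycle (Suc 0) T (segment e 0 \<mu>)"
  using singular_chain_affine(2) [of UNIV T e 0 \<mu>] assms(1) vertex_translate [of e \<mu> 0] per
  by (simp add: singular_cycle boundary_segment)

text \<open>The second half of the segment from \<open>0\<close> to \<open>\<mu> + \<nu>\<close> is the translate by \<open>\<mu>\<close> of the segment from
  \<open>0\<close> to \<open>\<nu>\<close>.\<close>

lemma loop_add:
  fixes e :: "'v::real_normed_vector \<Rightarrow> 'a"
  assumes e: "continuous_map euclidean T e" and per: "\<And>v. e (v + \<mu>) = e v"
  shows "bounds (Suc 0) T (segment e 0 (\<mu> + \<nu>) - (segment e 0 \<mu> + segment e 0 \<nu>))"
  using segment_concat [of UNIV T e 0 \<mu> "\<mu> + \<nu>"] e segment_translate [of e \<mu> 0 \<nu>] per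
  by (simp add: add.commute)

lemma loop_nat_mult:
  fixes e :: "'v::real_normed_vector \<Rightarrow> 'a"
  assumes e: "continuous_map euclidean T e" and per: "\<And>v. e (v + \<mu>) = e v"
  shows "bounds (Suc 0) T (segment e 0 (real k *\<^sub>R \<mu>) - frag_cmul (int k) (segment e 0 \<mu>))"
proof (induction k)
  case 0
  show ?case
    using loop_add [OF e, of 0 0] singular_relboundary_minus [of "Suc 0" T "{}" "segment e 0 0"] by simp
next
  case (Suc k)
  have "bounds (Suc 0) T ((segment e 0 (\<mu> + real k *\<^sub>R \<mu>) - (segment e 0 \<mu> + segment e 0 (real k *\<^sub>R \<mu>)))
      + (segment e 0 (real k *\<^sub>R \<mu>) - frag_cmul (int k) (segment e 0 \<mu>)))"
    by (intro singular_relboundary_add loop_add e per Suc)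
  moreover have "\<mu> + real k *\<^sub>R \<mu> = real (Suc k) *\<^sub>R \<mu>" by (simp add: scaleR_left_distrib)
  moreover have "(u - (v + w)) + (w - frag_cmul (int k) v) = u - frag_cmul (int (Suc k)) v" for u v w :: "'a chain"
    by (simp add: frag_cmul_distrib)
  ultimately show ?case by (simp only:)
qed

lemma loop_int_mult:
  fixes e :: "'v::real_normed_vector \<Rightarrow> 'a"
  assumes e: "continuous_map euclidean T e" and per: "\<And>v. e (v + \<mu>) = e v"
  shows "bounds (Suc 0) T (segment e 0 (real_of_int k *\<^sub>R \<mu>) - frag_cmul k (segment e 0 \<mu>))"
proof (cases "k \<ge> 0")
  case True
  then show ?thesis using loop_nat_mult [OF e per, of "nat k"] by simp
next
  case False
  then obtain m where m: "k = - int m" by (metis int_cases2 of_nat_0_le_iff)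
  have per': "e (v + real m *\<^sub>R \<mu>) = e v" for v m
  proof (induction m)
    case (Suc m)
    have "e (v + real m *\<^sub>R \<mu> + \<mu>) = e v" using Suc per by simp
    then show ?case by (simp add: scaleR_left_distrib algebra_simps)
  qed simp
  have "bounds (Suc 0) T (segment e 0 (real m *\<^sub>R \<mu> + - (real m *\<^sub>R \<mu>))
      - (segment e 0 (real m *\<^sub>R \<mu>) + segment e 0 (- (real m *\<^sub>R \<mu>))))"
    by (intro loop_add e per')
  moreover have "bounds (Suc 0) T (segment e 0 0)"
    using loop_nat_mult [OF e per, of 0] by simp
  ultimately have "bounds (Suc 0) T (segment e 0 0 - ((segment e 0 0 - (segment e 0 (real m *\<^sub>R \<mu>) + segment e 0 (- (real m *\<^sub>R \<mu>))))
      + (segment e 0 (real m *\<^sub>R \<mu>) - frag_cmul (int m) (segment e 0 \<mu>))))"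
    using singular_relboundary_diff singular_relboundary_add loop_nat_mult [OF e per, of m] by (metis add.right_inverse)
  moreover have "z - ((z - (u + v)) + (u - frag_cmul (int m) w)) = v - frag_cmul (- int m) w" for u v w z :: "'a chain"
    by (simp add: minus_frag_cmul [symmetric] del: minus_frag_cmul)
  ultimately show ?thesis by (simp only: m of_int_minus of_int_of_nat_eq scaleR_minus_left)
qed

lemma homology_basis_0_path_connected:
  assumes X: "path_connected_space X" and s: "singular_simplex 0 X s"
  shows "homology_basis 0 X {()} (\<lambda>_. frag_of s)"
proof (rule homology_basis_0I [OF s])
  fix f assume f: "singular_simplex 0 X f"
  define v0 :: "nat \<Rightarrow> real" where "v0 = (\<lambda>j. if j = 0 then 1 else 0)"
  have std: "standard_simplex 0 = {v0}" by (simp add: standard_simplex_0 v0_def)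
  have val: "\<sigma> v0 \<in> topspace X" "\<sigma> = restrict (\<lambda>_. \<sigma> v0) (standard_simplex 0)"
    if "singular_simplex 0 X \<sigma>" for \<sigma>
  proof -
    show "\<sigma> v0 \<in> topspace X"
      using that by (auto simp: singular_simplex_def continuous_map_def std)
    have "restrict \<sigma> (standard_simplex 0) = \<sigma>"
      using that by (simp add: singular_simplex_def extensional_restrict)
    moreover have "restrict \<sigma> (standard_simplex 0) = restrict (\<lambda>_. \<sigma> v0) (standard_simplex 0)"
      by (rule restrict_ext) (simp add: std)
    ultimately show "\<sigma> = restrict (\<lambda>_. \<sigma> v0) (standard_simplex 0)" by simp
  qed
  obtain g where g: "pathin X g" "g 0 = s v0" "g 1 = f v0"
    using X val(1) [OF s] val(1) [OF f] unfolding path_connected_space_def by blast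
  have "singular_chain (Suc 0) X (segment g 0 1)"
    by (rule singular_chain_affine(2) [of "{0..1}"]) (use g in \<open>auto simp: pathin_def\<close>)
  moreover have "chain_boundary (Suc 0) (segment g 0 1) = frag_of f - frag_of s"
    unfolding boundary_segment vertex_eq g using val(2) [OF s] val(2) [OF f] by simp
  ultimately show "bounds 0 X (frag_of f - frag_of s)"
    by (auto simp: bounds_iff)
qed

lemma homology_basis_0_vertex:
  fixes e :: "'v::real_normed_vector \<Rightarrow> 'a"
  assumes X: "path_connected_space X" and e: "e x \<in> topspace X"
  shows "homology_basis 0 X {()} (\<lambda>_. vertex e x)"
proof -
  have "singular_simplex 0 X (restrict (\<lambda>_. e x) (standard_simplex 0))"
    using e by (simp add: singular_simplex_def)
  then show ?thesis
    unfolding vertex_eq by (rule homology_basis_0_path_connected [OF X])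
qed

section \<open>The product of a circle and a space\<close>

abbreviation circle :: "complex topology"
  where "circle \<equiv> top_of_set (sphere 0 1)"

definition cap :: "complex \<Rightarrow> complex set"
  where "cap u = {w \<in> sphere 0 1. w \<noteq> - u}"

definition half_circle :: "real \<Rightarrow> complex set"
  where "half_circle \<epsilon> = {w \<in> sphere 0 1. \<epsilon> * Im w > 0}"

text \<open>A point moves along the chord towards \<open>u\<close>, and is projected back to the circle.\<close>

lemma arc_contracts:
  assumes D: "D \<subseteq> sphere 0 1" and u: "u \<in> D"
    and star: "\<And>w s. w \<in> D \<Longrightarrow> 0 \<le> s \<Longrightarrow> s \<le> 1 \<Longrightarrow>
      (1 - s) *\<^sub>R w + s *\<^sub>R u \<noteq> 0 \<and> sgn ((1 - s) *\<^sub>R w + s *\<^sub>R u) \<in> D"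
  shows "homotopic_with (\<lambda>_. True) (top_of_set D) (top_of_set D) (\<lambda>w. w) (\<lambda>_. (u::complex))"
proof -
  let ?h = "\<lambda>(s, w). sgn ((1 - s) *\<^sub>R w + s *\<^sub>R u)"
  have "continuous_on ({0..1} \<times> D) ?h"
    unfolding sgn_div_norm case_prod_unfold
    by (intro continuous_intros) (use star in auto)
  moreover have "?h ` ({0..1} \<times> D) \<subseteq> D" using star by auto
  moreover have "sgn w = w" if "w \<in> D" for w
    using that D by (auto simp: sgn_div_norm)
  ultimately show ?thesis
    using u by (subst homotopic_with) (auto intro!: exI [of _ ?h] simp: image_subset_iff_funcset)
qed

lemma cap_contracts:
  assumes u: "cmod u = 1"
  shows "homotopic_with (\<lambda>_. True) (top_of_set (cap u)) (top_of_set (cap u)) (\<lambda>w. w) (\<lambda>_. u)"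
proof (rule arc_contracts)
  have u0: "u \<noteq> 0" using u by auto
  then show "u \<in> cap u" using u by (auto simp: cap_def)
  fix w and s :: real assume w: "w \<in> cap u" and s: "0 \<le> s" "s \<le> 1"
  let ?v = "(1 - s) *\<^sub>R w + s *\<^sub>R u"
  have no: "?v \<noteq> - (r *\<^sub>R u)" if r: "0 \<le> r" for r
  proof
    assume "?v = - (r *\<^sub>R u)"
    then have eq: "(1 - s) *\<^sub>R w = - ((s + r) *\<^sub>R u)" by (simp add: algebra_simps eq_neg_iff_add_eq_0)
    then have "norm ((1 - s) *\<^sub>R w) = norm ((s + r) *\<^sub>R u)" by simp
    then have sr: "1 - s = s + r" using s r u w by (simp add: cap_def)
    then have "1 - s \<noteq> 0" using s r by auto
    moreover have "(1 - s) *\<^sub>R w = (1 - s) *\<^sub>R (- u)" using eq sr by (metis scaleR_minus_right)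
    ultimately have "w = - u" by (metis scaleR_cancel_left)
    then show False using w by (simp add: cap_def)
  qed
  have v0: "?v \<noteq> 0" using no [of 0] by simp
  moreover have "sgn ?v \<noteq> - u"
  proof
    assume "sgn ?v = - u"
    then have "norm ?v *\<^sub>R sgn ?v = - (norm ?v *\<^sub>R u)" by simp
    then show False using no [of "norm ?v"] v0 by (simp add: sgn_div_norm)
  qed
  ultimately show "?v \<noteq> 0 \<and> sgn ?v \<in> cap u" by (simp add: cap_def norm_sgn)
qed (auto simp: cap_def)

lemma half_circle_contracts:
  assumes e: "\<bar>\<epsilon>\<bar> = 1"
  shows "homotopic_with (\<lambda>_. True) (top_of_set (half_circle \<epsilon>)) (top_of_set (half_circle \<epsilon>)) (\<lambda>w. w)
    (\<lambda>_. complex_of_real \<epsilon> * \<i>)"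
proof (rule arc_contracts)
  show u: "complex_of_real \<epsilon> * \<i> \<in> half_circle \<epsilon>"
    using e by (auto simp: half_circle_def norm_mult abs_if split: if_splits)
  fix w and s :: real assume w: "w \<in> half_circle \<epsilon>" and s: "0 \<le> s" "s \<le> 1"
  let ?v = "(1 - s) *\<^sub>R w + s *\<^sub>R (complex_of_real \<epsilon> * \<i>)"
  have "\<epsilon> * \<epsilon> = 1" using e by (auto simp: abs_if split: if_splits)
  then have "\<epsilon> * Im ?v = (1 - s) * (\<epsilon> * Im w) + s" by (simp add: algebra_simps)
  moreover have "\<epsilon> * Im w > 0" using w by (simp add: half_circle_def)
  ultimately have pos: "\<epsilon> * Im ?v > 0"
    using s by (cases "s = 1") (auto intro!: add_pos_nonneg mult_pos_pos)
  then have v0: "?v \<noteq> 0" by (metis less_irrefl mult_zero_right zero_complex.sel(2))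
  have "\<epsilon> * Im (sgn ?v) = \<epsilon> * Im ?v / norm ?v" by (simp add: Im_sgn)
  then have "\<epsilon> * Im (sgn ?v) > 0" using pos v0 by (metis divide_pos_pos zero_less_norm_iff)
  then show "?v \<noteq> 0 \<and> sgn ?v \<in> half_circle \<epsilon>"
    using v0 by (simp add: half_circle_def norm_sgn)
qed (auto simp: half_circle_def)

abbreviation arc_times :: "complex set \<Rightarrow> 'a topology \<Rightarrow> (complex \<times> 'a) topology"
  where "arc_times D Q \<equiv> prod_topology (top_of_set D) Q"

lemma subtopology_arc_times:
  assumes "D \<subseteq> E"
  shows "subtopology (arc_times E Q) (D \<times> topspace Q) = arc_times D Q"
  using assms by (simp add: subtopology_Times subtopology_subtopology inf.absorb2)

lemma slice_map: "u \<in> D \<Longrightarrow> continuous_map Q (arc_times D Q) (Pair u)"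
  by (auto intro!: continuous_map_pairedI)

text \<open>If the first factor contracts to \<open>u\<close>, every cycle can be pushed into the slice over \<open>u\<close>.\<close>

lemma slice_retract:
  assumes D: "homotopic_with (\<lambda>_. True) (top_of_set D) (top_of_set D) (\<lambda>w. w) (\<lambda>_. u)"
    and z: "cycle p (arc_times D Q) z"
  shows "bounds p (arc_times D Q) (z - chain_map p (Pair u) (chain_map p snd z))"
proof -
  have "homotopic_with (\<lambda>_. True) (arc_times D Q) (arc_times D Q)
      (\<lambda>z. (fst z, snd z)) (\<lambda>z. (u, snd z))"
    by (rule homotopic_with_prod_topology [OF D homotopic_with_refl [THEN iffD2]]) auto
  then have "homotopic_with (\<lambda>_. True) (arc_times D Q) (arc_times D Q) id (Pair u \<circ> snd)"
    by (simp add: o_def id_def)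
  from homotopic_chain_maps_bound [OF this z] show ?thesis
    using chain_map_ident [of p "arc_times D Q" z] z by (simp add: chain_map_compose singular_cycle)
qed

lemma chain_map_snd_slice: "singular_chain p Q c \<Longrightarrow> chain_map p snd (chain_map p (Pair u) c) = c"
proof -
  have "chain_map p snd (chain_map p (Pair u) c) = chain_map p (snd \<circ> Pair u) c"
    by (simp only: chain_map_compose o_apply)
  also assume "singular_chain p Q c"
  then have "chain_map p (snd \<circ> Pair u) c = c"
    by (rule chain_map_id_gen) simp
  finally show "chain_map p snd (chain_map p (Pair u) c) = c" .
qed

lemma slices_homologous:
  assumes D: "homotopic_with (\<lambda>_. True) (top_of_set D) (top_of_set D) (\<lambda>w. w) (\<lambda>_. u)"
    and x: "x \<in> D" and y: "y \<in> D" and c: "cycle p Q c"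
  shows "bounds p (arc_times D Q) (chain_map p (Pair x) c - chain_map p (Pair y) c)"
proof -
  have "bounds p (arc_times D Q) (chain_map p (Pair v) c - chain_map p (Pair u) c)" if "v \<in> D" for v
    using slice_retract [OF D cycle_chain_map [OF c slice_map [OF that]]] chain_map_snd_slice [of p Q c v] c
    by (simp add: singular_cycle)
  from bounds_trans [OF this [OF x] bounds_commute [OF this [OF y]]] show ?thesis .
qed

lemma caps: "1 \<in> cap 1" "\<i> \<in> cap 1" "- \<i> \<in> cap 1" "- 1 \<in> cap (- 1)" "\<i> \<in> cap (- 1)" "- \<i> \<in> cap (- 1)"
  by (auto simp: cap_def complex_eq_iff)

lemma cap_Un: "cap 1 \<union> cap (- 1) = sphere 0 1"
  by (auto simp: cap_def)

lemma cap_Int: "cap 1 \<inter> cap (- 1) = half_circle 1 \<union> half_circle (- 1)"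
proof -
  have "Im w \<noteq> 0" if "w \<noteq> 1" "w \<noteq> - 1" "cmod w = 1" for w
  proof
    assume "Im w = 0"
    then have "\<bar>Re w\<bar> = 1" using that(3) by (simp add: cmod_def)
    then show False using that \<open>Im w = 0\<close> by (auto simp: abs_if complex_eq_iff split: if_splits)
  qed
  then show ?thesis by (fastforce simp: cap_def half_circle_def)
qed

text \<open>The decomposition \<open>H\<^sub>p\<^sub>+\<^sub>1(S\<^sup>1 \<times> Q) = H\<^sub>p\<^sub>+\<^sub>1(Q) \<oplus> H\<^sub>p(Q)\<close>, by Mayer-Vietoris for the parts over the
  complements of \<open>- 1\<close> and of \<open>1\<close>. Each of them retracts to a slice, which gives the first summand.
  They meet over two open half circles, where a cycle is a pair of cycles of \<open>Q\<close>; it bounds in both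
  parts if and only if the two add up to a boundary, so the second summand comes from the
  differences of the slices over \<open>\<i>\<close> and \<open>- \<i>\<close>. The chains \<open>a k\<close> and \<open>b k\<close> that fill such a difference
  are left open, so that explicit arcs can be inserted.\<close>

proposition circle_times_homology_basis:
  assumes g: "homology_basis p Q K g" and h: "homology_basis (Suc p) Q I h"
    and a: "\<And>k. k \<in> K \<Longrightarrow> singular_chain (Suc p) (arc_times (cap 1) Q) (a k)"
    and b: "\<And>k. k \<in> K \<Longrightarrow> singular_chain (Suc p) (arc_times (cap (- 1)) Q) (b k)"
    and da: "\<And>k. k \<in> K \<Longrightarrow> chain_boundary (Suc p) (a k) = chain_map p (Pair \<i>) (g k) - chain_map p (Pair (- \<i>)) (g k)"
    and db: "\<And>k. k \<in> K \<Longrightarrow> chain_boundary (Suc p) (b k) = chain_map p (Pair \<i>) (g k) - chain_map p (Pair (- \<i>)) (g k)"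
  shows "homology_basis (Suc p) (prod_topology circle Q) (I <+> K)
    (case_sum (\<lambda>i. chain_map (Suc p) (Pair 1) (h i)) (\<lambda>k. a k - b k))"
proof -
  let ?X = "prod_topology circle Q"
  let ?U = "cap 1 \<times> topspace Q" and ?V = "cap (- 1) \<times> topspace Q"
  let ?P = "half_circle 1 \<times> topspace Q" and ?N = "half_circle (- 1) \<times> topspace Q"
  have caps_sub: "cap u \<subseteq> sphere 0 1" "half_circle \<epsilon> \<subseteq> sphere 0 1" for u \<epsilon>
    by (auto simp: cap_def half_circle_def)
  have top: "subtopology ?X (D \<times> topspace Q) = arc_times D Q" if "D \<subseteq> sphere 0 1" for D
    by (rule subtopology_arc_times [OF that])
  have UV: "?U \<union> ?V = topspace ?X" "?U \<inter> ?V = ?P \<union> ?N"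
    using cap_Un cap_Int by auto
  have WX: "subtopology ?X (?U \<union> ?V) = ?X" by (simp only: UV subtopology_topspace)
  have op: "openin ?X (D \<times> topspace Q)" if "openin circle D" for D
    using that by (simp add: openin_prod_Times_iff)
  have "openin circle (cap u)" for u
  proof -
    have "cap u = sphere 0 1 \<inter> - {- u}" by (auto simp: cap_def)
    then show ?thesis by (metis open_Compl closed_singleton openin_open)
  qed
  then have openUV: "openin ?X ?U" "openin ?X ?V" using op by auto
  have "openin circle (half_circle \<epsilon>)" for \<epsilon>
  proof -
    have "half_circle \<epsilon> = sphere 0 1 \<inter> {w. \<epsilon> * Im w > 0}" by (auto simp: half_circle_def)
    moreover have "open {w. \<epsilon> * Im w > 0}" by (intro open_Collect_less continuous_intros)
    ultimately show ?thesis by (metis openin_open)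
  qed
  then have openPN: "openin ?X ?P" "openin ?X ?N" using op by auto
  note cu = cap_contracts [of 1, simplified] and cv = cap_contracts [of "- 1", simplified]
  have hp: "homotopic_with (\<lambda>_. True) (top_of_set (half_circle 1)) (top_of_set (half_circle 1)) (\<lambda>w. w) (\<lambda>_. \<i>)"
    and hn: "homotopic_with (\<lambda>_. True) (top_of_set (half_circle (- 1))) (top_of_set (half_circle (- 1))) (\<lambda>w. w) (\<lambda>_. - \<i>)"
    using half_circle_contracts [of 1] half_circle_contracts [of "- 1"] by simp_all
  have ii: "\<i> \<in> half_circle 1" "- \<i> \<in> half_circle (- 1)" by (auto simp: half_circle_def)
  have snd: "continuous_map (arc_times D Q) Q snd" for D by (simp add: continuous_map_snd)
  have finI: "finite I" and finK: "finite K" using h g by (auto simp: homology_basis_def)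
  have g_cyc: "cycle p Q (g k)" if "k \<in> K" for k using g that by (auto simp: homology_basis_def)
  have h_cyc: "cycle (Suc p) Q (h i)" if "i \<in> I" for i using h that by (auto simp: homology_basis_def)
  let ?x = "\<lambda>i. chain_map (Suc p) (Pair (1::complex)) (h i)"
  have slice_span: "\<exists>c. bounds (Suc p) ?X (chain_map (Suc p) (Pair 1) z - comb I c ?x)"
    if "cycle (Suc p) Q z" for z
  proof -
    obtain c where "bounds (Suc p) Q (z - comb I c h)" using homology_basis_span [OF h \<open>cycle (Suc p) Q z\<close>] .
    then have "bounds (Suc p) ?X (chain_map (Suc p) (Pair 1) (z - comb I c h))"
      by (rule bounds_chain_map) (auto intro: slice_map)
    then show ?thesis by (auto simp: chain_map_diff chain_map_comb finI)
  qed
  have upU: "bounds r ?X z" if "bounds r (arc_times (cap u) Q) z" for r u z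
  proof -
    have "cap u \<times> topspace Q \<subseteq> ?U \<union> ?V" using caps_sub(1) [of u] unfolding UV by auto
    then have "bounds r (subtopology ?X (?U \<union> ?V)) z"
      by (rule singular_boundary_mono) (use that in \<open>simp only: top [OF caps_sub(1)]\<close>)
    then show ?thesis unfolding WX .
  qed
  have "homology_basis (Suc p) (subtopology ?X (?U \<union> ?V)) (I <+> K) (case_sum ?x (\<lambda>k. a k - b k))"
  proof (rule mayer_vietoris_basis [OF openUV finI finK])
    show "cycle (Suc p) (subtopology ?X ?U) (?x i)" if "i \<in> I" for i
      unfolding top [OF caps_sub(1)] by (rule cycle_chain_map [OF h_cyc [OF that] slice_map]) (rule caps)
  next
    fix z assume "cycle (Suc p) (subtopology ?X ?U) z"
    then have z: "cycle (Suc p) (arc_times (cap 1) Q) z" unfolding top [OF caps_sub(1)] .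
    have "bounds (Suc p) ?X (z - chain_map (Suc p) (Pair 1) (chain_map (Suc p) snd z))"
      by (rule upU [OF slice_retract [OF cu z]])
    with slice_span [OF cycle_chain_map [OF z snd]]
    show "\<exists>c. bounds (Suc p) (subtopology ?X (?U \<union> ?V)) (z - comb I c ?x)"
      unfolding WX using bounds_trans by blast
  next
    fix z assume "cycle (Suc p) (subtopology ?X ?V) z"
    then have z: "cycle (Suc p) (arc_times (cap (- 1)) Q) z" unfolding top [OF caps_sub(1)] .
    let ?z = "chain_map (Suc p) snd z"
    have cz: "cycle (Suc p) Q ?z" by (rule cycle_chain_map [OF z snd])
    have 1: "bounds (Suc p) ?X (z - chain_map (Suc p) (Pair (- 1)) ?z)"
      by (rule upU [OF slice_retract [OF cv z]])
    have 2: "bounds (Suc p) ?X (chain_map (Suc p) (Pair (- 1)) ?z - chain_map (Suc p) (Pair \<i>) ?z)"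
      by (rule upU [OF slices_homologous [OF cv _ _ cz]]) (rule caps)+
    have 3: "bounds (Suc p) ?X (chain_map (Suc p) (Pair \<i>) ?z - chain_map (Suc p) (Pair 1) ?z)"
      by (rule upU [OF slices_homologous [OF cu _ _ cz]]) (rule caps)+
    from bounds_trans [OF 1 bounds_trans [OF 2 3]] slice_span [OF cz]
    show "\<exists>c. bounds (Suc p) (subtopology ?X (?U \<union> ?V)) (z - comb I c ?x)"
      unfolding WX using bounds_trans by blast
  next
    fix c i assume bc: "bounds (Suc p) (subtopology ?X (?U \<union> ?V)) (comb I c ?x)" and i: "i \<in> I"
    have "bounds (Suc p) Q (chain_map (Suc p) snd (comb I c ?x))"
      using bounds_chain_map [OF bc [unfolded WX] snd [of "sphere 0 1"]] .
    moreover have "chain_map (Suc p) snd (comb I c ?x) = comb I c h"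
      unfolding chain_map_comb [OF finI]
      by (rule sum.cong) (use h_cyc in \<open>simp_all add: singular_cycle chain_map_snd_slice [of "Suc p" Q]\<close>)
    ultimately show "c i = 0" using homology_basisD(3) [OF h _ i] by simp
  next
    show "singular_chain (Suc p) (subtopology ?X ?U) (a k)" "singular_chain (Suc p) (subtopology ?X ?V) (b k)"
      "chain_boundary (Suc p) (b k) = chain_boundary (Suc p) (a k)" if "k \<in> K" for k
      unfolding top [OF caps_sub(1)] using that a b by (simp_all add: da db)
  next
    fix m assume "cycle p (subtopology ?X (?U \<inter> ?V)) m" and mU: "bounds p (subtopology ?X ?U) m"
    then have m: "cycle p (subtopology ?X (?P \<union> ?N)) m" unfolding UV by simp
    obtain u v where u: "singular_chain p (subtopology ?X ?P) u" and v: "singular_chain p (subtopology ?X ?N) v"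
      and muv: "bounds p (subtopology ?X (?P \<union> ?N)) (m - (u + v))"
      using small_cycle_exists [OF openPN m] .
    \<comment> \<open>As the half circles are disjoint, the two parts of \<open>m\<close> are cycles separately.\<close>
    have empty: "?P \<inter> ?N = {}" by (auto simp: half_circle_def)
    have "cycle p (subtopology ?X (?P \<union> ?N)) (u + v)"
      using singular_relcycle_diff [OF m bounds_imp_cycle [OF muv]] by (simp add: add.commute)
    then have "chain_boundary p (u + v) = 0" by (simp add: singular_cycle)
    then have duv: "chain_boundary p v = - chain_boundary p u"
      by (simp add: chain_boundary_add eq_neg_iff_add_eq_0 add.commute)
    have "singular_chain (p - 1) (subtopology ?X (?P \<inter> ?N)) (chain_boundary p u)"
      using singular_chain_boundary [OF u] singular_chain_boundary [OF v]
      by (intro singular_chain_Int) (simp_all add: duv singular_chain_minus)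
    then have "chain_boundary p u = 0"
      unfolding empty by (simp add: singular_chain_empty)
    then have cu': "cycle p (arc_times (half_circle 1) Q) u" and cv': "cycle p (arc_times (half_circle (- 1)) Q) v"
      using u v duv unfolding top [OF caps_sub(2)] by (auto simp: singular_cycle)
    let ?u = "chain_map p snd u" and ?v = "chain_map p snd v"
    have cyc: "cycle p Q ?u" "cycle p Q ?v"
      using cycle_chain_map [OF cu' snd] cycle_chain_map [OF cv' snd] .
    obtain c where c: "bounds p Q (?u - comb K c g)" using homology_basis_span [OF g cyc(1)] .
    \<comment> \<open>As \<open>m\<close> bounds over the arc around 1, the projections of its parts to \<open>Q\<close> add up to a boundary.\<close>
    have muvU: "bounds p (subtopology ?X ?U) (m - (u + v))"
      by (rule singular_boundary_mono [OF _ muv]) (use UV in auto)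
    have "bounds p (subtopology ?X ?U) (u + v)"
      using singular_relboundary_diff [OF mU muvU] by (simp add: add.commute)
    then have "bounds p Q (chain_map p snd (u + v))"
      unfolding top [OF caps_sub(1)] by (rule bounds_chain_map [OF _ snd])
    then have c2: "bounds p Q (?v + comb K c g)"
      using singular_relboundary_diff [OF _ c] by (fastforce simp: chain_map_add algebra_simps)
    have upP: "bounds p (subtopology ?X (?P \<union> ?N)) z" if "bounds p (arc_times (half_circle 1) Q) z" for z
      using that unfolding top [OF caps_sub(2), symmetric] by (rule singular_boundary_mono [rotated]) auto
    have upN: "bounds p (subtopology ?X (?P \<union> ?N)) z" if "bounds p (arc_times (half_circle (- 1)) Q) z" for z
      using that unfolding top [OF caps_sub(2), symmetric] by (rule singular_boundary_mono [rotated]) auto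
    have 1: "bounds p (subtopology ?X (?P \<union> ?N)) (u - chain_map p (Pair \<i>) ?u)"
      by (rule upP [OF slice_retract [OF hp cu']])
    have 2: "bounds p (subtopology ?X (?P \<union> ?N)) (chain_map p (Pair \<i>) (?u - comb K c g))"
      by (rule upP [OF bounds_chain_map [OF c slice_map [OF ii(1)]]])
    have 3: "bounds p (subtopology ?X (?P \<union> ?N)) (v - chain_map p (Pair (- \<i>)) ?v)"
      by (rule upN [OF slice_retract [OF hn cv']])
    have 4: "bounds p (subtopology ?X (?P \<union> ?N)) (chain_map p (Pair (- \<i>)) (?v + comb K c g))"
      by (rule upN [OF bounds_chain_map [OF c2 slice_map [OF ii(2)]]])
    have eq: "comb K c (\<lambda>k. chain_boundary (Suc p) (a k))
        = chain_map p (Pair \<i>) (comb K c g) - chain_map p (Pair (- \<i>)) (comb K c g)"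
      unfolding chain_map_comb [OF finK] sum_subtractf [symmetric]
      by (rule sum.cong) (auto simp: da, metis (no_types, lifting) add_diff_cancel_right' diff_add_cancel frag_cmul_distrib2)
    have "m - comb K c (\<lambda>k. chain_boundary (Suc p) (a k)) = (m - (u + v)) + ((u - chain_map p (Pair \<i>) ?u)
        + (chain_map p (Pair \<i>) (?u - comb K c g) + ((v - chain_map p (Pair (- \<i>)) ?v)
        + chain_map p (Pair (- \<i>)) (?v + comb K c g))))"
      unfolding eq by (simp add: chain_map_diff chain_map_add)
    then have "bounds p (subtopology ?X (?P \<union> ?N)) (m - comb K c (\<lambda>k. chain_boundary (Suc p) (a k)))"
      by (simp only:) (intro singular_relboundary_add muv 1 2 3 4)
    then show "\<exists>d. bounds p (subtopology ?X (?U \<inter> ?V)) (m - comb K d (\<lambda>k. chain_boundary (Suc p) (a k)))"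
      unfolding UV by (rule exI [of _ c])
  next
    fix d k assume bd0: "bounds p (subtopology ?X (?U \<inter> ?V)) (comb K d (\<lambda>k. chain_boundary (Suc p) (a k)))" and k: "k \<in> K"
    have bd: "bounds p (subtopology ?X (?P \<union> ?N)) (comb K d (\<lambda>k. chain_boundary (Suc p) (a k)))"
      using bd0 unfolding UV .
    let ?s = "chain_map p (Pair \<i>) (comb K d g)" and ?t = "- chain_map p (Pair (- \<i>)) (comb K d g)"
    have eq: "comb K d (\<lambda>k. chain_boundary (Suc p) (a k)) = ?s + ?t"
      unfolding chain_map_comb [OF finK] add_uminus_conv_diff sum_subtractf [symmetric]
      by (rule sum.cong) (auto simp: da, metis (no_types, lifting) add_diff_cancel_right' diff_add_cancel frag_cmul_distrib2)
    have gc: "singular_chain p Q (comb K d g)"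
      by (rule comb_chain) (use g_cyc in \<open>auto simp: singular_cycle\<close>)
    have s: "singular_chain p (subtopology ?X ?P) ?s"
      unfolding top [OF caps_sub(2)] by (rule singular_chain_chain_map [OF gc slice_map [OF ii(1)]])
    have t: "singular_chain p (subtopology ?X ?N) ?t"
      unfolding top [OF caps_sub(2)] singular_chain_minus by (rule singular_chain_chain_map [OF gc slice_map [OF ii(2)]])
    obtain u v where u: "singular_chain (Suc p) (subtopology ?X ?P) u" and v: "singular_chain (Suc p) (subtopology ?X ?N) v"
      and duv: "chain_boundary (Suc p) (u + v) = ?s + ?t"
      by (rule small_boundary_exists [OF openPN s t bd [unfolded eq]])
    \<comment> \<open>As the half circles are disjoint, the two parts of the boundary bound separately.\<close>
    have empty: "?P \<inter> ?N = {}" by (auto simp: half_circle_def)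
    have e1: "?s - chain_boundary (Suc p) u = chain_boundary (Suc p) v - ?t"
      using duv by (simp add: chain_boundary_add algebra_simps)
    have "singular_chain p (subtopology ?X (?P \<inter> ?N)) (?s - chain_boundary (Suc p) u)"
    proof (rule singular_chain_Int)
      show "singular_chain p (subtopology ?X ?P) (?s - chain_boundary (Suc p) u)"
        by (intro singular_chain_diff s singular_chain_boundary_alt u)
      show "singular_chain p (subtopology ?X ?N) (?s - chain_boundary (Suc p) u)"
        unfolding e1 by (intro singular_chain_diff t singular_chain_boundary_alt v)
    qed
    then have "?s = chain_boundary (Suc p) u"
      unfolding empty by (simp add: singular_chain_empty)
    then have "bounds p (arc_times (half_circle 1) Q) ?s"
      using bounds_boundary [OF u] unfolding top [OF caps_sub(2)] by simp
    then have "bounds p Q (chain_map p snd ?s)" by (rule bounds_chain_map [OF _ snd])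
    then have "bounds p Q (comb K d g)" by (simp add: chain_map_snd_slice [OF gc])
    then show "d k = 0" using homology_basisD(3) [OF g _ k] by blast
  qed
  then show ?thesis unfolding WX .
qed

section \<open>The circle\<close>

definition circle_exp :: "real \<Rightarrow> complex"
  where "circle_exp x = exp (2 * of_real pi * \<i> * of_real x)"

lemma torus_exp_circle_exp: "torus_exp x = (circle_exp (fst x), circle_exp (snd x))"
  by (simp add: torus_exp_def circle_exp_def)

lemma circle_exp_add: "circle_exp (x + y) = circle_exp x * circle_exp y"
  by (simp add: circle_exp_def exp_add [symmetric] algebra_simps)

lemma circle_exp_0 [simp]: "circle_exp 0 = 1"
  by (simp add: circle_exp_def)

lemma circle_exp_cis: "circle_exp x = cis (2 * pi * x)"
  by (simp add: circle_exp_def cis_conv_exp mult_ac)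

lemma circle_exp_int [simp]: "circle_exp (real_of_int k) = 1"
  by (simp add: circle_exp_cis cis_multiple_2pi)

lemma circle_exp_periodic [simp]: "circle_exp (x + 1) = circle_exp x"
  using circle_exp_int [of 1] by (simp add: circle_exp_add)

lemma norm_circle_exp [simp]: "cmod (circle_exp x) = 1"
  by (simp add: circle_exp_cis)

lemma continuous_circle_exp [continuous_intros]:
  "continuous_on S f \<Longrightarrow> continuous_on S (\<lambda>x. circle_exp (f x))"
  unfolding circle_exp_def by (intro continuous_intros)

lemma continuous_map_circle_exp: "continuous_on UNIV f \<Longrightarrow> continuous_map euclidean circle (\<lambda>x. circle_exp (f x))"
  by (simp add: continuous_map_in_subtopology continuous_circle_exp)

lemma circle_exp_quarter: "circle_exp (1/4) = \<i>" "circle_exp (- (1/4)) = - \<i>" "circle_exp (- (3/4)) = \<i>"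
proof -
  show q: "circle_exp (1/4) = \<i>" by (simp add: circle_exp_cis)
  have "circle_exp (- (1/4)) = cis (- (pi / 2))" by (simp add: circle_exp_cis)
  then show "circle_exp (- (1/4)) = - \<i>" by (simp add: cis_minus_pi_half)
  show "circle_exp (- (3/4)) = \<i>" using circle_exp_periodic [of "- (3/4)"] q by simp
qed

lemma circle_exp_cap:
  assumes "\<bar>x\<bar> \<le> 1/4"
  shows "circle_exp x \<in> cap 1" "circle_exp (x - 1/2) \<in> cap (- 1)"
proof -
  have "0 \<le> cos (2 * pi * x)"
  proof (rule cos_ge_zero)
    have "- (1/4) \<le> x" "x \<le> 1/4" using assms by auto
    then have "pi * - (1/4) \<le> pi * x" "pi * x \<le> pi * (1/4)" by (intro mult_left_mono; simp)+
    then show "- (pi / 2) \<le> 2 * pi * x" "2 * pi * x \<le> pi / 2" by auto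
  qed
  then have c: "Re (circle_exp x) \<ge> 0" by (simp add: circle_exp_cis)
  have h: "circle_exp (- (1/2)) = - 1"
  proof -
    have "circle_exp (- (1/2)) = cis (- pi)" by (simp add: circle_exp_cis)
    then show ?thesis by (simp add: complex_eq_iff)
  qed
  show "circle_exp x \<in> cap 1" using c by (auto simp: cap_def)
  have "circle_exp (x - 1/2) = - circle_exp x" using circle_exp_add [of x "- (1/2)"] h by simp
  moreover have "circle_exp x \<noteq> - 1" using c by auto
  ultimately show "circle_exp (x - 1/2) \<in> cap (- 1)"
    by (auto simp: cap_def) (metis add.inverse_inverse)
qed

lemma affine_simplex_linear:
  assumes "linear L"
  shows "affine_simplex (e \<circ> L) p A = affine_simplex e p (\<lambda>i. L (A i))"
  using assms by (simp add: affine_simplex_def o_def linear_sum linear_scale)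

lemma segment_linear: "linear L \<Longrightarrow> segment (e \<circ> L) x y = segment e (L x) (L y)"
  by (simp add: segment_def affine_simplex_linear if_distrib)

text \<open>The two arcs lead from \<open>- \<i>\<close> to \<open>\<i>\<close>, through 1 and through \<open>- 1\<close>. Their difference is a full turn
  that starts at a point other than 1, and translating a part of it by a period moves the start.\<close>

lemma two_arcs_homologous_loop:
  assumes e: "continuous_map euclideanreal T e" and per: "\<And>x. e (x + 1) = e x"
  shows "bounds (Suc 0) T (segment e 0 1 - (segment e (- (1/4)) (1/4) - segment e (- (1/4)) (- (3/4))))"
proof -
  let ?s = "segment e"
  have c: "bounds (Suc 0) T (?s x z - (?s x y + ?s y z))" for x y z
    using segment_concat [of UNIV T e x y z] e by simp
  have t: "?s (- (3/4)) 0 = ?s (1/4) 1"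
    using segment_translate [of e 1 "- (3/4)" 0] per by simp
  have "?s 0 1 - (?s (- (1/4)) (1/4) - ?s (- (1/4)) (- (3/4))) =
     (?s 0 1 - (?s 0 (1/4) + ?s (1/4) 1)) - (?s (- (3/4)) (1/4) - (?s (- (3/4)) 0 + ?s 0 (1/4)))
     - (?s (- (1/4)) (1/4) - (?s (- (1/4)) (- (3/4)) + ?s (- (3/4)) (1/4)))"
    unfolding t by simp
  then show ?thesis
    by (simp only:) (intro singular_relboundary_diff c)
qed

lemma arc_chains:
  fixes y :: "'a::topological_space"
  assumes "y \<in> S"
  shows "singular_chain (Suc 0) (arc_times (cap 1) (top_of_set S)) (segment (\<lambda>x. (circle_exp x, y)) (- (1/4)) (1/4))"
    and "singular_chain (Suc 0) (arc_times (cap (- 1)) (top_of_set S)) (segment (\<lambda>x. (circle_exp x, y)) (- (1/4)) (- (3/4)))"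
proof -
  have "continuous_map (top_of_set {- (1/4)..1/4}) (arc_times (cap 1) (top_of_set S)) (\<lambda>x. (circle_exp x, y))"
    using assms circle_exp_cap(1) by (auto intro!: continuous_map_pairedI continuous_intros)
  then show "singular_chain (Suc 0) (arc_times (cap 1) (top_of_set S)) (segment (\<lambda>x. (circle_exp x, y)) (- (1/4)) (1/4))"
    by (rule singular_chain_affine) auto
  have "circle_exp x \<in> cap (- 1)" if "- (3/4) \<le> x" "x \<le> - (1/4)" for x
  proof -
    have "\<bar>x + 1/2\<bar> \<le> 1/4" using that by linarith
    from circle_exp_cap(2) [OF this] show ?thesis by simp
  qed
  then have "continuous_map (top_of_set {- (3/4).. - (1/4)}) (arc_times (cap (- 1)) (top_of_set S)) (\<lambda>x. (circle_exp x, y))"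
    using assms by (auto intro!: continuous_map_pairedI continuous_intros)
  then show "singular_chain (Suc 0) (arc_times (cap (- 1)) (top_of_set S)) (segment (\<lambda>x. (circle_exp x, y)) (- (1/4)) (- (3/4)))"
    by (rule singular_chain_affine) auto
qed

lemma arc_boundaries:
  "chain_boundary (Suc 0) (segment (\<lambda>x. (circle_exp x, e v)) (- (1/4)) (1/4))
    = chain_map 0 (Pair \<i>) (vertex e v) - chain_map 0 (Pair (- \<i>)) (vertex e v)"
  "chain_boundary (Suc 0) (segment (\<lambda>x. (circle_exp x, e v)) (- (1/4)) (- (3/4)))
    = chain_map 0 (Pair \<i>) (vertex e v) - chain_map 0 (Pair (- \<i>)) (vertex e v)"
  unfolding boundary_segment chain_map_affine by (simp_all add: vertex_eq circle_exp_quarter)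

text \<open>The circle is its own product with a point.\<close>

lemma homology_basis_circle:
  shows homology_basis_circle_1: "homology_basis (Suc 0) circle {()} (\<lambda>_. segment circle_exp 0 1)"
    and homology_basis_circle_2: "homology_basis (Suc (Suc p)) circle {} h"
    and homology_basis_circle_0: "homology_basis 0 circle {()} (\<lambda>_. vertex circle_exp 0)"
proof -
  let ?Q = "top_of_set {1::complex}"
  let ?C = "prod_topology circle ?Q"
  let ?e = "\<lambda>x. (circle_exp x, 1::complex)"
  have Q0: "homology_basis 0 ?Q {()} (\<lambda>_. vertex (\<lambda>_::real. 1) 0)"
    by (rule homology_basis_0_vertex) (auto intro: contractible_imp_path_connected_space)
  have "contractible_space ?Q" by simp
  note Qp = homology_basis_contractible [OF this]
  have f: "continuous_map circle ?C (\<lambda>w. (w, 1::complex))" by (intro continuous_map_pairedI) auto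
  have g: "continuous_map ?C circle fst" by (rule continuous_map_fst)
  have gf: "homotopic_with (\<lambda>_. True) circle circle (fst \<circ> (\<lambda>w. (w, 1::complex))) id"
    by (rule homotopic_with_equal [OF _ _ continuous_map_compose [OF f g]]) auto
  have fg: "homotopic_with (\<lambda>_. True) ?C ?C ((\<lambda>w. (w, 1::complex)) \<circ> fst) id"
    by (rule homotopic_with_equal [OF _ _ continuous_map_compose [OF g f]]) auto
  have ce: "continuous_map euclideanreal circle circle_exp"
    using continuous_map_circle_exp [of "\<lambda>x. x"] by simp
  have e: "continuous_map euclideanreal ?C ?e" using continuous_map_compose [OF ce f] by (simp add: o_def)
  have "homology_basis (Suc 0) ?C ({} <+> {()})
      (case_sum (\<lambda>i::unit. chain_map (Suc 0) (Pair 1) 0)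
        (\<lambda>_. segment ?e (- (1/4)) (1/4) - segment ?e (- (1/4)) (- (3/4))))"
    by (rule circle_times_homology_basis [OF Q0 Qp])
      (use arc_chains [of "1::complex" "{1}"] arc_boundaries [of "\<lambda>_::real. 1::complex" 0] in \<open>simp_all only: insertI1\<close>)
  then have "homology_basis (Suc 0) ?C {()} (\<lambda>_. segment ?e (- (1/4)) (1/4) - segment ?e (- (1/4)) (- (3/4)))"
    by (rule homology_basis_reindex [where f = Inr]) (auto simp: bij_betw_def)
  then have "homology_basis (Suc 0) ?C {()} (\<lambda>_. segment ?e 0 1)"
    by (rule homology_basis_change) (rule two_arcs_homologous_loop [OF e], simp)
  then show "homology_basis (Suc 0) circle {()} (\<lambda>_. segment circle_exp 0 1)"
    by (rule homology_basis_homotopy_equivalence [OF f g gf fg])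
      (use loop_cycle [OF ce, of 1] in \<open>simp_all add: o_def\<close>)
  have "homology_basis (Suc (Suc p)) ?C ({} <+> {})
      (case_sum (\<lambda>i::unit. chain_map (Suc (Suc p)) (Pair 1) 0) (\<lambda>_::unit. 0 - 0))"
    by (rule circle_times_homology_basis [OF Qp Qp]) auto
  then have "homology_basis (Suc (Suc p)) ?C {} (\<lambda>_::'b. 0)"
    by (rule homology_basis_reindex [where f = "\<lambda>_. undefined"]) (auto simp: bij_betw_def)
  then show "homology_basis (Suc (Suc p)) circle {} h"
    by (rule homology_basis_homotopy_equivalence [OF f g gf fg]) auto
  show "homology_basis 0 circle {()} (\<lambda>_. vertex circle_exp 0)"
    by (rule homology_basis_0_vertex) (auto intro!: path_connected_sphere)
qed

section \<open>The torus\<close>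

abbreviation torus_space :: "(complex \<times> complex) topology"
  where "torus_space \<equiv> top_of_set torus"

definition torus_loop :: "int \<times> int \<Rightarrow> (complex \<times> complex) chain"
  where "torus_loop \<mu> = segment torus_exp 0 (real_of_int (fst \<mu>), real_of_int (snd \<mu>))"

text \<open>The unit square of the universal covering, cut along its diagonal.\<close>

definition torus_cycle :: "(complex \<times> complex) chain"
  where "torus_cycle = triangle torus_exp 0 (1, 0) (1, 1) - triangle torus_exp 0 (0, 1) (1, 1)"

lemma torus_space_prod: "prod_topology circle circle = torus_space"
  by (simp add: torus_def)

lemma continuous_torus_exp: "continuous_map euclidean torus_space torus_exp"
  unfolding torus_exp_circle_exp torus_space_prod [symmetric]
  by (intro continuous_map_pairedI) (auto intro!: continuous_map_circle_exp continuous_intros)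

lemma torus_exp_periodic: "torus_exp (v + (real_of_int k, real_of_int l)) = torus_exp v"
  by (simp add: torus_exp_circle_exp circle_exp_add)

lemma torus_loop_cycle: "cycle (Suc 0) torus_space (torus_loop \<mu>)"
  unfolding torus_loop_def by (rule loop_cycle [OF continuous_torus_exp]) (rule torus_exp_periodic)

lemma homology_basis_torus_0: "homology_basis 0 torus_space {()} (\<lambda>_. vertex torus_exp 0)"
proof (rule homology_basis_0_vertex)
  have "path_connected torus"
    unfolding torus_def by (intro path_connected_Times path_connected_sphere) simp_all
  then show "path_connected_space torus_space" by simp
qed (simp add: torus_exp_circle_exp torus_def)

lemma homology_basis_torus_1:
  "homology_basis (Suc 0) torus_space UNIV (\<lambda>i. torus_loop (if i then (1, 0) else (0, 1)))"
proof -
  let ?e = "\<lambda>x. (circle_exp x, 1::complex)"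
  let ?h = "case_sum (\<lambda>i::unit. chain_map (Suc 0) (Pair 1) (segment circle_exp 0 1))
        (\<lambda>_::unit. segment ?e (- (1/4)) (1/4) - segment ?e (- (1/4)) (- (3/4)))"
  have "homology_basis (Suc 0) (prod_topology circle circle) ({()} <+> {()}) ?h"
    by (rule circle_times_homology_basis [OF homology_basis_circle_0 homology_basis_circle_1])
      (use arc_chains [of "1::complex" "sphere 0 1"] arc_boundaries [of circle_exp 0] in \<open>simp_all\<close>)
  then have "homology_basis (Suc 0) torus_space UNIV (\<lambda>i. ?h (if i then Inr () else Inl ()))"
    unfolding torus_space_prod
    by (rule homology_basis_reindex [where f = "\<lambda>i. if i then Inr () else Inl ()"])
      (auto simp: bij_betw_def inj_on_def image_iff split: if_splits)
  then show ?thesis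
  proof (rule homology_basis_change)
    fix i :: bool
    have e: "continuous_map euclideanreal torus_space ?e"
      unfolding torus_space_prod [symmetric] by (intro continuous_map_pairedI) (auto intro!: continuous_map_circle_exp continuous_intros)
    have 1: "?e = torus_exp \<circ> (\<lambda>x. (x, 0))" "Pair 1 \<circ> circle_exp = torus_exp \<circ> (\<lambda>x. (0, x))"
      by (auto simp: torus_exp_circle_exp)
    have 2: "linear (\<lambda>x::real. (x, 0::real))" "linear (\<lambda>x::real. (0::real, x))"
      by (auto intro!: linearI)
    have 3: "torus_loop (1, 0) = segment ?e 0 1" "torus_loop (0, 1) = chain_map (Suc 0) (Pair 1) (segment circle_exp 0 1)"
      unfolding chain_map_affine 1 segment_linear [OF 2(1)] segment_linear [OF 2(2)]
      by (simp_all add: torus_loop_def zero_prod_def)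
    show "bounds (Suc 0) torus_space (torus_loop (if i then (1, 0) else (0, 1)) - ?h (if i then Inr () else Inl ()))"
      using two_arcs_homologous_loop [OF e] by (simp add: 3)
  qed
qed

lemma cap_filling:
  assumes "cycle p Q c" "u \<in> {1, - 1}"
  obtains a where "singular_chain (Suc p) (arc_times (cap u) Q) a"
    "chain_boundary (Suc p) a = chain_map p (Pair \<i>) c - chain_map p (Pair (- \<i>)) c"
proof -
  have "bounds p (arc_times (cap u) Q) (chain_map p (Pair \<i>) c - chain_map p (Pair (- \<i>)) c)"
    by (rule slices_homologous [OF cap_contracts [of u]]) (use assms caps in auto)
  then show thesis using that by (auto simp: bounds_iff)
qed

text \<open>The product formula yields a generator made from chains of which only the boundaries are known.\<close>

lemma homology_basis_torus_2_ex: "\<exists>\<tau>. homology_basis (Suc (Suc 0)) torus_space {()} (\<lambda>_. \<tau>)"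
proof -
  let ?l = "segment circle_exp 0 1"
  have l: "cycle (Suc 0) circle ?l" using homology_basisD(2) [OF homology_basis_circle_1] by simp
  obtain a where a: "singular_chain (Suc (Suc 0)) (arc_times (cap 1) circle) a"
    "chain_boundary (Suc (Suc 0)) a = chain_map (Suc 0) (Pair \<i>) ?l - chain_map (Suc 0) (Pair (- \<i>)) ?l"
    by (rule cap_filling [OF l, of 1]) auto
  obtain b where b: "singular_chain (Suc (Suc 0)) (arc_times (cap (- 1)) circle) b"
    "chain_boundary (Suc (Suc 0)) b = chain_map (Suc 0) (Pair \<i>) ?l - chain_map (Suc 0) (Pair (- \<i>)) ?l"
    by (rule cap_filling [OF l, of "- 1"]) auto
  have "homology_basis (Suc (Suc 0)) (prod_topology circle circle) ({} <+> {()})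
      (case_sum (\<lambda>i::unit. chain_map (Suc (Suc 0)) (Pair 1) 0) (\<lambda>_. a - b))"
    by (rule circle_times_homology_basis [OF homology_basis_circle_1 homology_basis_circle_2])
      (simp_all only: a b)
  then have "homology_basis (Suc (Suc 0)) torus_space {()} (\<lambda>_. a - b)"
    unfolding torus_space_prod
    by (rule homology_basis_reindex [where f = Inr]) (auto simp: bij_betw_def)
  then show ?thesis by blast
qed

lemma homology_basis_torus_3: "homology_basis (Suc (Suc (Suc p))) torus_space {} h"
proof -
  have "homology_basis (Suc (Suc (Suc p))) (prod_topology circle circle) ({} <+> {})
      (case_sum (\<lambda>i::unit. chain_map (Suc (Suc (Suc p))) (Pair 1) 0) (\<lambda>_::unit. 0 - 0))"
    by (rule circle_times_homology_basis [OF homology_basis_circle_2 homology_basis_circle_2]) auto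
  then have "homology_basis (Suc (Suc (Suc p))) torus_space {} (\<lambda>_::unit. 0)"
    unfolding torus_space_prod
    by (rule homology_basis_reindex [where f = "\<lambda>_. undefined"]) (auto simp: bij_betw_def)
  then show ?thesis
    by (auto simp: homology_basis_def)
qed

text \<open>On \<open>k\<close> times a generator, every cocycle takes a value divisible by \<open>k\<close>. So a value \<open>\<plusminus>1\<close> leaves
  only \<open>k = \<plusminus>1\<close>.\<close>

lemma homology_basis_generator:
  assumes h: "homology_basis p X {()} (\<lambda>_. \<tau>)" and t: "cycle p X t"
    and \<omega>: "cocycle p X \<omega>" and 1: "\<bar>cochain_eval \<omega> t\<bar> = 1"
  shows "homology_basis p X {()} (\<lambda>_. t)"
proof -
  obtain c where "bounds p X (t - comb {()} c (\<lambda>_. \<tau>))" using homology_basis_span [OF h t] .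
  then have t\<tau>: "bounds p X (t - frag_cmul (c ()) \<tau>)" by simp
  then have "\<bar>c () * cochain_eval \<omega> \<tau>\<bar> = 1"
    using cocycle_homologous [OF \<omega>] 1 by (simp add: cochain_eval_cmul)
  then have c: "c () * c () = 1"
    by (metis abs_mult_self_eq abs_zmult_eq_1 mult_1)
  have m: "bounds p X (frag_cmul k t - frag_cmul (k * c ()) \<tau>)" for k
    using singular_relboundary_cmul [OF t\<tau>, of k] by (simp add: frag_cmul_distrib2 algebra_simps
        diff_conv_add_uminus del: add_uminus_conv_diff)
  have "\<exists>d::unit \<Rightarrow> int. bounds p X (z - frag_cmul (d ()) t)" if z: "cycle p X z" for z
  proof -
    obtain d where "bounds p X (z - comb {()} d (\<lambda>_. \<tau>))" using homology_basis_span [OF h z] .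
    then have "bounds p X (z - frag_cmul (d () * c () * c ()) \<tau>)" by (simp add: c mult.assoc)
    from bounds_trans [OF this bounds_commute [OF m]] show ?thesis
      by (intro exI [where x = "\<lambda>_. d () * c ()"])
  qed
  moreover have "d () = 0" if "bounds p X (frag_cmul (d ()) t)" for d :: "unit \<Rightarrow> int"
  proof -
    have "bounds p X (comb {()} (\<lambda>_. d () * c ()) (\<lambda>_. \<tau>))"
      using singular_relboundary_diff [OF that m [of "d ()"]] by simp
    then have "d () * c () = 0" using homology_basisD(3) [OF h, of "\<lambda>_. d () * c ()" "()"] by simp
    then show ?thesis using c by auto
  qed
  ultimately show ?thesis using t by (simp add: homology_basis_def)
qed

lemma torus_cycle_cycle: "cycle (Suc (Suc 0)) torus_space torus_cycle"
proof -
  have "segment torus_exp (1, 0) (1, 1) = segment torus_exp 0 (0, 1)"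
    "segment torus_exp (0, 1) (1, 1) = segment torus_exp 0 (1, 0)"
    using segment_translate [of torus_exp "(1, 0)" 0 "(0, 1)"] segment_translate [of torus_exp "(0, 1)" 0 "(1, 0)"]
      torus_exp_periodic [of _ 1 0] torus_exp_periodic [of _ 0 1] by simp_all
  then show ?thesis
    using singular_chain_affine(3) [of UNIV torus_space torus_exp] continuous_torus_exp
    by (simp add: singular_cycle torus_cycle_def chain_boundary_diff boundary_triangle singular_chain_diff)
qed

text \<open>On a triangle, the value of the product is the value of \<open>\<phi>\<close> on the first side times that of \<open>\<psi>\<close> on
  the second. Opposite sides of the unit square give the same loop.\<close>

lemma cup_torus_cycle:
  "cochain_eval (cup_cochain (Suc 0) (Suc 0) torus_space \<phi> \<psi>) torus_cycle =
    cochain_eval \<phi> (torus_loop (1, 0)) * cochain_eval \<psi> (torus_loop (0, 1)) -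
    cochain_eval \<phi> (torus_loop (0, 1)) * cochain_eval \<psi> (torus_loop (1, 0))"
proof -
  have tri: "cochain_eval (cup_cochain (Suc 0) (Suc 0) torus_space \<phi> \<psi>) (triangle torus_exp x y z) =
      cochain_eval \<phi> (segment torus_exp x y) * cochain_eval \<psi> (segment torus_exp y z)" for x y z
  proof -
    let ?A = "\<lambda>i::nat. if i = 0 then x else if i = 1 then y else z"
    have "front_face (Suc 0) (affine_simplex torus_exp (Suc 0 + Suc 0) ?A)
        = affine_simplex torus_exp 1 (\<lambda>i. if i = 0 then x else y)"
      unfolding front_face_affine One_nat_def by (rule affine_simplex_cong) auto
    moreover have "back_face (Suc 0) (Suc 0) (affine_simplex torus_exp (Suc 0 + Suc 0) ?A)
        = affine_simplex torus_exp 1 (\<lambda>i. if i = 0 then y else z)"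
      unfolding back_face_affine One_nat_def by (rule affine_simplex_cong) auto
    moreover have "singular_simplex (Suc 0 + Suc 0) torus_space (affine_simplex torus_exp (Suc 0 + Suc 0) ?A)"
      by (rule singular_simplex_affine [of UNIV]) (use continuous_torus_exp in auto)
    ultimately show ?thesis
      by (simp add: triangle_def segment_def cup_cochain_def numeral_2_eq_2)
  qed
  have "segment torus_exp (1, 0) (1, 1) = segment torus_exp 0 (0, 1)"
    "segment torus_exp (0, 1) (1, 1) = segment torus_exp 0 (1, 0)"
    using segment_translate [of torus_exp "(1, 0)" 0 "(0, 1)"] segment_translate [of torus_exp "(0, 1)" 0 "(1, 0)"]
      torus_exp_periodic [of _ 1 0] torus_exp_periodic [of _ 0 1] by simp_all
  then show ?thesis
    by (simp add: torus_cycle_def cochain_eval_diff tri torus_loop_def)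
qed

text \<open>That the square generates, and not only some multiple of a generator, is detected by the cup
  product of the two cocycles dual to the coordinate loops.\<close>

lemma homology_basis_torus_2: "homology_basis (Suc (Suc 0)) torus_space {()} (\<lambda>_. torus_cycle)"
proof -
  obtain \<phi> where \<phi>: "cocycle (Suc 0) torus_space \<phi>"
    "\<And>i. cochain_eval \<phi> (torus_loop (if i then (1, 0) else (0, 1))) = (if i then 1 else 0)"
    using cocycle_with_values [OF homology_basis_torus_1, of "\<lambda>i. if i then 1 else 0"] by auto
  obtain \<psi> where \<psi>: "cocycle (Suc 0) torus_space \<psi>"
    "\<And>i. cochain_eval \<psi> (torus_loop (if i then (1, 0) else (0, 1))) = (if i then 0 else 1)"
    using cocycle_with_values [OF homology_basis_torus_1, of "\<lambda>i. if i then 0 else 1"] by auto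
  let ?\<omega> = "cup_cochain (Suc 0) (Suc 0) torus_space \<phi> \<psi>"
  have "cocycle (Suc 0 + Suc 0) torus_space ?\<omega>"
    using cup_cocycle [of \<phi> "Suc 0" torus_space \<psi> "Suc 0"] \<phi>(1) \<psi>(1) by simp
  moreover have "cochain_eval ?\<omega> torus_cycle = 1"
    using \<phi>(2) [of True] \<phi>(2) [of False] \<psi>(2) [of True] \<psi>(2) [of False] by (simp add: cup_torus_cycle)
  moreover obtain \<tau> where "homology_basis (Suc (Suc 0)) torus_space {()} (\<lambda>_. \<tau>)"
    using homology_basis_torus_2_ex by blast
  ultimately show ?thesis
    by (intro homology_basis_generator [OF _ torus_cycle_cycle, of _ ?\<omega>]) simp_all
qed

section \<open>The faces of a labelled polygon\<close>

type_synonym orbifold_point = "((real^2) \<times> (complex \<times> complex)) set"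

locale toric_polygon =
  fixes n :: nat and P :: "(real^2) set" and E :: "nat \<Rightarrow> (real^2) set" and v :: "nat \<Rightarrow> real^2"
    and lam :: "(real^2) set \<Rightarrow> int \<times> int" and a b :: "nat \<Rightarrow> int"
  assumes n: "n \<ge> 1" and polygon: "labelled_polygon P (n + 2) E v"
    and char: "characteristic_function P lam"
    and lam_E: "\<And>i. i \<in> {1..n + 2} \<Longrightarrow> lam (E i) = (a i, b i)"
    and lam_last: "lam (E (n + 1)) = (1, 0)" "lam (E (n + 2)) = (0, 1)"
begin

definition nxt :: "nat \<Rightarrow> nat" where "nxt i = (if i = n + 2 then 1 else i + 1)"

definition prv :: "nat \<Rightarrow> nat" where "prv i = (if i = 1 then n + 2 else i - 1)"

text \<open>The minimal face of a point is encoded by the edges through the point: none, one, or two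
  neighbouring ones (\<open>edges_at_cases\<close>).\<close>

definition edges_at :: "real^2 \<Rightarrow> nat set" where "edges_at x = {i \<in> {1..n + 2}. x \<in> E i}"

lemma nxt_in: "i \<in> {1..n + 2} \<Longrightarrow> nxt i \<in> {1..n + 2}" and prv_in: "i \<in> {1..n + 2} \<Longrightarrow> prv i \<in> {1..n + 2}"
  by (auto simp: nxt_def prv_def)

lemma convex_P: "convex P" and polytope_P: "polytope P" and compact_P: "compact P"
  using polygon by (auto simp: labelled_polygon_def polytope_imp_convex polytope_imp_compact)

lemma E_bij: "bij_betw E {1..n + 2} {F. F edge_of P}" and v_bij: "bij_betw v {1..n + 2} {x. x extreme_point_of P}"
  using polygon by (simp_all only: labelled_polygon_def)

lemma edge: "i \<in> {1..n + 2} \<Longrightarrow> E i edge_of P"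
  using bij_betw_apply [OF E_bij] by blast

lemma edge_face: "i \<in> {1..n + 2} \<Longrightarrow> E i face_of P"
  using edge by (simp add: edge_of_def)

lemma edge_ex: "F edge_of P \<Longrightarrow> \<exists>i\<in>{1..n + 2}. F = E i"
  using bij_betw_imp_surj_on [OF E_bij] by blast

lemma edge_sub: "i \<in> {1..n + 2} \<Longrightarrow> E i \<subseteq> P"
  using edge_face face_of_imp_subset by blast

lemma v_inj: "i \<in> {1..n + 2} \<Longrightarrow> j \<in> {1..n + 2} \<Longrightarrow> v i = v j \<longleftrightarrow> i = j"
  using bij_betw_imp_inj_on [OF v_bij] by (simp only: inj_on_eq_iff)

lemma E_segment: "i \<in> {1..n + 2} \<Longrightarrow> E i = closed_segment (v i) (v (nxt i))"
  using polygon by (auto simp: labelled_polygon_def nxt_def)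

lemma v_extreme: "i \<in> {1..n + 2} \<Longrightarrow> v i extreme_point_of P"
  using bij_betw_apply [OF v_bij] by blast

lemma v_in: "i \<in> {1..n + 2} \<Longrightarrow> v i \<in> P"
  using v_extreme by (simp add: extreme_point_of_def)

lemma nxt_neq: "i \<in> {1..n + 2} \<Longrightarrow> nxt i \<noteq> i"
  by (auto simp: nxt_def)

lemma v_nxt_neq: "i \<in> {1..n + 2} \<Longrightarrow> v i \<noteq> v (nxt i)"
  using v_inj [OF _ nxt_in] nxt_neq by metis

lemma nxt_inj: "i \<in> {1..n + 2} \<Longrightarrow> k \<in> {1..n + 2} \<Longrightarrow> nxt i = nxt k \<Longrightarrow> i = k"
  unfolding nxt_def by (cases "i = n + 2"; cases "k = n + 2"; simp)

lemma nxt_nxt_neq: "k \<in> {1..n + 2} \<Longrightarrow> nxt (nxt k) \<noteq> k"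
  using n by (simp add: nxt_def)

lemma v_in_E:
  assumes i: "i \<in> {1..n + 2}" and j: "j \<in> {1..n + 2}"
  shows "v j \<in> E i \<longleftrightarrow> j = i \<or> j = nxt i"
proof
  assume "v j \<in> E i"
  moreover have "v j \<notin> open_segment (v i) (v (nxt i))"
    using v_extreme [OF j] v_in [OF i] v_in [OF nxt_in [OF i]] by (simp add: extreme_point_of_def)
  ultimately have "v j = v i \<or> v j = v (nxt i)"
    by (auto simp: E_segment [OF i] open_segment_def)
  then show "j = i \<or> j = nxt i" using v_inj [OF j] i nxt_in [OF i] by blast
qed (auto simp: E_segment [OF i])

lemma edges_at_vertex: "j \<in> {1..n + 2} \<Longrightarrow> edges_at (v j) = {prv j, j}"
proof -
  assume j: "j \<in> {1..n + 2}"
  have "edges_at (v j) = {i \<in> {1..n + 2}. j = i \<or> j = nxt i}"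
    using j by (auto simp: edges_at_def v_in_E)
  also have "\<dots> = {prv j, j}"
    using n j by (auto simp: nxt_def prv_def split: if_splits)
  finally show ?thesis .
qed

text \<open>A face that contains an inner point of a segment in \<open>P\<close> contains the end points as well.\<close>

lemma edges_at_open_segment:
  assumes i: "i \<in> {1..n + 2}" and x: "x \<in> open_segment (v i) (v (nxt i))"
  shows "edges_at x = {i}"
proof -
  have "k = i" if k: "k \<in> {1..n + 2}" and xk: "x \<in> E k" for k
  proof -
    have "v i \<in> E k \<and> v (nxt i) \<in> E k"
      using edge_face [OF k] xk x v_in [OF i] v_in [OF nxt_in [OF i]] unfolding face_of_def by blast
    then have "i = k \<or> i = nxt k" "nxt i = k \<or> nxt i = nxt k"
      unfolding v_in_E [OF k i] v_in_E [OF k nxt_in [OF i]] by blast+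
    then show ?thesis using nxt_inj [OF i k] nxt_nxt_neq [OF k] by auto
  qed
  moreover have "x \<in> E i" using x by (auto simp: E_segment [OF i] open_segment_def)
  ultimately show ?thesis using i unfolding edges_at_def by blast
qed

lemma edges_at_cases:
  obtains "edges_at x = {}" | i where "i \<in> {1..n + 2}" "x \<in> open_segment (v i) (v (nxt i))" "edges_at x = {i}"
  | j where "j \<in> {1..n + 2}" "x = v j" "edges_at x = {prv j, j}"
proof (cases "edges_at x = {}")
  case False
  then obtain i where i: "i \<in> {1..n + 2}" "x \<in> E i" by (auto simp: edges_at_def)
  then consider "x = v i" | "x = v (nxt i)" | "x \<in> open_segment (v i) (v (nxt i))"
    by (auto simp: E_segment open_segment_def)
  then show thesis
    using that(2,3) i edges_at_vertex nxt_in edges_at_open_segment by metis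
qed

lemma prv_neq: "j \<in> {1..n + 2} \<Longrightarrow> prv j \<noteq> j"
  by (auto simp: prv_def)

lemma vertex_face_not_edge: "j \<in> {1..n + 2} \<Longrightarrow> \<not> {v j} edge_of P" "{v j} \<noteq> P"
proof -
  show "\<not> {v j} edge_of P" by (simp add: edge_of_def)
  have "aff_dim P = 2" using polygon by (simp add: labelled_polygon_def)
  then show "{v j} \<noteq> P" by auto
qed

lemma edge_neq_P: "i \<in> {1..n + 2} \<Longrightarrow> E i \<noteq> P"
  using edge [of i] polygon by (auto simp: edge_of_def labelled_polygon_def)

lemma minimal_faceI: "F face_of P \<Longrightarrow> x \<in> rel_interior F \<Longrightarrow> minimal_face P x = F"
  unfolding minimal_face_def by (rule the_equality) (blast dest: face_of_eq)+

text \<open>The frontier of \<open>P\<close> is the union of its facets, which are the edges.\<close>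

lemma minimal_face_inner:
  assumes "x \<in> P" "edges_at x = {}"
  shows "minimal_face P x = P"
proof (rule minimal_faceI)
  show "P face_of P" by (simp add: face_of_refl convex_P)
  have "x \<notin> rel_frontier P"
  proof
    assume "x \<in> rel_frontier P"
    then obtain F where F: "F facet_of P" "x \<in> F"
      using rel_frontier_of_polyhedron [OF polytope_imp_polyhedron [OF polytope_P]] by auto
    then have "F edge_of P"
      using polygon by (simp add: facet_of_def edge_of_def labelled_polygon_def)
    then obtain i where "i \<in> {1..n + 2}" "F = E i" using edge_ex by blast
    then show False using F assms by (auto simp: edges_at_def)
  qed
  then show "x \<in> rel_interior P"
    using assms compact_P compact_imp_closed closure_closed by (auto simp: rel_frontier_def)
qed

lemma minimal_face_edge:
  assumes "i \<in> {1..n + 2}" "x \<in> open_segment (v i) (v (nxt i))"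
  shows "minimal_face P x = E i"
proof (rule minimal_faceI [OF edge_face [OF assms(1)]])
  have "v i \<noteq> v (nxt i)" by (rule v_nxt_neq [OF assms(1)])
  then show "x \<in> rel_interior (E i)"
    using assms by (simp add: E_segment rel_interior_closed_segment)
qed

lemma minimal_face_vertex: "j \<in> {1..n + 2} \<Longrightarrow> minimal_face P (v j) = {v j}"
  by (rule minimal_faceI) (simp_all add: face_of_singleton v_extreme)

section \<open>Stabilisers\<close>

definition stab :: "real^2 \<Rightarrow> (complex \<times> complex) set"
  where "stab x = face_torus P lam (minimal_face P x)"

definition edge_torus :: "nat \<Rightarrow> (complex \<times> complex) set"
  where "edge_torus i = range (\<lambda>t::real. torus_exp (t * real_of_int (a i), t * real_of_int (b i)))"

lemma stab_inner: "x \<in> P \<Longrightarrow> edges_at x = {} \<Longrightarrow> stab x = {(1, 1)}"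
  by (simp add: stab_def minimal_face_inner face_torus_def)

lemma stab_edge:
  assumes "edges_at x = {i}"
  shows "stab x = edge_torus i"
proof (cases x rule: edges_at_cases)
  case (2 k)
  then have "k = i" using assms by auto
  with 2 have "stab x = face_torus P lam (E i)" by (simp only: stab_def minimal_face_edge)
  then show ?thesis
    using 2 \<open>k = i\<close> by (simp add: face_torus_def edge_neq_P edge lam_E edge_torus_def)
next
  case (3 j)
  then have "prv j = j" using assms by (metis insertCI singletonD)
  then show ?thesis using 3 prv_neq [of j] by simp
qed (use assms in simp)

lemma stab_vertex: "j \<in> {1..n + 2} \<Longrightarrow> stab (v j) = torus"
  by (simp add: stab_def minimal_face_vertex face_torus_def vertex_face_not_edge)

lemma stab_mono:
  assumes x: "x \<in> P" and y: "y \<in> P" and sub: "edges_at x \<subseteq> edges_at y"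
  shows "stab x \<subseteq> stab y"
proof (cases y rule: edges_at_cases)
  case 1
  then show ?thesis using sub x y by (simp add: stab_inner)
next
  case (2 i)
  then have "edges_at x = {} \<or> edges_at x = {i}" using sub by auto
  then show ?thesis
  proof
    assume "edges_at x = {}"
    moreover have "(1, 1) \<in> edge_torus i"
      unfolding edge_torus_def by (rule range_eqI [of _ _ 0]) (simp add: torus_exp_def)
    ultimately show ?thesis using x 2 by (simp add: stab_inner stab_edge)
  qed (use 2 in \<open>simp add: stab_edge\<close>)
next
  case (3 j)
  have "stab x \<subseteq> torus" unfolding stab_def by (rule face_torus_group(1))
  then show ?thesis using 3 by (simp add: stab_vertex)
qed

lemma coprime_edge_vector:
  assumes i: "i \<in> {1..n + 2}"
  shows "gcd (a i) (b i) = 1"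
  using char edge [OF i] lam_E [OF i] by (auto simp: characteristic_function_def primitive_def)

lemma a_b_last: "a (n + 1) = 1" "b (n + 1) = 0" "a (n + 2) = 0" "b (n + 2) = 1"
  using lam_last lam_E [of "n + 1"] lam_E [of "n + 2"] by auto

section \<open>Open stars of points\<close>

text \<open>For the set \<open>J\<close> of edges through a vertex, or for a singleton, or for the empty set, this is the
  open star in \<open>P\<close> of the vertex, or of the edge, or the interior of \<open>P\<close>.\<close>

definition region :: "nat set \<Rightarrow> (real^2) set"
  where "region J = {x \<in> P. edges_at x \<subseteq> J}"

definition centre :: "nat set \<Rightarrow> real^2 \<Rightarrow> bool"
  where "centre J e \<longleftrightarrow> e \<in> P \<and> edges_at e = J"

lemma region_Int: "region J \<inter> region K = region (J \<inter> K)"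
  by (auto simp: region_def)

lemma region_mono: "J \<subseteq> K \<Longrightarrow> region J \<subseteq> region K"
  by (auto simp: region_def)

lemma openin_region: "openin (top_of_set P) (region J)"
proof -
  have "region J = P - (\<Union>i\<in>{1..n + 2} - J. E i)"
    by (auto simp: region_def edges_at_def)
  moreover have "closedin (top_of_set P) (\<Union>i\<in>{1..n + 2} - J. E i)"
  proof (rule closedin_Union)
    fix S assume "S \<in> E ` ({1..n + 2} - J)"
    then obtain i where i: "i \<in> {1..n + 2}" "S = E i" by blast
    show "closedin (top_of_set P) S"
      unfolding i(2) by (rule closed_subset [OF edge_sub [OF i(1)]]) (simp only: E_segment [OF i(1)] closed_segment)
  qed auto
  ultimately show ?thesis by (metis openin_diff openin_subtopology_self)
qed

lemma centre_vertex: "j \<in> {1..n + 2} \<Longrightarrow> centre {prv j, j} (v j)"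
  by (simp add: centre_def v_in edges_at_vertex)

lemma centre_edge: "i \<in> {1..n + 2} \<Longrightarrow> \<exists>e. centre {i} e"
proof -
  assume i: "i \<in> {1..n + 2}"
  then have "v i \<noteq> v (nxt i)" by (rule v_nxt_neq)
  then have m: "midpoint (v i) (v (nxt i)) \<in> open_segment (v i) (v (nxt i))" by simp
  then have "midpoint (v i) (v (nxt i)) \<in> P"
    using edge_sub [OF i] E_segment [OF i] segment_open_subset_closed by blast
  then show ?thesis using edges_at_open_segment [OF i m] by (auto simp: centre_def)
qed

lemma centre_inner: "\<exists>e. centre {} e"
proof -
  have "P \<noteq> {}" using v_in [of 1] by auto
  then obtain e where e: "e \<in> rel_interior P"
    using rel_interior_eq_empty [OF convex_P] by blast
  moreover have "e \<notin> E i" if "i \<in> {1..n + 2}" for i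
    using face_of_disjoint_rel_interior [OF edge_face [OF that] edge_neq_P [OF that]] e by blast
  ultimately show ?thesis using rel_interior_subset by (force simp: centre_def edges_at_def)
qed

text \<open>A face through an inner point of the segment from \<open>x\<close> to \<open>e\<close> contains \<open>e\<close>, so the segment stays in
  the open star. That it also stays on the edges through \<open>x\<close> means that the stabilisers can only
  grow along it, and this makes the motion descend to \<open>X\<close>.\<close>

lemma region_star:
  assumes e: "centre J e" and x: "x \<in> region J" and s: "0 \<le> s" "s \<le> 1"
  shows "(1 - s) *\<^sub>R x + s *\<^sub>R e \<in> region J"
    and "edges_at x \<subseteq> edges_at ((1 - s) *\<^sub>R x + s *\<^sub>R e)"
proof -
  let ?y = "(1 - s) *\<^sub>R x + s *\<^sub>R e"
  have xe: "x \<in> P" "edges_at x \<subseteq> edges_at e" "e \<in> P" "edges_at e = J"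
    using e x by (auto simp: centre_def region_def)
  have y: "?y \<in> P" using convex_P xe s by (simp add: convexD_alt)
  have "edges_at ?y \<subseteq> J"
  proof
    fix i assume i: "i \<in> edges_at ?y"
    show "i \<in> J"
    proof (cases "s = 0 \<or> s = 1 \<or> x = e")
      case True
      then show ?thesis using i xe by (auto simp: scaleR_left_distrib [symmetric])
    next
      case False
      then have "?y \<in> open_segment x e" unfolding in_segment using s by (intro conjI exI [of _ s]) auto
      then have "e \<in> E i"
        using i edge_face [of i] xe unfolding face_of_def edges_at_def by blast
      then show ?thesis using i xe by (auto simp: edges_at_def)
    qed
  qed
  then show "?y \<in> region J" using y by (simp add: region_def)
  show "edges_at x \<subseteq> edges_at ?y"
  proof
    fix i assume i: "i \<in> edges_at x"
    then have "x \<in> E i" "e \<in> E i" "convex (E i)"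
      using xe edge_face [of i] by (auto simp: edges_at_def face_of_def)
    then show "i \<in> edges_at ?y" using i s by (auto simp: edges_at_def convexD_alt)
  qed
qed

section \<open>The toric orbifold over an open star\<close>

definition X :: "orbifold_point topology"
  where "X = toric_orbifold P lam"

definition cls :: "(real^2) \<times> (complex \<times> complex) \<Rightarrow> orbifold_point"
  where "cls z = orbifold_rel P lam `` {z}"

definition over :: "(real^2) set \<Rightarrow> orbifold_point set"
  where "over D = cls ` (D \<times> torus)"

lemma quotient_map_cls: "quotient_map (top_of_set (P \<times> torus)) X cls"
  unfolding X_def toric_orbifold_def cls_def by (rule quotient_map_quotient_topology)

lemma topspace_X: "topspace X = over P"
  unfolding X_def toric_orbifold_def over_def by (simp add: cls_def)

lemma cls_eq_iff:
  assumes "z \<in> P \<times> torus" "w \<in> P \<times> torus"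
  shows "cls z = cls w \<longleftrightarrow> fst z = fst w \<and>
    (inverse (fst (snd z)) * fst (snd w), inverse (snd (snd z)) * snd (snd w)) \<in> stab (fst z)"
proof -
  have "cls z = cls w \<longleftrightarrow> (z, w) \<in> orbifold_rel P lam"
    unfolding cls_def by (rule eq_equiv_class_iff [OF equiv_orbifold_rel assms])
  then show ?thesis using assms by (auto simp: orbifold_rel_def stab_def split: prod.splits)
qed

lemma cls_in_over:
  assumes "D \<subseteq> P" "z \<in> P \<times> torus"
  shows "cls z \<in> over D \<longleftrightarrow> fst z \<in> D"
proof
  assume "cls z \<in> over D"
  then obtain w where "w \<in> D \<times> torus" "cls z = cls w" by (auto simp: over_def)
  then show "fst z \<in> D" using cls_eq_iff [of z w] assms by auto
next
  assume "fst z \<in> D"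
  then show "cls z \<in> over D" using assms by (auto simp: over_def)
qed

lemma over_Int: "D \<subseteq> P \<Longrightarrow> D' \<subseteq> P \<Longrightarrow> over (D \<inter> D') = over D \<inter> over D'"
proof
  assume D: "D \<subseteq> P" "D' \<subseteq> P"
  show "over D \<inter> over D' \<subseteq> over (D \<inter> D')"
  proof
    fix c assume c: "c \<in> over D \<inter> over D'"
    then obtain z where z: "z \<in> D \<times> torus" "c = cls z" by (auto simp: over_def)
    then have "fst z \<in> D'" using cls_in_over [OF D(2), of z] c D by auto
    then show "c \<in> over (D \<inter> D')" using z by (auto simp: over_def)
  qed
qed (auto simp: over_def)

lemma preimage_over:
  assumes D: "D \<subseteq> P"
  shows "{z \<in> P \<times> torus. cls z \<in> over D} = D \<times> torus"
proof
  show "D \<times> torus \<subseteq> {z \<in> P \<times> torus. cls z \<in> over D}"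
    using D by (auto simp: over_def)
  show "{z \<in> P \<times> torus. cls z \<in> over D} \<subseteq> D \<times> torus"
    using cls_in_over [OF D] by auto
qed

lemma openin_over:
  assumes "openin (top_of_set P) D"
  shows "openin X (over D)"
proof -
  have D: "D \<subseteq> P" using assms openin_imp_subset by auto
  have "openin (top_of_set (P \<times> torus)) (D \<times> torus)"
    using openin_Times [OF assms openin_subtopology_self [of torus]] by simp
  then have op: "openin (top_of_set (P \<times> torus)) {z \<in> P \<times> torus. cls z \<in> over D}"
    by (simp only: preimage_over [OF D])
  have sub: "over D \<subseteq> topspace X" using D by (auto simp: topspace_X over_def)
  have "openin (top_of_set (P \<times> torus)) {z \<in> P \<times> torus. cls z \<in> U} \<longleftrightarrow> openin X U" if "U \<subseteq> topspace X" for U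
    using quotient_map_cls that by (simp add: quotient_map_def)
  from this [OF sub] op show ?thesis by (rule iffD1)
qed

lemma quotient_map_over:
  assumes "openin (top_of_set P) D"
  shows "quotient_map (top_of_set (D \<times> torus)) (subtopology X (over D)) cls"
proof -
  have D: "D \<subseteq> P" using assms openin_imp_subset by auto
  have "quotient_map (subtopology (top_of_set (P \<times> torus)) (D \<times> torus)) (subtopology X (over D)) cls"
    by (rule quotient_map_restriction [OF quotient_map_cls]) (use preimage_over [OF D] openin_over [OF assms] in auto)
  moreover have "subtopology (top_of_set (P \<times> torus)) (D \<times> torus) = top_of_set (D \<times> torus)"
    using D by (simp add: subtopology_subtopology Int_absorb1 Times_Int_Times)
  ultimately show ?thesis by simp
qed

end

section \<open>Homotopy types over the open stars\<close>

lemma circle_exp_uminus: "circle_exp (- x) = inverse (circle_exp x)"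
  by (simp add: circle_exp_def exp_minus)

lemma circle_exp_power_int: "circle_exp x powi k = circle_exp (real_of_int k * x)"
  by (simp add: circle_exp_cis cis_power_int mult_ac)

lemma circle_exp_surj: "w \<in> sphere 0 1 \<Longrightarrow> \<exists>x. w = circle_exp x"
proof -
  assume "w \<in> sphere 0 1"
  moreover from this have "w \<noteq> 0" by auto
  ultimately have "w = cis (Arg w)" using cis_Arg [of w] by (simp add: sgn_div_norm)
  then have "w = circle_exp (Arg w / (2 * pi))" by (simp add: circle_exp_cis)
  then show ?thesis ..
qed

lemma torus_exp_surj: "t \<in> torus \<Longrightarrow> \<exists>x y. t = torus_exp (x, y)"
  unfolding torus_def torus_exp_circle_exp by (metis circle_exp_surj fst_conv mem_Times_iff prod.collapse snd_conv)

lemma torus_exp_quotient: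
  "(inverse (fst (torus_exp x)) * fst (torus_exp y), inverse (snd (torus_exp x)) * snd (torus_exp y)) = torus_exp (y - x)"
  using circle_exp_add [of "- fst x" "fst y"] circle_exp_add [of "- snd x" "snd y"]
  by (simp add: torus_exp_circle_exp circle_exp_uminus)

lemma chain_map_vertex: "f (e x) = e' y \<Longrightarrow> chain_map 0 f (vertex e x) = vertex e' y"
  unfolding chain_map_affine by (simp add: vertex_eq)

context toric_polygon
begin

abbreviation XR :: "nat set \<Rightarrow> orbifold_point topology"
  where "XR J \<equiv> subtopology X (over (region J))"

definition base :: "real^2" where "base = (SOME e. centre {} e)"

text \<open>The orbit over an interior point. It lies over all the open stars, and all cycles of interest
  over these are images of cycles of the torus.\<close>

definition inc :: "complex \<times> complex \<Rightarrow> orbifold_point"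
  where "inc t = cls (base, t)"

lemma base: "centre {} base"
  unfolding base_def using centre_inner by (rule someI_ex)

lemma base_region: "base \<in> region J"
  using base by (auto simp: centre_def region_def)

lemma region_sub: "region J \<subseteq> P"
  by (auto simp: region_def)

lemma quotient_map_region: "quotient_map (top_of_set (region J \<times> torus)) (XR J) cls"
  by (rule quotient_map_over [OF openin_region])

lemma topspace_XR: "topspace (XR J) = over (region J)"
  using region_sub [of J] by (auto simp: topspace_X over_def)

lemma continuous_map_cls_region: "continuous_map (top_of_set (region J \<times> torus)) (XR J) cls"
  using quotient_map_region by (rule quotient_imp_continuous_map)

lemma continuous_map_slice: "x \<in> region J \<Longrightarrow> continuous_map torus_space (XR J) (\<lambda>t. cls (x, t))"
proof -
  assume "x \<in> region J"
  then have "continuous_map torus_space (top_of_set (region J \<times> torus)) (\<lambda>t. (x, t))"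
    by (auto intro!: continuous_intros)
  from continuous_map_compose [OF this continuous_map_cls_region] show ?thesis by (simp add: o_def)
qed

lemma continuous_map_inc: "continuous_map torus_space (XR J) inc"
  unfolding inc_def by (rule continuous_map_slice [OF base_region])

text \<open>Up to homotopy, the part of \<open>X\<close> over the open star is \<open>Q\<close>, and the inclusion of the torus is \<open>f\<close>.
  The last condition is what determines the classes of the images of cycles of the torus.\<close>

definition region_model :: "nat set \<Rightarrow> 'q topology \<Rightarrow> (complex \<times> complex \<Rightarrow> 'q) \<Rightarrow> bool"
  where "region_model J Q f \<longleftrightarrow> (\<exists>F G. continuous_map (XR J) Q F \<and> continuous_map Q (XR J) G \<and>
    homotopic_with (\<lambda>_. True) (XR J) (XR J) (G \<circ> F) id \<and> homotopic_with (\<lambda>_. True) Q Q (F \<circ> G) id \<and>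
    (\<forall>t\<in>torus. F (inc t) = f t))"

text \<open>The contraction of the open star to \<open>e\<close> lifts to a deformation of the part of \<open>X\<close> over it into the
  orbit over \<open>e\<close>. This orbit is the quotient of the torus by the stabiliser of \<open>e\<close>, which is
  identified with \<open>Q\<close> by \<open>f\<close>, with \<open>g\<close> as a section.\<close>

proposition region_modelI:
  assumes e: "centre J e"
    and cf: "continuous_map torus_space Q f" and cg: "continuous_map Q torus_space g"
    and inv: "\<And>t s. t \<in> torus \<Longrightarrow> s \<in> torus \<Longrightarrow>
      (inverse (fst t) * fst s, inverse (snd t) * snd s) \<in> stab e \<Longrightarrow> f t = f s"
    and fg: "\<And>w. w \<in> topspace Q \<Longrightarrow> f (g w) = w"
    and gf: "\<And>t. t \<in> torus \<Longrightarrow> (inverse (fst t) * fst (g (f t)), inverse (snd t) * snd (g (f t))) \<in> stab e"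
  shows "region_model J Q f"
proof -
  let ?D = "region J" and ?Z = "top_of_set {0..1::real}"
  have eP: "e \<in> P" "edges_at e = J" using e by (auto simp: centre_def)
  have eD: "e \<in> ?D" using eP by (simp add: region_def)
  have stab_e: "stab x \<subseteq> stab e" if "x \<in> ?D" for x
    using that eP by (intro stab_mono) (auto simp: region_def)
  have "continuous_map (top_of_set (?D \<times> torus)) Q (f \<circ> snd)"
    by (rule continuous_map_compose [OF _ cf]) (auto intro!: continuous_intros)
  moreover have "(f \<circ> snd) z = (f \<circ> snd) w"
    if "z \<in> topspace (top_of_set (?D \<times> torus))" "w \<in> topspace (top_of_set (?D \<times> torus))" "cls z = cls w" for z w
  proof -
    have zw: "z \<in> P \<times> torus" "w \<in> P \<times> torus" "fst z \<in> ?D" using that region_sub by auto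
    then show ?thesis
      using cls_eq_iff [OF zw(1,2)] that(3) stab_e [OF zw(3)] inv [of "snd z" "snd w"] by auto
  qed
  ultimately obtain F where F: "continuous_map (XR J) Q F" "F ` topspace (XR J) = (f \<circ> snd) ` topspace (top_of_set (?D \<times> torus))"
    "\<And>z. z \<in> topspace (top_of_set (?D \<times> torus)) \<Longrightarrow> F (cls z) = (f \<circ> snd) z"
    by (rule quotient_map_lift_exists [OF quotient_map_region]) blast+
  have Fcls: "F (cls (x, t)) = f t" if "x \<in> ?D" "t \<in> torus" for x t
    using F(3) [of "(x, t)"] that by simp
  define G where "G w = cls (e, g w)" for w
  have G: "continuous_map Q (XR J) G"
    unfolding G_def using continuous_map_compose [OF cg continuous_map_slice [OF eD]] by (simp add: o_def)
  have gT: "g w \<in> torus" if "w \<in> topspace Q" for w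
    using cg that by (auto simp: continuous_map_def)
  have FG: "homotopic_with (\<lambda>_. True) Q Q (F \<circ> G) id"
    by (rule homotopic_with_equal [OF _ _ continuous_map_compose [OF G F(1)]])
      (auto simp: G_def Fcls eD gT fg)
  let ?h = "\<lambda>(s, z). cls ((1 - s) *\<^sub>R fst z + s *\<^sub>R e, snd z)"
  \<comment> \<open>Since the unit interval is locally compact, its product with a quotient map is a quotient map;
    so the homotopy can be defined before passing to the quotient.\<close>
  have prodQ: "quotient_map (prod_topology ?Z (top_of_set (?D \<times> torus))) (prod_topology ?Z (XR J)) (\<lambda>(s, z). (s, cls z))"
    by (rule quotient_map_prod_right [OF _ _ quotient_map_region])
      (auto intro!: compact_imp_locally_compact_space Hausdorff_space_subtopology simp: compact_space_subtopology)
  have ck: "continuous_map (top_of_set ({0..1} \<times> ?D \<times> torus)) (top_of_set (?D \<times> torus))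
      (\<lambda>(s, z). ((1 - s) *\<^sub>R fst z + s *\<^sub>R e, snd z))"
    using region_star [OF e] by (auto intro!: continuous_intros simp: case_prod_unfold)
  have ch: "continuous_map (prod_topology ?Z (top_of_set (?D \<times> torus))) (XR J) ?h"
    using continuous_map_compose [OF ck continuous_map_cls_region] by (simp add: o_def case_prod_unfold)
  have "?h y = ?h y'" if y: "y \<in> topspace (prod_topology ?Z (top_of_set (?D \<times> torus)))"
    "y' \<in> topspace (prod_topology ?Z (top_of_set (?D \<times> torus)))"
    "(\<lambda>(s, z). (s, cls z)) y = (\<lambda>(s, z). (s, cls z)) y'" for y y'
  proof -
    obtain s x t where [simp]: "y = (s, (x, t))" by (metis prod.collapse)
    obtain s' x' t' where [simp]: "y' = (s', (x', t'))" by (metis prod.collapse)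
    have s: "0 \<le> s" "s \<le> 1" "s' = s" and x: "x \<in> ?D" "x' \<in> ?D" "t \<in> torus" "t' \<in> torus" and eq: "cls (x, t) = cls (x', t')"
      using y by auto
    have xP: "x \<in> P" "x' \<in> P" using x region_sub by auto
    let ?y = "(1 - s) *\<^sub>R x + s *\<^sub>R e"
    have yP: "?y \<in> P" using region_star(1) [OF e x(1) s(1,2)] region_sub by blast
    have "stab x \<subseteq> stab ?y" by (rule stab_mono [OF xP(1) yP region_star(2) [OF e x(1) s(1,2)]])
    then show ?thesis
      using cls_eq_iff [of "(x, t)" "(x', t')"] cls_eq_iff [of "(?y, t)" "(?y, t')"] eq x xP yP s by auto
  qed
  then obtain H where H: "continuous_map (prod_topology ?Z (XR J)) (XR J) H"
    "H ` topspace (prod_topology ?Z (XR J)) = ?h ` topspace (prod_topology ?Z (top_of_set (?D \<times> torus)))"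
    "\<And>y. y \<in> topspace (prod_topology ?Z (top_of_set (?D \<times> torus))) \<Longrightarrow> H ((\<lambda>(s, z). (s, cls z)) y) = ?h y"
    by (rule quotient_map_lift_exists [OF prodQ ch]) blast+
  have Hcls: "H (s, cls (x, t)) = cls ((1 - s) *\<^sub>R x + s *\<^sub>R e, t)" if "0 \<le> s" "s \<le> 1" "x \<in> ?D" "t \<in> torus" for s x t
    using H(3) [of "(s, (x, t))"] that by simp
  have "homotopic_with (\<lambda>_. True) (XR J) (XR J) id (G \<circ> F)"
  proof (subst homotopic_with, simp, intro exI [of _ H] conjI ballI)
    show "continuous_map (prod_topology ?Z (XR J)) (XR J) H" by (rule H)
    fix y assume "y \<in> topspace (XR J)"
    then obtain x t where y: "y = cls (x, t)" "x \<in> ?D" "t \<in> torus" by (auto simp: topspace_XR over_def)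
    show "H (0, y) = id y" using y by (simp add: Hcls)
    have "f t \<in> topspace Q" using cf y by (auto simp: continuous_map_def)
    then show "H (1, y) = (G \<circ> F) y"
      using y gf [OF y(3)] cls_eq_iff [of "(e, t)" "(e, g (f t))"] eP gT [of "f t"]
      by (simp add: Hcls Fcls G_def)
  qed simp
  then have "homotopic_with (\<lambda>_. True) (XR J) (XR J) (G \<circ> F) id" by (simp only: homotopic_with_sym)
  moreover have "F (inc t) = f t" if "t \<in> torus" for t
    unfolding inc_def by (rule Fcls [OF base_region that])
  ultimately show ?thesis
    unfolding region_model_def using F(1) G FG by blast
qed

lemma region_basis:
  assumes m: "region_model J Q f" and h: "homology_basis p Q I h"
    and k: "\<And>i. i \<in> I \<Longrightarrow> cycle p torus_space (k i)"
    and kh: "\<And>i. i \<in> I \<Longrightarrow> bounds p Q (chain_map p f (k i) - h i)"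
  shows "homology_basis p (XR J) I (\<lambda>i. chain_map p inc (k i))"
proof -
  obtain F G where FG: "continuous_map (XR J) Q F" "continuous_map Q (XR J) G"
    "homotopic_with (\<lambda>_. True) (XR J) (XR J) (G \<circ> F) id" "homotopic_with (\<lambda>_. True) Q Q (F \<circ> G) id"
    "\<And>t. t \<in> torus \<Longrightarrow> F (inc t) = f t"
    using m unfolding region_model_def by blast
  show ?thesis
  proof (rule homology_basis_homotopy_equivalence [OF FG(1-4) h])
    fix i assume i: "i \<in> I"
    show "cycle p (XR J) (chain_map p inc (k i))" by (rule cycle_chain_map [OF k [OF i] continuous_map_inc])
    have "chain_map p F (chain_map p inc (k i)) = chain_map p (F \<circ> inc) (k i)"
      by (simp only: chain_map_compose o_apply)
    also have "\<dots> = chain_map p f (k i)"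
      by (rule chain_map_eq [of p torus_space]) (use k [OF i] FG(5) in \<open>auto simp: singular_cycle\<close>)
    finally show "bounds p Q (chain_map p F (chain_map p inc (k i)) - h i)" using kh [OF i] by simp
  qed
qed

lemma region_bounds:
  assumes m: "region_model J Q f" and k: "cycle p torus_space k" and b: "bounds p Q (chain_map p f k)"
  shows "bounds p (XR J) (chain_map p inc k)"
proof -
  obtain F G where FG: "continuous_map (XR J) Q F" "continuous_map Q (XR J) G"
    "homotopic_with (\<lambda>_. True) (XR J) (XR J) (G \<circ> F) id" "\<And>t. t \<in> torus \<Longrightarrow> F (inc t) = f t"
    using m unfolding region_model_def by blast
  have "chain_map p F (chain_map p inc k) = chain_map p (F \<circ> inc) k"
    by (simp only: chain_map_compose o_apply)
  also have "\<dots> = chain_map p f k"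
    by (rule chain_map_eq [of p torus_space]) (use k FG(4) in \<open>auto simp: singular_cycle\<close>)
  finally have "bounds p (XR J) (chain_map p G (chain_map p F (chain_map p inc k)))"
    using bounds_chain_map [OF b FG(2)] by simp
  moreover have "bounds p (XR J) (chain_map p G (chain_map p F (chain_map p inc k)) - chain_map p inc k)"
    by (rule homotopic_id_bounds [OF FG(3) cycle_chain_map [OF k continuous_map_inc]])
  ultimately show ?thesis using singular_relboundary_diff by fastforce
qed

text \<open>The determinant of \<open>\<lambda> (E i)\<close> and \<open>\<mu>\<close>, which is the degree of the loop \<open>\<mu>\<close> in the circle over
  \<open>E i\<close> (\<open>chi_loop\<close>).\<close>

definition edge_pairing :: "nat \<Rightarrow> int \<times> int \<Rightarrow> int" where "edge_pairing i \<mu> = a i * snd \<mu> - b i * fst \<mu>"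

text \<open>The direction of a loop that generates the homology over the edge.\<close>

definition dual :: "nat \<Rightarrow> int \<times> int" where "dual i = (SOME \<mu>. edge_pairing i \<mu> = 1)"

lemma edge_pairing_dual:
  assumes "i \<in> {1..n + 2}"
  shows "edge_pairing i (dual i) = 1"
proof -
  obtain x y where "x * a i + y * b i = gcd (a i) (b i)" by (metis bezout_int)
  then have "edge_pairing i (- y, x) = 1" using coprime_edge_vector [OF assms] by (simp add: edge_pairing_def mult.commute)
  then show ?thesis unfolding dual_def by (rule someI)
qed

text \<open>The character of the torus whose kernel is the one-parameter subgroup of \<open>\<lambda> (E i)\<close>.\<close>

definition chi :: "nat \<Rightarrow> complex \<times> complex \<Rightarrow> complex"
  where "chi i t = snd t powi (a i) * fst t powi (- b i)"

lemma chi_torus_exp: "chi i (torus_exp x) = circle_exp (real_of_int (a i) * snd x - real_of_int (b i) * fst x)"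
  using circle_exp_add [of "real_of_int (a i) * snd x" "- (real_of_int (b i) * fst x)"]
  by (simp add: chi_def torus_exp_circle_exp circle_exp_power_int del: power_int_minus)

text \<open>As \<open>\<lambda> (E i)\<close> is primitive, the kernel of \<open>chi i\<close> is connected and hence is the stabiliser, and the
  one-parameter subgroup of \<open>dual i\<close> is a section of \<open>chi i\<close>.\<close>

lemma region_model_edge:
  assumes i: "i \<in> {1..n + 2}"
  shows "region_model {i} circle (chi i)"
proof -
  obtain e where e: "centre {i} e" using centre_edge [OF i] by blast
  then have stab_e: "stab e = edge_torus i" by (simp add: centre_def stab_edge)
  obtain p q where pq: "dual i = (p, q)" by (metis surj_pair)
  have det: "a i * q - b i * p = 1" using edge_pairing_dual [OF i] by (simp add: edge_pairing_def pq)
  then have detr: "real_of_int (a i) * q - real_of_int (b i) * p = 1" by (metis of_int_1 of_int_diff of_int_mult)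
  let ?g = "\<lambda>w::complex. (w powi p, w powi q)"
  have g: "?g (circle_exp x) = torus_exp (real_of_int p * x, real_of_int q * x)" for x
    by (simp add: torus_exp_circle_exp circle_exp_power_int)
  show ?thesis
  proof (rule region_modelI [OF e, of _ _ ?g])
    have "chi i \<in> torus \<rightarrow> sphere 0 1"
      by (auto simp: chi_def torus_def norm_mult norm_power_int)
    moreover have "continuous_on torus (chi i)"
      unfolding chi_def by (intro continuous_intros) (auto simp: torus_def)
    ultimately show "continuous_map torus_space circle (chi i)" by simp
    have "?g \<in> sphere 0 1 \<rightarrow> torus" by (auto simp: torus_def norm_power_int)
    moreover have "continuous_on (sphere 0 1) ?g" by (intro continuous_intros) auto
    ultimately show "continuous_map circle torus_space ?g" by simp
  next
    fix t s assume t: "t \<in> torus" and s: "s \<in> torus"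
      and st: "(inverse (fst t) * fst s, inverse (snd t) * snd s) \<in> stab e"
    obtain u u' where u: "t = torus_exp (u, u')" using torus_exp_surj [OF t] by blast
    obtain r :: real where r: "(inverse (fst t) * fst s, inverse (snd t) * snd s) = torus_exp (r * a i, r * b i)"
      using st by (auto simp: stab_e edge_torus_def)
    have nz: "fst t \<noteq> 0" "snd t \<noteq> 0" using t by (auto simp: torus_def)
    have "s = (fst t * (inverse (fst t) * fst s), snd t * (inverse (snd t) * snd s))"
      using nz by (simp add: mult.assoc [symmetric])
    also have "\<dots> = torus_exp (u + r * a i, u' + r * b i)"
      using r by (simp add: u torus_exp_circle_exp circle_exp_add)
    finally show "chi i t = chi i s" by (simp add: u chi_torus_exp algebra_simps)
  next
    fix w assume "w \<in> topspace circle"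
    then obtain x where w: "w = circle_exp x" using circle_exp_surj by auto
    have "real_of_int (a i) * (q * x) - real_of_int (b i) * (p * x) = (real_of_int (a i) * q - real_of_int (b i) * p) * x" by (simp add: algebra_simps)
    then show "chi i (?g w) = w" unfolding w g by (simp add: chi_torus_exp detr)
  next
    fix t assume t: "t \<in> torus"
    obtain u u' where u: "t = torus_exp (u, u')" using torus_exp_surj [OF t] by blast
    define d where "d = a i * u' - b i * u"
    \<comment> \<open>The vector \<open>(p d - u, q d - u')\<close> is a multiple of \<open>(a i, b i)\<close>, by a factor that is found by
      taking the determinant with \<open>(p, q)\<close>.\<close>
    define r where "r = q * (p * d - u) - p * (q * d - u')"
    have "?g (chi i t) = torus_exp (p * d, q * d)"
      by (simp add: u chi_torus_exp g d_def del: Pair_inject)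
    moreover have "p * d - u = r * a i" "q * d - u' = r * b i"
    proof -
      have perp: "a i * (q * d - u') = b i * (p * d - u)"
      proof -
        have "a i * (q * d - u') - b i * (p * d - u) = (real_of_int (a i) * q - real_of_int (b i) * p) * d - d"
          by (simp add: d_def algebra_simps)
        then show ?thesis by (simp add: detr)
      qed
      have "r * a i = q * a i * (p * d - u) - p * (a i * (q * d - u'))" by (simp add: r_def algebra_simps)
      also have "\<dots> = (real_of_int (a i) * q - real_of_int (b i) * p) * (p * d - u)"
        unfolding perp by (simp add: algebra_simps)
      finally show "p * d - u = r * a i" by (simp add: detr)
      have "r * b i = q * (b i * (p * d - u)) - p * b i * (q * d - u')" by (simp add: r_def algebra_simps)
      also have "\<dots> = (real_of_int (a i) * q - real_of_int (b i) * p) * (q * d - u')"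
        unfolding perp [symmetric] by (simp add: algebra_simps)
      finally show "q * d - u' = r * b i" by (simp add: detr)
    qed
    ultimately have "(inverse (fst t) * fst (?g (chi i t)), inverse (snd t) * snd (?g (chi i t))) = torus_exp (r * a i, r * b i)"
      unfolding u torus_exp_quotient [symmetric] by (simp only: torus_exp_quotient) simp
    then show "(inverse (fst t) * fst (?g (chi i t)), inverse (snd t) * snd (?g (chi i t))) \<in> stab e"
      unfolding stab_e edge_torus_def by (rule range_eqI)
  qed
qed

lemma region_model_vertex:
  assumes j: "j \<in> {1..n + 2}"
  shows "region_model {prv j, j} (top_of_set {1::complex}) (\<lambda>_. 1)"
proof (rule region_modelI [OF centre_vertex [OF j], of _ _ "\<lambda>_. (1, 1)"])
  fix t :: "complex \<times> complex" assume "t \<in> torus"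
  then show "(inverse (fst t) * fst ((1::complex), (1::complex)), inverse (snd t) * snd ((1::complex), (1::complex))) \<in> stab (v j)"
    by (auto simp: stab_vertex [OF j] torus_def norm_inverse)
qed (auto simp: torus_def)

lemma region_model_inner: "region_model {} torus_space (\<lambda>t. t)"
proof (rule region_modelI [OF base, of _ _ "\<lambda>t. t"])
  have s: "stab base = {(1, 1)}" using base by (simp add: centre_def stab_inner)
  show "t = s" if "t \<in> torus" "s \<in> torus" "(inverse (fst t) * fst s, inverse (snd t) * snd s) \<in> stab base" for t s
    using that by (auto simp: \<open>stab base = {(1, 1)}\<close> torus_def prod_eq_iff field_simps)
  show "(inverse (fst t) * fst t, inverse (snd t) * snd t) \<in> stab base" if "t \<in> torus" for t
    using that by (auto simp: s torus_def intro!: left_inverse)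
qed auto

subsection \<open>Homology of the open stars\<close>

definition pt :: "orbifold_point chain" where "pt = chain_map 0 inc (vertex torus_exp 0)"

definition loop :: "int \<times> int \<Rightarrow> orbifold_point chain"
  where "loop \<mu> = chain_map (Suc 0) inc (torus_loop \<mu>)"

definition tor :: "orbifold_point chain" where "tor = chain_map (Suc (Suc 0)) inc torus_cycle"

lemma loop_cycle: "cycle (Suc 0) (XR J) (loop \<mu>)"
  unfolding loop_def by (rule cycle_chain_map [OF torus_loop_cycle continuous_map_inc])

lemma tor_cycle: "cycle (Suc (Suc 0)) (XR J) tor"
  unfolding tor_def by (rule cycle_chain_map [OF torus_cycle_cycle continuous_map_inc])

lemma vertex_cycle: "cycle 0 torus_space (vertex torus_exp 0)"
  using homology_basisD(2) [OF homology_basis_torus_0] by simp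

lemma vertex_star_homology:
  assumes j: "j \<in> {1..n + 2}"
  shows "homology_basis 0 (XR {prv j, j}) {()} (\<lambda>_. pt)" and "homology_basis (Suc p) (XR {prv j, j}) {} h"
proof -
  note m = region_model_vertex [OF j]
  have c: "contractible_space (top_of_set {1::complex})" by simp
  have 0: "homology_basis 0 (top_of_set {1::complex}) {()} (\<lambda>_. vertex (\<lambda>_::real \<times> real. 1) 0)"
    by (rule homology_basis_0_vertex) (auto intro: contractible_imp_path_connected_space)
  show "homology_basis 0 (XR {prv j, j}) {()} (\<lambda>_. pt)"
    unfolding pt_def by (rule region_basis [OF m 0 vertex_cycle]) (subst chain_map_vertex [where e' = "\<lambda>_::real \<times> real. 1" and y = 0]; simp)
  have "homology_basis (Suc p) (XR {prv j, j}) {} (\<lambda>i. chain_map (Suc p) inc 0)"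
    by (rule region_basis [OF m homology_basis_contractible [OF c]]) auto
  then show "homology_basis (Suc p) (XR {prv j, j}) {} h" by (rule homology_basis_empty_any)
qed

lemma chi_loop: "chain_map (Suc 0) (chi i) (torus_loop \<mu>) = segment circle_exp 0 (real_of_int (edge_pairing i \<mu>))"
proof -
  let ?L = "\<lambda>x::real \<times> real. real_of_int (a i) * snd x - real_of_int (b i) * fst x"
  have L: "linear ?L" by (rule linearI) (auto simp: algebra_simps)
  have "chi i \<circ> torus_exp = circle_exp \<circ> ?L" by (rule ext) (simp add: chi_torus_exp)
  then show ?thesis
    by (simp add: torus_loop_def segment_linear [OF L] edge_pairing_def)
qed

lemma edge_star_homology:
  assumes i: "i \<in> {1..n + 2}"
  shows edge_star_0: "homology_basis 0 (XR {i}) {()} (\<lambda>_. pt)"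
    and edge_star_1: "homology_basis (Suc 0) (XR {i}) {()} (\<lambda>_. loop (dual i))"
    and edge_star_2: "homology_basis (Suc (Suc p)) (XR {i}) {} h"
    and edge_star_loop: "bounds (Suc 0) (XR {i}) (loop \<mu> - frag_cmul (edge_pairing i \<mu>) (loop (dual i)))"
proof -
  note m = region_model_edge [OF i]
  show "homology_basis 0 (XR {i}) {()} (\<lambda>_. pt)"
    unfolding pt_def by (rule region_basis [OF m homology_basis_circle_0 vertex_cycle])
      (subst chain_map_vertex [where e' = circle_exp and y = 0]; simp add: chi_torus_exp)
  show "homology_basis (Suc 0) (XR {i}) {()} (\<lambda>_. loop (dual i))"
    unfolding loop_def by (rule region_basis [OF m homology_basis_circle_1 torus_loop_cycle])
      (simp add: chi_loop edge_pairing_dual [OF i])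
  have "homology_basis (Suc (Suc p)) (XR {i}) {} (\<lambda>i. chain_map (Suc (Suc p)) inc 0)"
    by (rule region_basis [OF m homology_basis_circle_2]) auto
  then show "homology_basis (Suc (Suc p)) (XR {i}) {} h" by (rule homology_basis_empty_any)
  have c: "cycle (Suc 0) torus_space (torus_loop \<mu> - frag_cmul (edge_pairing i \<mu>) (torus_loop (dual i)))"
    by (intro singular_relcycle_diff singular_relcycle_cmul torus_loop_cycle)
  have ce: "continuous_map euclideanreal circle circle_exp"
    using continuous_map_circle_exp [of "\<lambda>x. x"] by simp
  have "bounds (Suc 0) circle (segment circle_exp 0 (real_of_int (edge_pairing i \<mu>) *\<^sub>R 1) - frag_cmul (edge_pairing i \<mu>) (segment circle_exp 0 1))"
    by (rule loop_int_mult [OF ce]) simp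
  then have "bounds (Suc 0) circle (chain_map (Suc 0) (chi i) (torus_loop \<mu> - frag_cmul (edge_pairing i \<mu>) (torus_loop (dual i))))"
    by (simp add: chain_map_diff chi_loop edge_pairing_dual [OF i])
  from region_bounds [OF m c this]
  show "bounds (Suc 0) (XR {i}) (loop \<mu> - frag_cmul (edge_pairing i \<mu>) (loop (dual i)))"
    by (simp add: loop_def chain_map_diff)
qed

lemma inner_homology:
  shows inner_0: "homology_basis 0 (XR {}) {()} (\<lambda>_. pt)"
    and inner_1: "homology_basis (Suc 0) (XR {}) UNIV (\<lambda>i. loop (if i then (1, 0) else (0, 1)))"
    and inner_2: "homology_basis (Suc (Suc 0)) (XR {}) {()} (\<lambda>_. tor)"
    and inner_3: "homology_basis (Suc (Suc (Suc p))) (XR {}) {} h"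
proof -
  note m = region_model_inner
  have id: "chain_map p (\<lambda>t. t) c = c" if "cycle p torus_space c" for p c
    using that chain_map_id_gen [of p torus_space c "\<lambda>t. t"] by (simp add: singular_cycle)
  show "homology_basis 0 (XR {}) {()} (\<lambda>_. pt)"
    unfolding pt_def by (rule region_basis [OF m homology_basis_torus_0 vertex_cycle]) (simp add: o_def)
  show "homology_basis (Suc 0) (XR {}) UNIV (\<lambda>i. loop (if i then (1, 0) else (0, 1)))"
    unfolding loop_def by (rule region_basis [OF m homology_basis_torus_1 torus_loop_cycle]) (simp add: id torus_loop_cycle)
  show "homology_basis (Suc (Suc 0)) (XR {}) {()} (\<lambda>_. tor)"
    unfolding tor_def by (rule region_basis [OF m homology_basis_torus_2 torus_cycle_cycle]) (simp add: id torus_cycle_cycle)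
  have "homology_basis (Suc (Suc (Suc p))) (XR {}) {} (\<lambda>i. chain_map (Suc (Suc (Suc p))) inc 0)"
    by (rule region_basis [OF m homology_basis_torus_3]) auto
  then show "homology_basis (Suc (Suc (Suc p))) (XR {}) {} h" by (rule homology_basis_empty_any)
qed

end

section \<open>Consequences of the Mayer-Vietoris sequence\<close>

lemma mayer_vietoris_trivial:
  assumes U: "openin X U" and V: "openin X V"
    and zU: "\<And>z. cycle (Suc p) (subtopology X U) z \<Longrightarrow> bounds (Suc p) (subtopology X (U \<union> V)) z"
    and zV: "\<And>z. cycle (Suc p) (subtopology X V) z \<Longrightarrow> bounds (Suc p) (subtopology X (U \<union> V)) z"
    and M: "\<And>m. \<lbrakk>cycle p (subtopology X (U \<inter> V)) m; bounds p (subtopology X U) m; bounds p (subtopology X V) m\<rbrakk>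
        \<Longrightarrow> bounds p (subtopology X (U \<inter> V)) m"
  shows "homology_basis (Suc p) (subtopology X (U \<union> V)) {} h"
proof -
  have "homology_basis (Suc p) (subtopology X (U \<union> V)) ({} <+> {}) (case_sum (\<lambda>_::unit. 0) (\<lambda>_::unit. 0 - 0))"
    by (rule mayer_vietoris_basis [OF U V]) (use zU zV M in auto)
  then show ?thesis by (simp add: homology_basis_def)
qed

lemma mayer_vietoris_new_class:
  assumes U: "openin X U" and V: "openin X V"
    and zU: "\<And>z. cycle (Suc p) (subtopology X U) z \<Longrightarrow> bounds (Suc p) (subtopology X (U \<union> V)) z"
    and zV: "\<And>z. cycle (Suc p) (subtopology X V) z \<Longrightarrow> bounds (Suc p) (subtopology X (U \<union> V)) z"
    and M: "homology_basis p (subtopology X (U \<inter> V)) {()} (\<lambda>_. m)"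
    and a: "singular_chain (Suc p) (subtopology X U) a" "chain_boundary (Suc p) a = m"
    and b: "singular_chain (Suc p) (subtopology X V) b" "chain_boundary (Suc p) b = m"
  shows "homology_basis (Suc p) (subtopology X (U \<union> V)) {()} (\<lambda>_. a - b)"
proof -
  have "homology_basis (Suc p) (subtopology X (U \<union> V)) ({} <+> {()}) (case_sum (\<lambda>_::unit. 0) (\<lambda>_::unit. a - b))"
  proof (rule mayer_vietoris_basis [OF U V])
    show "\<exists>d. bounds p (subtopology X (U \<inter> V)) (z - comb {()} d (\<lambda>k. chain_boundary (Suc p) a))"
      if "cycle p (subtopology X (U \<inter> V)) z" for z
      using homology_basis_span [OF M that] unfolding a(2) by metis
    show "d k = 0" if "bounds p (subtopology X (U \<inter> V)) (comb {()} d (\<lambda>k. chain_boundary (Suc p) a))" "k \<in> {()}" for d k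
      using homology_basisD(3) [OF M that [unfolded a(2)]] .
  qed (use a b zU zV in auto)
  then show ?thesis
    by (rule homology_basis_reindex [where f = Inr]) (auto simp: bij_betw_def)
qed

text \<open>A common basis makes the inclusion an isomorphism in homology, and in particular injective.\<close>

lemma bounds_reflect:
  assumes M: "homology_basis p (subtopology X M) I h" and U: "homology_basis p (subtopology X U) I h"
    and sub: "M \<subseteq> U" and m: "cycle p (subtopology X M) m" "bounds p (subtopology X U) m"
  shows "bounds p (subtopology X M) m"
proof -
  obtain c where c: "bounds p (subtopology X M) (m - comb I c h)" using homology_basis_span [OF M m(1)] .
  then have "bounds p (subtopology X U) (m - comb I c h)" by (rule singular_boundary_mono [OF sub])
  then have "bounds p (subtopology X U) (comb I c h)"
    using singular_relboundary_diff [OF m(2)] by fastforce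
  from homology_basisD(3) [OF U this] show ?thesis using c by simp
qed

lemma homology_basis_0_Un:
  assumes "homology_basis 0 (subtopology X U) {()} (\<lambda>_. frag_of s)" "homology_basis 0 (subtopology X V) {()} (\<lambda>_. frag_of s)"
  shows "homology_basis 0 (subtopology X (U \<union> V)) {()} (\<lambda>_. frag_of s)"
proof (rule homology_basis_0I)
  have "singular_simplex 0 (subtopology X U) s"
    using assms(1) by (simp add: homology_basis_def cycle_0 singular_chain_of)
  then show "singular_simplex 0 (subtopology X (U \<union> V)) s" by (rule singular_simplex_mono) simp
  fix f assume f: "singular_simplex 0 (subtopology X (U \<union> V)) f"
  then consider "singular_simplex 0 (subtopology X U) f" | "singular_simplex 0 (subtopology X V) f"
    by (auto simp: singular_simplex_subtopology standard_simplex_0)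
  then show "bounds 0 (subtopology X (U \<union> V)) (frag_of f - frag_of s)"
  proof cases
    case 1
    show ?thesis by (rule singular_boundary_mono [OF _ homology_basis_0D [OF assms(1) 1]]) simp
  next
    case 2
    show ?thesis by (rule singular_boundary_mono [OF _ homology_basis_0D [OF assms(2) 2]]) simp
  qed
qed

text \<open>By exactness, a class of \<open>U\<close> that dies in the union comes from the intersection.\<close>

lemma bounds_Un_left:
  assumes U: "openin X U" and V: "openin X V" and x: "cycle p (subtopology X U) x"
    and bx: "bounds p (subtopology X (U \<union> V)) x"
    and M: "\<And>m. cycle p (subtopology X (U \<inter> V)) m \<Longrightarrow> bounds p (subtopology X U) m"
  shows "bounds p (subtopology X U) x"
proof -
  have x0: "singular_chain p (subtopology X U) x" "singular_chain p (subtopology X V) 0"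
    "bounds p (subtopology X (U \<union> V)) (x + 0)"
    using x bx by (auto simp: singular_cycle)
  obtain u w where u: "singular_chain (Suc p) (subtopology X U) u" and w: "singular_chain (Suc p) (subtopology X V) w"
    and uw: "chain_boundary (Suc p) (u + w) = x + 0"
    by (rule small_boundary_exists [OF U V x0])
  let ?m = "x - chain_boundary (Suc p) u"
  have m: "?m = chain_boundary (Suc p) w" using uw by (simp add: chain_boundary_add algebra_simps)
  have "singular_chain p (subtopology X (U \<inter> V)) ?m"
  proof (rule singular_chain_Int)
    show "singular_chain p (subtopology X U) ?m" by (intro singular_chain_diff x0 singular_chain_boundary_alt u)
    show "singular_chain p (subtopology X V) ?m" unfolding m by (rule singular_chain_boundary_alt [OF w])
  qed
  moreover have "chain_boundary p ?m = 0"
    using bounds_imp_cycle [OF bounds_boundary [OF w]] by (simp add: m singular_cycle)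
  ultimately have "bounds p (subtopology X U) ?m" by (intro M) (simp add: singular_cycle)
  from singular_relboundary_add [OF this bounds_boundary [OF u]] show ?thesis by simp
qed

context toric_polygon
begin

section \<open>The cover by open stars of vertices\<close>

abbreviation sub :: "orbifold_point set \<Rightarrow> orbifold_point topology"
  where "sub S \<equiv> subtopology X S"

definition star :: "nat \<Rightarrow> orbifold_point set"
  where "star j = over (region {prv j, j})"

definition edge_star :: "nat \<Rightarrow> orbifold_point set"
  where "edge_star i = over (region {i})"

definition inner :: "orbifold_point set"
  where "inner = over (region {})"

definition chain_star :: "nat \<Rightarrow> nat \<Rightarrow> orbifold_point set"
  where "chain_star k l = (\<Union>j\<in>{k..l}. star j)"

lemma openin_star: "openin X (star j)" and openin_edge_star: "openin X (edge_star i)"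
  unfolding star_def edge_star_def by (rule openin_over [OF openin_region])+

lemma openin_chain_star: "openin X (chain_star k l)"
  unfolding chain_star_def by (rule openin_Union) (use openin_star in auto)

lemma over_region_Int: "over (region J) \<inter> over (region K) = over (region (J \<inter> K))"
  by (simp add: over_Int [symmetric] region_sub region_Int)

lemma over_region_mono: "J \<subseteq> K \<Longrightarrow> over (region J) \<subseteq> over (region K)"
  using region_mono [of J K] by (auto simp: over_def)

lemma chain_star_Suc: "k \<le> Suc l \<Longrightarrow> chain_star k (Suc l) = chain_star k l \<union> star (Suc l)"
  by (simp add: chain_star_def atLeastAtMostSuc_conv Un_commute)

lemma chain_star_single: "chain_star k k = star k"
  by (simp add: chain_star_def)

lemma star_Int: "star i \<inter> star j = over (region ({prv i, i} \<inter> {prv j, j}))"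
  unfolding star_def by (rule over_region_Int)

text \<open>The vertex \<open>l + 1\<close> has only one neighbour in the chain, because \<open>l \<le> n\<close> keeps away from the place
  where the polygon closes up.\<close>

lemma chain_star_Int_star:
  assumes k: "1 \<le> k" "k \<le> l" and l: "l \<le> n"
  shows "chain_star k l \<inter> star (Suc l) = edge_star l"
proof
  have prv_l: "prv (Suc l) = l" using k by (simp add: prv_def)
  show "chain_star k l \<inter> star (Suc l) \<subseteq> edge_star l"
  proof
    fix c assume "c \<in> chain_star k l \<inter> star (Suc l)"
    then obtain j where j: "j \<in> {k..l}" and c: "c \<in> star j \<inter> star (Suc l)" by (auto simp: chain_star_def)
    have "{prv j, j} \<inter> {prv (Suc l), Suc l} \<subseteq> {l}"
      unfolding prv_l using j k l by (auto simp: prv_def split: if_splits)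
    then show "c \<in> edge_star l"
      using c over_region_mono unfolding star_Int edge_star_def by blast
  qed
  have "edge_star l \<subseteq> star l \<inter> star (Suc l)"
    unfolding star_Int edge_star_def prv_l by (rule over_region_mono) simp
  then show "edge_star l \<subseteq> chain_star k l \<inter> star (Suc l)" using k by (auto simp: chain_star_def)
qed

text \<open>The last vertex has two neighbours in the chain, the first vertex and vertex \<open>n + 1\<close>.\<close>

lemma chain_star_Int_last: "chain_star 1 (n + 1) \<inter> star (n + 2) = edge_star (n + 1) \<union> edge_star (n + 2)"
proof
  have prv_n: "prv (n + 2) = n + 1" "prv 1 = n + 2" by (simp_all add: prv_def)
  show "chain_star 1 (n + 1) \<inter> star (n + 2) \<subseteq> edge_star (n + 1) \<union> edge_star (n + 2)"
  proof
    fix c assume "c \<in> chain_star 1 (n + 1) \<inter> star (n + 2)"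
    then obtain j where j: "j \<in> {1..n + 1}" and c: "c \<in> star j \<inter> star (n + 2)" by (auto simp: chain_star_def)
    have "{prv j, j} \<inter> {prv (n + 2), n + 2} \<subseteq> {n + 1} \<or> {prv j, j} \<inter> {prv (n + 2), n + 2} \<subseteq> {n + 2}"
      unfolding prv_n using j n by (auto simp: prv_def split: if_splits)
    then show "c \<in> edge_star (n + 1) \<union> edge_star (n + 2)"
      using c over_region_mono unfolding star_Int edge_star_def by blast
  qed
  have "edge_star (n + 1) \<subseteq> star (n + 1) \<inter> star (n + 2)" "edge_star (n + 2) \<subseteq> star 1 \<inter> star (n + 2)"
    unfolding star_Int edge_star_def prv_n by (rule over_region_mono; simp)+
  moreover have "star (n + 1) \<subseteq> chain_star 1 (n + 1)" "star 1 \<subseteq> chain_star 1 (n + 1)"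
    unfolding chain_star_def by (rule UN_upper, simp)+
  ultimately show "edge_star (n + 1) \<union> edge_star (n + 2) \<subseteq> chain_star 1 (n + 1) \<inter> star (n + 2)"
    by blast
qed

lemma edge_star_Int: "i \<noteq> j \<Longrightarrow> edge_star i \<inter> edge_star j = inner"
  by (simp add: edge_star_def inner_def over_region_Int)

lemma stars_cover: "chain_star 1 (n + 1) \<union> star (n + 2) = topspace X"
proof
  have sub: "star j \<subseteq> topspace X" for j using openin_subset [OF openin_star] .
  then show "chain_star 1 (n + 1) \<union> star (n + 2) \<subseteq> topspace X" by (auto simp: chain_star_def)
  show "topspace X \<subseteq> chain_star 1 (n + 1) \<union> star (n + 2)"
  proof
    fix c assume "c \<in> topspace X"
    then obtain z where z: "z \<in> P \<times> torus" "c = cls z" by (auto simp: topspace_X over_def)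
    have "\<exists>j\<in>{1..n + 2}. edges_at (fst z) \<subseteq> {prv j, j}"
    proof (cases "fst z" rule: edges_at_cases)
      case 1
      then show ?thesis by (intro bexI [of _ 1]) simp_all
    qed blast+
    then obtain j where j: "j \<in> {1..n + 2}" "edges_at (fst z) \<subseteq> {prv j, j}" by blast
    then have "c \<in> star j" using z by (auto simp: star_def over_def region_def)
    moreover have "j \<in> {1..n + 1} \<or> j = n + 2" using j(1) by auto
    ultimately show "c \<in> chain_star 1 (n + 1) \<union> star (n + 2)"
      unfolding chain_star_def by blast
  qed
qed

lemma pt_frag: "\<exists>s. pt = frag_of s"
  unfolding pt_def vertex_def chain_map_of by blast

lemma star_homology:
  assumes "j \<in> {1..n + 2}"
  shows star_0: "homology_basis 0 (sub (star j)) {()} (\<lambda>_. pt)" and star_pos: "homology_basis (Suc p) (sub (star j)) {} h"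
  unfolding star_def using vertex_star_homology [OF assms] by blast+

lemma star_bounds: "j \<in> {1..n + 2} \<Longrightarrow> cycle (Suc p) (sub (star j)) z \<Longrightarrow> bounds (Suc p) (sub (star j)) z"
  using homology_basis_emptyD [OF star_pos [where h = "\<lambda>_::unit. 0"]] .

subsection \<open>Disks and spheres\<close>

text \<open>Stars of vertices being contractible, every loop of the torus is filled there, and in a way that
  is unique up to boundaries.\<close>

definition disk :: "nat \<Rightarrow> int \<times> int \<Rightarrow> orbifold_point chain"
  where "disk j \<mu> = filling (Suc 0) (sub (star j)) (loop \<mu>)"

text \<open>The sphere over the edge \<open>E i\<close>: two disks, in the stars of its end points, glued along the loop
  that generates the homology over the edge.\<close>

definition sphere_cycle :: "nat \<Rightarrow> orbifold_point chain"
  where "sphere_cycle i = disk i (dual i) - disk (nxt i) (dual i)"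

lemma disk:
  assumes j: "j \<in> {1..n + 2}"
  shows "singular_chain (Suc (Suc 0)) (sub (star j)) (disk j \<mu>)" "chain_boundary (Suc (Suc 0)) (disk j \<mu>) = loop \<mu>"
proof -
  have "bounds (Suc 0) (sub (star j)) (loop \<mu>)"
    by (rule star_bounds [OF j]) (simp add: star_def loop_cycle)
  then show "singular_chain (Suc (Suc 0)) (sub (star j)) (disk j \<mu>)" "chain_boundary (Suc (Suc 0)) (disk j \<mu>) = loop \<mu>"
    unfolding disk_def by (rule filling)+
qed

lemma disk_chain_X: "j \<in> {1..n + 2} \<Longrightarrow> singular_chain (Suc (Suc 0)) X (disk j \<mu>)"
  using disk(1) by (simp add: singular_chain_subtopology)

lemma bounds_X: "bounds p (sub S) c \<Longrightarrow> bounds p X c"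
  using singular_boundary_mono [of "S" UNIV p X c] by simp

text \<open>Over the edge, the loop \<open>\<mu>\<close> is homologous to \<open>edge_pairing i \<mu>\<close> times the generating loop. A chain
  that realises this homology lies in the stars of both end points of the edge, and there it turns
  one filling of \<open>\<mu>\<close> into a multiple of a filling of the generating loop.\<close>

lemma disk_edge_relation:
  assumes i: "i \<in> {1..n + 2}"
  shows "bounds (Suc (Suc 0)) X ((disk i \<mu> - disk (nxt i) \<mu>) - frag_cmul (edge_pairing i \<mu>) (sphere_cycle i))"
proof -
  let ?w = "filling (Suc 0) (XR {i}) (loop \<mu> - frag_cmul (edge_pairing i \<mu>) (loop (dual i)))"
  have w: "singular_chain (Suc (Suc 0)) (XR {i}) ?w"
    "chain_boundary (Suc (Suc 0)) ?w = loop \<mu> - frag_cmul (edge_pairing i \<mu>) (loop (dual i))"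
    using edge_star_loop [OF i, of \<mu>] by (rule filling)+
  have *: "bounds (Suc (Suc 0)) X (disk j \<mu> - frag_cmul (edge_pairing i \<mu>) (disk j (dual i)) - ?w)"
    if j: "j \<in> {1..n + 2}" "i \<in> {prv j, j}" for j
  proof -
    have "singular_chain (Suc (Suc 0)) (sub (star j)) ?w"
      unfolding star_def by (rule singular_chain_mono [OF w(1) over_region_mono]) (use j in auto)
    then have "cycle (Suc (Suc 0)) (sub (star j)) (disk j \<mu> - frag_cmul (edge_pairing i \<mu>) (disk j (dual i)) - ?w)"
      using disk [OF j(1), of \<mu>] disk [OF j(1), of "dual i"] w(2)
      by (auto simp: singular_cycle chain_boundary_diff chain_boundary_cmul intro!: singular_chain_diff singular_chain_cmul)
    then show ?thesis using star_bounds [OF j(1)] bounds_X by blast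
  qed
  have "i \<in> {prv (nxt i), nxt i}" using i by (auto simp: prv_def nxt_def)
  from singular_relboundary_diff [OF * [OF i] * [OF nxt_in [OF i] this]]
  have "bounds (Suc (Suc 0)) X ((disk i \<mu> - frag_cmul (edge_pairing i \<mu>) (disk i (dual i)) - ?w)
      - (disk (nxt i) \<mu> - frag_cmul (edge_pairing i \<mu>) (disk (nxt i) (dual i)) - ?w))" by simp
  moreover have "x - frag_cmul k y - w - (x' - frag_cmul k y' - w) = (x - x') - frag_cmul k (y - y')"
    for x y x' y' w :: "orbifold_point chain" and k
    using frag_cmul_distrib2 [of k "y - y'" y'] by simp
  ultimately show ?thesis by (simp only: sphere_cycle_def)
qed

subsection \<open>Homology of chains of stars\<close>

text \<open>The next star is contractible and meets the chain over an edge, in a circle up to homotopy. So it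
  contributes exactly one class, of degree 2: the generating loop of that circle, filled on both
  sides.\<close>

lemma chain_star_homology:
  assumes "1 \<le> k" "k \<le> l" "l \<le> n + 1"
  shows "homology_basis 0 (sub (chain_star k l)) {()} (\<lambda>_. pt)
    \<and> homology_basis (Suc 0) (sub (chain_star k l)) {} (\<lambda>_::unit. 0)
    \<and> homology_basis (Suc (Suc 0)) (sub (chain_star k l)) {k..<l} sphere_cycle
    \<and> (\<forall>p. homology_basis (Suc (Suc (Suc p))) (sub (chain_star k l)) {} (\<lambda>_::unit. 0))"
  using assms(2,3)
proof (induction l rule: dec_induct)
  case base
  have "k \<in> {1..n + 2}" using assms by auto
  note s = star_0 [OF this] star_pos [OF this, where h = "\<lambda>_::unit. 0"] star_pos [OF this, where h = sphere_cycle]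
  then show ?case unfolding chain_star_single by (simp only: atLeastLessThan_empty order_refl simp_thms)
next
  case (step l)
  have l: "l \<in> {1..n + 2}" "Suc l \<in> {1..n + 2}" "l \<le> n" using step assms by auto
  have IH: "homology_basis 0 (sub (chain_star k l)) {()} (\<lambda>_. pt)"
    "homology_basis (Suc 0) (sub (chain_star k l)) {} (\<lambda>_::unit. 0)"
    "homology_basis (Suc (Suc 0)) (sub (chain_star k l)) {k..<l} sphere_cycle"
    "\<And>p. homology_basis (Suc (Suc (Suc p))) (sub (chain_star k l)) {} (\<lambda>_::unit. 0)"
    using step by auto
  let ?U = "chain_star k l" and ?V = "star (Suc l)"
  have W: "chain_star k (Suc l) = ?U \<union> ?V" using step by (intro chain_star_Suc) simp
  have M: "?U \<inter> ?V = edge_star l" using assms(1) step(1) l(3) by (rule chain_star_Int_star)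
  note op = openin_chain_star [of k l] openin_star [of "Suc l"]
  note e0 = edge_star_0 [OF l(1), folded edge_star_def] and e1 = edge_star_1 [OF l(1), folded edge_star_def]
    and e2 = edge_star_2 [OF l(1), folded edge_star_def, where h = "\<lambda>_::unit. 0"]
  have subU: "edge_star l \<subseteq> ?U" using M by blast
  have up: "bounds p (sub (?U \<union> ?V)) z" if "bounds p (sub ?U) z \<or> bounds p (sub ?V) z" for p z
    using that singular_boundary_mono [of ?U "?U \<union> ?V"] singular_boundary_mono [of ?V "?U \<union> ?V"] by auto
  have V: "bounds (Suc p) (sub (?U \<union> ?V)) z" if "cycle (Suc p) (sub ?V) z" for p z
    using up star_bounds [OF l(2) that] by blast
  obtain s where s: "pt = frag_of s" using pt_frag by blast
  have h0: "homology_basis 0 (sub (?U \<union> ?V)) {()} (\<lambda>_. pt)"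
    using IH(1) star_0 [OF l(2)] unfolding s by (rule homology_basis_0_Un)
  have h1: "homology_basis (Suc 0) (sub (?U \<union> ?V)) {} (\<lambda>_::unit. 0)"
  proof (rule mayer_vietoris_trivial [OF op])
    show "bounds (Suc 0) (sub (?U \<union> ?V)) z" if "cycle (Suc 0) (sub ?U) z" for z
      using up homology_basis_emptyD [OF IH(2) that] by blast
    show "bounds 0 (sub (?U \<inter> ?V)) m" if "cycle 0 (sub (?U \<inter> ?V)) m" "bounds 0 (sub ?U) m" for m
      using bounds_reflect [OF e0 IH(1) subU] that unfolding M by blast
  qed (rule V)
  have h3: "homology_basis (Suc (Suc (Suc p))) (sub (?U \<union> ?V)) {} (\<lambda>_::unit. 0)" for p
  proof (rule mayer_vietoris_trivial [OF op])
    show "bounds (Suc (Suc (Suc p))) (sub (?U \<union> ?V)) z" if "cycle (Suc (Suc (Suc p))) (sub ?U) z" for z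
      using up homology_basis_emptyD [OF IH(4) that] by blast
    show "bounds (Suc (Suc p)) (sub (?U \<inter> ?V)) m" if "cycle (Suc (Suc p)) (sub (?U \<inter> ?V)) m" for m
      using homology_basis_emptyD [OF e2] that unfolding M by blast
  qed (rule V)
  have "homology_basis (Suc (Suc 0)) (sub (?U \<union> ?V)) ({k..<l} <+> {l})
      (case_sum sphere_cycle (\<lambda>i. disk i (dual i) - disk (nxt i) (dual i)))"
  proof (rule mayer_vietoris_basis [OF op])
    show "cycle (Suc (Suc 0)) (sub ?U) (sphere_cycle i)" if "i \<in> {k..<l}" for i
      by (rule homology_basisD(2) [OF IH(3) that])
    show "\<exists>c. bounds (Suc (Suc 0)) (sub (?U \<union> ?V)) (z - comb {k..<l} c sphere_cycle)"
      if "cycle (Suc (Suc 0)) (sub ?U) z" for z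
      using homology_basis_span [OF IH(3) that] up by meson
    show "\<exists>c. bounds (Suc (Suc 0)) (sub (?U \<union> ?V)) (z - comb {k..<l} c sphere_cycle)"
      if "cycle (Suc (Suc 0)) (sub ?V) z" for z
      using V [OF that] by (intro exI [of _ "\<lambda>_. 0"]) simp
    show "c i = 0" if "bounds (Suc (Suc 0)) (sub (?U \<union> ?V)) (comb {k..<l} c sphere_cycle)" "i \<in> {k..<l}" for c i
    proof (rule homology_basisD(3) [OF IH(3) _ that(2)])
      show "bounds (Suc (Suc 0)) (sub ?U) (comb {k..<l} c sphere_cycle)"
      proof (rule bounds_Un_left [OF op _ that(1)])
        show "cycle (Suc (Suc 0)) (sub ?U) (comb {k..<l} c sphere_cycle)"
          by (rule comb_cycle) (rule homology_basisD(2) [OF IH(3)])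
        show "bounds (Suc (Suc 0)) (sub ?U) m" if "cycle (Suc (Suc 0)) (sub (?U \<inter> ?V)) m" for m
          using homology_basis_emptyD [OF e2] that singular_boundary_mono [OF subU] unfolding M by blast
      qed
    qed
    fix i assume "i \<in> {l}"
    then have i: "i = l" "nxt i = Suc l" using l by (auto simp: nxt_def)
    show "singular_chain (Suc (Suc 0)) (sub ?U) (disk i (dual i))"
      unfolding i by (rule singular_chain_mono [OF disk(1) [OF l(1)]]) (use step(1) in \<open>auto simp: chain_star_def\<close>)
    show "singular_chain (Suc (Suc 0)) (sub ?V) (disk (nxt i) (dual i))"
      unfolding i(2) by (rule disk(1) [OF l(2)])
    show "chain_boundary (Suc (Suc 0)) (disk (nxt i) (dual i)) = chain_boundary (Suc (Suc 0)) (disk i (dual i))"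
      unfolding i(2) using disk(2) [OF l(1)] disk(2) [OF l(2)] by (simp add: i(1))
  next
    fix m assume "cycle (Suc 0) (sub (?U \<inter> ?V)) m"
    then have "cycle (Suc 0) (sub (edge_star l)) m" unfolding M .
    then obtain c where c: "bounds (Suc 0) (sub (edge_star l)) (m - comb {()} c (\<lambda>_. loop (dual l)))"
      by (rule homology_basis_span [OF e1])
    show "\<exists>d. bounds (Suc 0) (sub (?U \<inter> ?V)) (m - comb {l} d (\<lambda>k. chain_boundary (Suc (Suc 0)) (disk k (dual k))))"
      unfolding M by (rule exI [of _ "\<lambda>_. c ()"]) (use c disk(2) [OF l(1)] in simp)
  next
    fix d i assume d: "bounds (Suc 0) (sub (?U \<inter> ?V)) (comb {l} d (\<lambda>k. chain_boundary (Suc (Suc 0)) (disk k (dual k))))"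
      and i: "i \<in> {l}"
    have "bounds (Suc 0) (sub (edge_star l)) (comb {()} (\<lambda>_. d l) (\<lambda>_. loop (dual l)))"
      using d disk(2) [OF l(1)] unfolding M by simp
    from homology_basisD(3) [OF e1 this] show "d i = 0" using i by simp
  qed auto
  then have "homology_basis (Suc (Suc 0)) (sub (?U \<union> ?V)) {k..<Suc l} sphere_cycle"
  proof (rule homology_basis_reindex)
    show "bij_betw (\<lambda>i. if i = l then Inr i else Inl i) {k..<Suc l} ({k..<l} <+> {l})"
      using step(1) by (auto simp: bij_betw_def inj_on_def image_iff less_Suc_eq split: if_splits)
  qed (auto simp: sphere_cycle_def)
  with h0 h1 h3 show ?case unfolding W by blast
qed

end

section \<open>Evaluating cup products\<close>

lemma cochain_eval_cong:
  assumes "singular_chain p X c" "\<And>f. singular_simplex p X f \<Longrightarrow> \<phi> f = \<psi> f"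
  shows "cochain_eval \<phi> c = cochain_eval \<psi> c"
  unfolding cochain_eval_def by (rule sum.cong) (use assms in \<open>auto simp: singular_chain_def\<close>)

lemma cochain_eval_zero_cochain [simp]: "cochain_eval (\<lambda>f. 0) c = 0"
  by (simp add: cochain_eval_def)

lemma cochain_eval_chain_map:
  assumes "singular_chain p X c"
  shows "cochain_eval \<phi> (chain_map p f c) = cochain_eval (\<lambda>s. \<phi> (simplex_map p f s)) c"
  using assms unfolding singular_chain_def
  by (induction c rule: frag_induction) (auto simp: chain_map_diff cochain_eval_diff)

lemma front_face_simplex_map: "front_face p (simplex_map (p + q) f s) = simplex_map p f (front_face p s)"
  using standard_simplex_subset_add [of _ p q]
  by (auto simp: front_face_def simplex_map_def restrict_def fun_eq_iff)

lemma back_face_simplex_map: "back_face p q (simplex_map (p + q) f s) = simplex_map q f (back_face p q s)"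
  using shift_in_standard_simplex [of _ q p]
  by (auto simp: back_face_def simplex_map_def restrict_def fun_eq_iff)

lemma cup_cochain_chain_map:
  assumes f: "continuous_map T X f" and c: "singular_chain (p + q) T c"
  shows "cochain_eval (cup_cochain p q X \<phi> \<psi>) (chain_map (p + q) f c)
    = cochain_eval (cup_cochain p q T (\<lambda>s. \<phi> (simplex_map p f s)) (\<lambda>s. \<psi> (simplex_map q f s))) c"
  unfolding cochain_eval_chain_map [OF c]
  by (rule cochain_eval_cong [OF c])
    (simp add: cup_cochain_def singular_simplex_simplex_map [OF _ f] front_face_simplex_map back_face_simplex_map)

lemma cup_cochain_cong:
  assumes c: "singular_chain (p + q) (subtopology X V) c"
    and \<phi>: "\<And>f. singular_simplex p (subtopology X V) f \<Longrightarrow> \<phi> f = \<phi>' f"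
    and \<psi>: "\<And>f. singular_simplex q (subtopology X V) f \<Longrightarrow> \<psi> f = \<psi>' f"
  shows "cochain_eval (cup_cochain p q X \<phi> \<psi>) c = cochain_eval (cup_cochain p q X \<phi>' \<psi>') c"
  by (rule cochain_eval_cong [OF c])
    (simp add: cup_cochain_def \<phi> \<psi> singular_simplex_front_face singular_simplex_back_face)

lemma cup_cochain_vanish:
  assumes c: "singular_chain (p + q) (subtopology X V) c"
    and v: "(\<forall>f. singular_simplex p (subtopology X V) f \<longrightarrow> \<phi> f = 0) \<or>
      (\<forall>f. singular_simplex q (subtopology X V) f \<longrightarrow> \<psi> f = 0)"
  shows "cochain_eval (cup_cochain p q X \<phi> \<psi>) c = 0"
proof -
  have "cochain_eval (cup_cochain p q X \<phi> \<psi>) c = cochain_eval (\<lambda>f. 0) c"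
  proof (rule cochain_eval_cong [OF c])
    fix f assume f: "singular_simplex (p + q) (subtopology X V) f"
    show "cup_cochain p q X \<phi> \<psi> f = 0"
      using v singular_simplex_front_face [OF f] singular_simplex_back_face [OF f] by (auto simp: cup_cochain_def)
  qed
  then show ?thesis by simp
qed

text \<open>Restricted to \<open>V\<close>, the cocycle is a coboundary, since it vanishes on the cycles of \<open>V\<close>; a primitive
  there, extended by zero, is a cochain of \<open>X\<close>.\<close>

lemma local_primitive:
  assumes g: "homology_basis p (subtopology X V) J g" and u: "cocycle (Suc p) X u"
    and 0: "\<And>z. cycle (Suc p) (subtopology X V) z \<Longrightarrow> cochain_eval u z = 0"
  obtains \<beta> where "singular_cochain p X \<beta>"
    "\<And>f. singular_simplex (Suc p) (subtopology X V) f \<Longrightarrow> coboundary p X \<beta> f = u f"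
proof -
  define w where "w f = (if singular_simplex (Suc p) (subtopology X V) f then u f else 0)" for f
  have w: "singular_cochain (Suc p) (subtopology X V) w" by (simp add: singular_cochain_def w_def)
  have "cochain_eval w z = 0" if z: "cycle (Suc p) (subtopology X V) z" for z
  proof -
    have "cochain_eval w z = cochain_eval u z"
      by (rule cochain_eval_cong [of "Suc p" "subtopology X V"]) (use z in \<open>auto simp: singular_cycle w_def\<close>)
    then show ?thesis using 0 [OF z] by simp
  qed
  then obtain \<beta> where \<beta>: "singular_cochain p (subtopology X V) \<beta>" "coboundary p (subtopology X V) \<beta> = w"
    using coboundary_if_vanishes_on_cycles [OF g w] by blast
  have "singular_cochain p X \<beta>"
    using \<beta>(1) by (auto simp: singular_cochain_def singular_simplex_subtopology)
  moreover have "coboundary p X \<beta> f = u f" if f: "singular_simplex (Suc p) (subtopology X V) f" for f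
  proof -
    have "coboundary p X \<beta> f = coboundary p (subtopology X V) \<beta> f"
      using f by (simp add: coboundary_def singular_simplex_subtopology)
    then show ?thesis using f by (simp add: \<beta>(2) w_def)
  qed
  ultimately show thesis using that by blast
qed

lemma cochain_eval_coboundary_cycle:
  "cycle (Suc p) X z \<Longrightarrow> cochain_eval (coboundary p X \<beta>) z = 0"
  by (simp add: singular_cycle cochain_eval_coboundary)

lemma cocycle_coboundary: "cocycle (Suc p) X (coboundary p X \<beta>)"
  by (simp add: singular_cochain_coboundary coboundary_coboundary)

text \<open>Subtract the coboundary of a primitive on \<open>V\<close>; this changes no value on a cycle of \<open>X\<close>.\<close>

lemma local_representative:
  assumes g: "homology_basis p (subtopology X V) J g" and u: "cocycle (Suc p) X u"
    and 0: "\<And>z. cycle (Suc p) (subtopology X V) z \<Longrightarrow> cochain_eval u z = 0"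
  obtains u' where "cocycle (Suc p) X u'" "\<And>f. singular_simplex (Suc p) (subtopology X V) f \<Longrightarrow> u' f = 0"
    "\<And>z. cycle (Suc p) X z \<Longrightarrow> cochain_eval u' z = cochain_eval u z"
proof -
  obtain \<beta> where \<beta>: "singular_cochain p X \<beta>"
    "\<And>f. singular_simplex (Suc p) (subtopology X V) f \<Longrightarrow> coboundary p X \<beta> f = u f"
    using local_primitive [OF g u 0] by blast
  let ?u = "\<lambda>f. u f - coboundary p X \<beta> f"
  have "cocycle (Suc p) X ?u" by (rule cocycle_minus [OF u cocycle_coboundary])
  moreover have "?u f = 0" if "singular_simplex (Suc p) (subtopology X V) f" for f
    using \<beta>(2) [OF that] by simp
  moreover have "cochain_eval ?u z = cochain_eval u z" if "cycle (Suc p) X z" for z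
    by (simp add: cochain_eval_minus_cochain cochain_eval_coboundary_cycle [OF that])
  ultimately show thesis using that by blast
qed

context toric_polygon
begin

section \<open>The neighbourhood of the smooth vertex\<close>

text \<open>A punctured neighbourhood of the point over the smooth vertex. The parts over the two edges are
  solid tori with common boundary torus \<open>tor\<close>; the chain \<open>solid i\<close> stands for such a solid torus.\<close>

definition corner :: "orbifold_point set"
  where "corner = edge_star (n + 1) \<union> edge_star (n + 2)"

definition solid :: "nat \<Rightarrow> orbifold_point chain"
  where "solid i = filling (Suc (Suc 0)) (sub (edge_star i)) tor"

definition corner_cycle :: "orbifold_point chain"
  where "corner_cycle = solid (n + 1) - solid (n + 2)"

lemma last_edges: "n + 1 \<in> {1..n + 2}" "n + 2 \<in> {1..n + 2}"
  by auto

lemma edge_star_basis: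
  assumes "i \<in> {1..n + 2}"
  shows "homology_basis 0 (sub (edge_star i)) {()} (\<lambda>_. pt)"
    and "homology_basis (Suc 0) (sub (edge_star i)) {()} (\<lambda>_. loop (dual i))"
    and "homology_basis (Suc (Suc p)) (sub (edge_star i)) {} h"
    and "bounds (Suc 0) (sub (edge_star i)) (loop \<mu> - frag_cmul (edge_pairing i \<mu>) (loop (dual i)))"
  using edge_star_homology [OF assms] unfolding edge_star_def by blast+

lemma edge_star_bounds:
  "i \<in> {1..n + 2} \<Longrightarrow> cycle (Suc (Suc p)) (sub (edge_star i)) z \<Longrightarrow> bounds (Suc (Suc p)) (sub (edge_star i)) z"
  using homology_basis_emptyD [OF edge_star_basis(3) [where h = "\<lambda>_::unit. 0"]] .

lemma solid:
  assumes i: "i \<in> {1..n + 2}"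
  shows "singular_chain (Suc (Suc (Suc 0))) (sub (edge_star i)) (solid i)"
    "chain_boundary (Suc (Suc (Suc 0))) (solid i) = tor"
proof -
  have "bounds (Suc (Suc 0)) (sub (edge_star i)) tor"
    by (rule edge_star_bounds [OF i]) (simp add: edge_star_def tor_cycle)
  then show "singular_chain (Suc (Suc (Suc 0))) (sub (edge_star i)) (solid i)"
    "chain_boundary (Suc (Suc (Suc 0))) (solid i) = tor"
    unfolding solid_def by (rule filling)+
qed

lemma pairing_last:
  "edge_pairing (n + 1) \<mu> = snd \<mu>" "edge_pairing (n + 2) \<mu> = - fst \<mu>"
  unfolding edge_pairing_def a_b_last by simp_all

lemma loop_bounds_last:
  "bounds (Suc 0) (sub (edge_star (n + 1))) (loop (1, 0))"
  "bounds (Suc 0) (sub (edge_star (n + 2))) (loop (0, 1))"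
  using edge_star_basis(4) [OF last_edges(1), of "(1, 0)"] edge_star_basis(4) [OF last_edges(2), of "(0, 1)"]
  by (simp_all only: pairing_last) simp_all

lemma loop_last:
  "bounds (Suc 0) (sub (edge_star (n + 1))) (loop (0, 1) - loop (dual (n + 1)))"
  "bounds (Suc 0) (sub (edge_star (n + 2))) (loop (1, 0) + loop (dual (n + 2)))"
  using edge_star_basis(4) [OF last_edges(1), of "(0, 1)"] edge_star_basis(4) [OF last_edges(2), of "(1, 0)"]
  by (simp_all only: pairing_last) simp_all

text \<open>This is where smoothness enters. Of the two coordinate loops of the torus, \<open>(1, 0)\<close> bounds over
  \<open>E (n + 1)\<close>, where \<open>(0, 1)\<close> is a generator, and over \<open>E (n + 2)\<close> it is the other way round. Two
  solid tori glued in this way form a 3-sphere.\<close>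

lemma corner_homology:
  shows corner_0: "homology_basis 0 (sub corner) {()} (\<lambda>_. pt)"
    and corner_1: "homology_basis (Suc 0) (sub corner) {} (\<lambda>_::unit. 0)"
    and corner_2: "homology_basis (Suc (Suc 0)) (sub corner) {} (\<lambda>_::unit. 0)"
    and corner_3: "homology_basis (Suc (Suc (Suc 0))) (sub corner) {()} (\<lambda>_. corner_cycle)"
    and corner_4: "homology_basis (Suc (Suc (Suc (Suc p)))) (sub corner) {} (\<lambda>_::unit. 0)"
proof -
  let ?U = "edge_star (n + 1)" and ?V = "edge_star (n + 2)"
  note op = openin_edge_star [of "n + 1"] openin_edge_star [of "n + 2"]
  note U = edge_star_basis [OF last_edges(1)] and V = edge_star_basis [OF last_edges(2)]
  have M: "?U \<inter> ?V = inner" by (rule edge_star_Int) simp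
  have subU: "inner \<subseteq> ?U" and subV: "inner \<subseteq> ?V" using M by blast+
  have upU: "bounds p (sub (?U \<union> ?V)) z" if "bounds p (sub ?U) z" for p z
    using that by (rule singular_boundary_mono [rotated]) simp
  have upV: "bounds p (sub (?U \<union> ?V)) z" if "bounds p (sub ?V) z" for p z
    using that by (rule singular_boundary_mono [rotated]) simp
  note i0 = inner_0 [folded inner_def] and i1 = inner_1 [folded inner_def]
    and i2 = inner_2 [folded inner_def] and i3 = inner_3 [folded inner_def, where h = "\<lambda>_::unit. 0"]
  obtain s where s: "pt = frag_of s" using pt_frag by blast
  show "homology_basis 0 (sub corner) {()} (\<lambda>_. pt)"
    unfolding corner_def using U(1) V(1) unfolding s by (rule homology_basis_0_Un)
  show "homology_basis (Suc 0) (sub corner) {} (\<lambda>_::unit. 0)"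
    unfolding corner_def
  proof (rule mayer_vietoris_trivial [OF op])
    fix z assume "cycle (Suc 0) (sub ?U) z"
    then obtain c where c: "bounds (Suc 0) (sub ?U) (z - comb {()} c (\<lambda>_. loop (dual (n + 1))))"
      by (rule homology_basis_span [OF U(2)])
    \<comment> \<open>The generator over one edge bounds over the other.\<close>
    have "bounds (Suc 0) (sub (?U \<union> ?V)) (loop (0, 1) - (loop (0, 1) - loop (dual (n + 1))))"
      by (intro singular_relboundary_diff upU [OF loop_last(1)] upV [OF loop_bounds_last(2)])
    then have "bounds (Suc 0) (sub (?U \<union> ?V)) (frag_cmul (c ()) (loop (dual (n + 1))))"
      by (intro singular_relboundary_cmul) simp
    from singular_relboundary_add [OF upU [OF c] this] show "bounds (Suc 0) (sub (?U \<union> ?V)) z" by simp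
  next
    fix z assume "cycle (Suc 0) (sub ?V) z"
    then obtain c where c: "bounds (Suc 0) (sub ?V) (z - comb {()} c (\<lambda>_. loop (dual (n + 2))))"
      by (rule homology_basis_span [OF V(2)])
    have "bounds (Suc 0) (sub (?U \<union> ?V)) ((loop (1, 0) + loop (dual (n + 2))) - loop (1, 0))"
      by (intro singular_relboundary_diff upV [OF loop_last(2)] upU [OF loop_bounds_last(1)])
    then have "bounds (Suc 0) (sub (?U \<union> ?V)) (frag_cmul (c ()) (loop (dual (n + 2))))"
      by (intro singular_relboundary_cmul) simp
    from singular_relboundary_add [OF upV [OF c] this] show "bounds (Suc 0) (sub (?U \<union> ?V)) z" by simp
  next
    show "bounds 0 (sub (?U \<inter> ?V)) m" if "cycle 0 (sub (?U \<inter> ?V)) m" "bounds 0 (sub ?U) m" for m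
      using bounds_reflect [OF i0 U(1) subU] that unfolding M by blast
  qed
  show "homology_basis (Suc (Suc 0)) (sub corner) {} (\<lambda>_::unit. 0)"
    unfolding corner_def
  proof (rule mayer_vietoris_trivial [OF op])
    show "bounds (Suc (Suc 0)) (sub (?U \<union> ?V)) z" if "cycle (Suc (Suc 0)) (sub ?U) z" for z
      by (rule upU [OF edge_star_bounds [OF last_edges(1) that]])
    show "bounds (Suc (Suc 0)) (sub (?U \<union> ?V)) z" if "cycle (Suc (Suc 0)) (sub ?V) z" for z
      by (rule upV [OF edge_star_bounds [OF last_edges(2) that]])
    fix m assume "cycle (Suc 0) (sub (?U \<inter> ?V)) m" and mU: "bounds (Suc 0) (sub ?U) m" and mV: "bounds (Suc 0) (sub ?V) m"
    then have "cycle (Suc 0) (sub inner) m" unfolding M by simp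
    then obtain c where "bounds (Suc 0) (sub inner) (m - comb UNIV c (\<lambda>i. loop (if i then (1, 0) else (0, 1))))"
      by (rule homology_basis_span [OF i1])
    then have c: "bounds (Suc 0) (sub inner) (m - (frag_cmul (c False) (loop (0, 1)) + frag_cmul (c True) (loop (1, 0))))"
      by (simp add: UNIV_bool)
    let ?x = "frag_cmul (c False) (loop (0, 1))" and ?y = "frag_cmul (c True) (loop (1, 0))"
    have 1: "bounds (Suc 0) (sub ?U) ?y" and 2: "bounds (Suc 0) (sub ?V) ?x"
      by (intro singular_relboundary_cmul loop_bounds_last)+
    have "bounds (Suc 0) (sub ?U) (m - (m - (?x + ?y)) - ?y)"
      by (intro singular_relboundary_diff 1 mU singular_boundary_mono [OF subU c])
    then have "bounds (Suc 0) (sub ?U) ?x" by simp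
    moreover have "bounds (Suc 0) (sub ?U) (frag_cmul (c False) (loop (0, 1) - loop (dual (n + 1))))"
      by (intro singular_relboundary_cmul loop_last)
    ultimately have "bounds (Suc 0) (sub ?U) (?x - frag_cmul (c False) (loop (0, 1) - loop (dual (n + 1))))"
      by (rule singular_relboundary_diff)
    moreover have "frag_cmul k x - frag_cmul k (x - y) = frag_cmul k y" for k and x y :: "orbifold_point chain"
      using frag_cmul_distrib2 [of k "x - y" y] by simp
    ultimately have "bounds (Suc 0) (sub ?U) (comb {()} (\<lambda>_. c False) (\<lambda>_. loop (dual (n + 1))))" by simp
    from homology_basisD(3) [OF U(2) this] have cF: "c False = 0" by simp
    have "bounds (Suc 0) (sub ?V) (m - (m - (?x + ?y)) - ?x)"
      by (intro singular_relboundary_diff 2 mV singular_boundary_mono [OF subV c])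
    then have "bounds (Suc 0) (sub ?V) ?y" by simp
    moreover have "bounds (Suc 0) (sub ?V) (frag_cmul (c True) (loop (1, 0) + loop (dual (n + 2))))"
      by (intro singular_relboundary_cmul loop_last)
    ultimately have "bounds (Suc 0) (sub ?V) (frag_cmul (c True) (loop (1, 0) + loop (dual (n + 2))) - ?y)"
      by (rule singular_relboundary_diff [rotated])
    then have "bounds (Suc 0) (sub ?V) (comb {()} (\<lambda>_. c True) (\<lambda>_. loop (dual (n + 2))))"
      by (simp add: frag_cmul_distrib2)
    from homology_basisD(3) [OF V(2) this] have "c True = 0" by simp
    then show "bounds (Suc 0) (sub (?U \<inter> ?V)) m" using c cF unfolding M by simp
  qed
  show "homology_basis (Suc (Suc (Suc 0))) (sub corner) {()} (\<lambda>_. corner_cycle)"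
    unfolding corner_def corner_cycle_def
  proof (rule mayer_vietoris_new_class [OF op])
    show "homology_basis (Suc (Suc 0)) (sub (?U \<inter> ?V)) {()} (\<lambda>_. tor)" unfolding M by (rule i2)
    show "bounds (Suc (Suc (Suc 0))) (sub (?U \<union> ?V)) z" if "cycle (Suc (Suc (Suc 0))) (sub ?U) z" for z
      by (rule upU [OF edge_star_bounds [OF last_edges(1) that]])
    show "bounds (Suc (Suc (Suc 0))) (sub (?U \<union> ?V)) z" if "cycle (Suc (Suc (Suc 0))) (sub ?V) z" for z
      by (rule upV [OF edge_star_bounds [OF last_edges(2) that]])
  qed (rule solid last_edges)+
  show "homology_basis (Suc (Suc (Suc (Suc p)))) (sub corner) {} (\<lambda>_::unit. 0)"
    unfolding corner_def
  proof (rule mayer_vietoris_trivial [OF op])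
    show "bounds (Suc (Suc (Suc (Suc p)))) (sub (?U \<union> ?V)) z" if "cycle (Suc (Suc (Suc (Suc p)))) (sub ?U) z" for z
      by (rule upU [OF edge_star_bounds [OF last_edges(1) that]])
    show "bounds (Suc (Suc (Suc (Suc p)))) (sub (?U \<union> ?V)) z" if "cycle (Suc (Suc (Suc (Suc p)))) (sub ?V) z" for z
      by (rule upV [OF edge_star_bounds [OF last_edges(2) that]])
    show "bounds (Suc (Suc (Suc p))) (sub (?U \<inter> ?V)) m" if "cycle (Suc (Suc (Suc p))) (sub (?U \<inter> ?V)) m" for m
      using homology_basis_emptyD [OF i3] that unfolding M by blast
  qed
qed

section \<open>The homology of the toric orbifold\<close>

text \<open>The 3-sphere \<open>corner_cycle\<close> bounds on both sides: a ball in the star of the smooth vertex, and a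
  chain in the union of the other stars.\<close>

definition corner_ball :: "orbifold_point chain"
  where "corner_ball = filling (Suc (Suc (Suc 0))) (sub (star (n + 2))) corner_cycle"

definition co_ball :: "orbifold_point chain"
  where "co_ball = filling (Suc (Suc (Suc 0))) (sub (chain_star 1 (n + 1))) corner_cycle"

definition fundamental_cycle :: "orbifold_point chain"
  where "fundamental_cycle = corner_ball - co_ball"

lemma long_chain_homology:
  shows "homology_basis 0 (sub (chain_star 1 (n + 1))) {()} (\<lambda>_. pt)"
    and "homology_basis (Suc 0) (sub (chain_star 1 (n + 1))) {} (\<lambda>_::unit. 0)"
    and "homology_basis (Suc (Suc 0)) (sub (chain_star 1 (n + 1))) {1..n} sphere_cycle"
    and "homology_basis (Suc (Suc (Suc p))) (sub (chain_star 1 (n + 1))) {} (\<lambda>_::unit. 0)"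
proof -
  have "{1..<n + 1} = {1..n}" by auto
  then show "homology_basis 0 (sub (chain_star 1 (n + 1))) {()} (\<lambda>_. pt)"
    "homology_basis (Suc 0) (sub (chain_star 1 (n + 1))) {} (\<lambda>_::unit. 0)"
    "homology_basis (Suc (Suc 0)) (sub (chain_star 1 (n + 1))) {1..n} sphere_cycle"
    "homology_basis (Suc (Suc (Suc p))) (sub (chain_star 1 (n + 1))) {} (\<lambda>_::unit. 0)"
    using chain_star_homology [of 1 "n + 1"] by simp_all
qed

lemma corner_sub: "corner \<subseteq> star (n + 2)" "corner \<subseteq> chain_star 1 (n + 1)"
  using chain_star_Int_last by (auto simp: corner_def)

lemma corner_cycle: "cycle (Suc (Suc (Suc 0))) (sub corner) corner_cycle"
  using homology_basisD(2) [OF corner_3] by simp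

lemma corner_ball:
  "singular_chain (Suc (Suc (Suc (Suc 0)))) (sub (star (n + 2))) corner_ball"
  "chain_boundary (Suc (Suc (Suc (Suc 0)))) corner_ball = corner_cycle"
proof -
  have "bounds (Suc (Suc (Suc 0))) (sub (star (n + 2))) corner_cycle"
    by (rule star_bounds [OF last_edges(2) singular_cycle_mono [OF corner_cycle corner_sub(1)]])
  then show "singular_chain (Suc (Suc (Suc (Suc 0)))) (sub (star (n + 2))) corner_ball"
    "chain_boundary (Suc (Suc (Suc (Suc 0)))) corner_ball = corner_cycle"
    unfolding corner_ball_def by (rule filling)+
qed

lemma co_ball:
  "singular_chain (Suc (Suc (Suc (Suc 0)))) (sub (chain_star 1 (n + 1))) co_ball"
  "chain_boundary (Suc (Suc (Suc (Suc 0)))) co_ball = corner_cycle"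
proof -
  have "bounds (Suc (Suc (Suc 0))) (sub (chain_star 1 (n + 1))) corner_cycle"
    by (rule homology_basis_emptyD [OF long_chain_homology(4) singular_cycle_mono [OF corner_cycle corner_sub(2)]])
  then show "singular_chain (Suc (Suc (Suc (Suc 0)))) (sub (chain_star 1 (n + 1))) co_ball"
    "chain_boundary (Suc (Suc (Suc (Suc 0)))) co_ball = corner_cycle"
    unfolding co_ball_def by (rule filling)+
qed

text \<open>A contractible star is glued to the union of the others along a 3-sphere, so the only new class is
  that of the two fillings of this 3-sphere.\<close>

lemma X_homology:
  shows X_0: "homology_basis 0 X {()} (\<lambda>_. pt)"
    and X_1: "homology_basis (Suc 0) X {} (\<lambda>_::unit. 0)"
    and X_2: "homology_basis (Suc (Suc 0)) X {1..n} sphere_cycle"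
    and X_3: "homology_basis (Suc (Suc (Suc 0))) X {} (\<lambda>_::unit. 0)"
    and X_4: "homology_basis (Suc (Suc (Suc (Suc 0)))) X {()} (\<lambda>_. fundamental_cycle)"
    and X_5: "homology_basis (Suc (Suc (Suc (Suc (Suc p))))) X {} (\<lambda>_::unit. 0)"
proof -
  let ?U = "star (n + 2)" and ?V = "chain_star 1 (n + 1)"
  note op = openin_star [of "n + 2"] openin_chain_star [of 1 "n + 1"]
  note V = long_chain_homology
  have M: "?U \<inter> ?V = corner" using chain_star_Int_last by (simp only: Int_commute corner_def)
  have W: "sub (?U \<union> ?V) = X"
    using stars_cover by (simp only: Un_commute [of ?U] subtopology_topspace)
  have bU: "bounds (Suc p) (sub (?U \<union> ?V)) z" if "cycle (Suc p) (sub ?U) z" for p z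
    using star_bounds [OF last_edges(2) that] by (rule singular_boundary_mono [rotated]) simp
  have upV: "bounds p (sub (?U \<union> ?V)) z" if "bounds p (sub ?V) z" for p z
    using that by (rule singular_boundary_mono [rotated]) simp
  have bV: "bounds (Suc (Suc (Suc p))) (sub (?U \<union> ?V)) z" if "cycle (Suc (Suc (Suc p))) (sub ?V) z" for p z
    by (rule upV [OF homology_basis_emptyD [OF V(4) that]])
  obtain s where s: "pt = frag_of s" using pt_frag by blast
  have "homology_basis 0 (sub (?U \<union> ?V)) {()} (\<lambda>_. pt)"
    using star_0 [OF last_edges(2)] V(1) unfolding s by (rule homology_basis_0_Un)
  then show "homology_basis 0 X {()} (\<lambda>_. pt)" unfolding W .
  have "homology_basis (Suc 0) (sub (?U \<union> ?V)) {} (\<lambda>_::unit. 0)"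
  proof (rule mayer_vietoris_trivial [OF op bU])
    show "bounds (Suc 0) (sub (?U \<union> ?V)) z" if "cycle (Suc 0) (sub ?V) z" for z
      by (rule upV [OF homology_basis_emptyD [OF V(2) that]])
    show "bounds 0 (sub (?U \<inter> ?V)) m" if "cycle 0 (sub (?U \<inter> ?V)) m" "bounds 0 (sub ?V) m" for m
      using bounds_reflect [OF corner_0 V(1) corner_sub(2)] that unfolding M by blast
  qed
  then show "homology_basis (Suc 0) X {} (\<lambda>_::unit. 0)" unfolding W .
  have "homology_basis (Suc (Suc (Suc 0))) (sub (?U \<union> ?V)) {} (\<lambda>_::unit. 0)"
  proof (rule mayer_vietoris_trivial [OF op bU bV])
    show "bounds (Suc (Suc 0)) (sub (?U \<inter> ?V)) m" if "cycle (Suc (Suc 0)) (sub (?U \<inter> ?V)) m" for m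
      using homology_basis_emptyD [OF corner_2] that unfolding M by blast
  qed
  then show "homology_basis (Suc (Suc (Suc 0))) X {} (\<lambda>_::unit. 0)" unfolding W .
  have "homology_basis (Suc (Suc (Suc (Suc (Suc p))))) (sub (?U \<union> ?V)) {} (\<lambda>_::unit. 0)"
  proof (rule mayer_vietoris_trivial [OF op bU bV])
    show "bounds (Suc (Suc (Suc (Suc p)))) (sub (?U \<inter> ?V)) m" if "cycle (Suc (Suc (Suc (Suc p)))) (sub (?U \<inter> ?V)) m" for m
      using homology_basis_emptyD [OF corner_4] that unfolding M by blast
  qed
  then show "homology_basis (Suc (Suc (Suc (Suc (Suc p))))) X {} (\<lambda>_::unit. 0)" unfolding W .
  have "homology_basis (Suc (Suc (Suc (Suc 0)))) (sub (?U \<union> ?V)) {()} (\<lambda>_. fundamental_cycle)"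
    unfolding fundamental_cycle_def
  proof (rule mayer_vietoris_new_class [OF op bU bV])
    show "homology_basis (Suc (Suc (Suc 0))) (sub (?U \<inter> ?V)) {()} (\<lambda>_. corner_cycle)"
      unfolding M by (rule corner_3)
  qed (assumption | rule corner_ball co_ball)+
  then show "homology_basis (Suc (Suc (Suc (Suc 0)))) X {()} (\<lambda>_. fundamental_cycle)" unfolding W .
  have "homology_basis (Suc (Suc 0)) (sub (?V \<union> ?U)) ({1..n} <+> {}) (case_sum sphere_cycle (\<lambda>_::unit. 0 - 0))"
  proof (rule mayer_vietoris_basis [OF op(2,1)])
    note W' = W [unfolded Un_commute [of ?U]]
    show "cycle (Suc (Suc 0)) (sub ?V) (sphere_cycle i)" if "i \<in> {1..n}" for i
      by (rule homology_basisD(2) [OF V(3) that])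
    show "\<exists>c. bounds (Suc (Suc 0)) (sub (?V \<union> ?U)) (z - comb {1..n} c sphere_cycle)"
      if "cycle (Suc (Suc 0)) (sub ?V) z" for z
      using homology_basis_span [OF V(3) that] upV unfolding W W' by meson
    show "\<exists>c. bounds (Suc (Suc 0)) (sub (?V \<union> ?U)) (z - comb {1..n} c sphere_cycle)"
      if "cycle (Suc (Suc 0)) (sub ?U) z" for z
      using bU [OF that] unfolding W W' by (intro exI [of _ "\<lambda>_. 0"]) simp
    show "c i = 0" if "bounds (Suc (Suc 0)) (sub (?V \<union> ?U)) (comb {1..n} c sphere_cycle)" "i \<in> {1..n}" for c i
    proof (rule homology_basisD(3) [OF V(3) _ that(2)])
      show "bounds (Suc (Suc 0)) (sub ?V) (comb {1..n} c sphere_cycle)"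
      proof (rule bounds_Un_left [OF op(2,1) _ that(1)])
        show "cycle (Suc (Suc 0)) (sub ?V) (comb {1..n} c sphere_cycle)"
          by (rule comb_cycle) (rule homology_basisD(2) [OF V(3)])
        show "bounds (Suc (Suc 0)) (sub ?V) m" if "cycle (Suc (Suc 0)) (sub (?V \<inter> ?U)) m" for m
          using homology_basis_emptyD [OF corner_2] that singular_boundary_mono [OF corner_sub(2)]
          unfolding Int_commute [of ?V] M by blast
      qed
    qed
    show "\<exists>d. bounds (Suc 0) (sub (?V \<inter> ?U)) (m - comb {} d (\<lambda>k. chain_boundary (Suc (Suc 0)) 0))"
      if "cycle (Suc 0) (sub (?V \<inter> ?U)) m" for m
      using homology_basis_emptyD [OF corner_1] that unfolding Int_commute [of ?V] M by simp
  qed auto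
  then have "homology_basis (Suc (Suc 0)) (sub (?V \<union> ?U)) {1..n} sphere_cycle"
    by (rule homology_basis_reindex [where f = Inl]) (auto simp: bij_betw_def)
  then show "homology_basis (Suc (Suc 0)) X {1..n} sphere_cycle" using W by (simp only: Un_commute)
qed

text \<open>Summing the relations for the single edges, the disks at intermediate vertices cancel.\<close>

lemma disk_relation:
  "bounds (Suc (Suc 0)) X ((disk 1 \<mu> - disk (n + 1) \<mu>) - comb {1..n} (\<lambda>i. edge_pairing i \<mu>) sphere_cycle)"
proof -
  have "(\<Sum>i\<in>{1..m}. disk i \<mu> - disk (i + 1) \<mu>) = disk 1 \<mu> - disk (m + 1) \<mu>" for m
    by (induction m) auto
  then have eq: "(disk 1 \<mu> - disk (n + 1) \<mu>) - comb {1..n} (\<lambda>i. edge_pairing i \<mu>) sphere_cycle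
      = (\<Sum>i\<in>{1..n}. (disk i \<mu> - disk (i + 1) \<mu>) - frag_cmul (edge_pairing i \<mu>) (sphere_cycle i))"
    unfolding sum_subtractf [of "\<lambda>i. disk i \<mu> - disk (i + 1) \<mu>"] by (simp only:)
  show ?thesis
    unfolding eq
  proof (rule bounds_sum)
    fix i assume i: "i \<in> {1..n}"
    then have "nxt i = i + 1" "i \<in> {1..n + 2}" by (auto simp: nxt_def)
    then show "bounds (Suc (Suc 0)) X ((disk i \<mu> - disk (i + 1) \<mu>) - frag_cmul (edge_pairing i \<mu>) (sphere_cycle i))"
      using disk_edge_relation [of i \<mu>] by simp
  qed
qed

end

context toric_polygon
begin

section \<open>The cup product\<close>

lemma cocycle_vanishes_on_chain_star:
  assumes u: "cocycle (Suc (Suc 0)) X u" and kl: "1 \<le> k" "k \<le> l" "l \<le> n + 1"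
    and 0: "\<And>i. i \<in> {k..<l} \<Longrightarrow> cochain_eval u (sphere_cycle i) = 0"
    and z: "cycle (Suc (Suc 0)) (sub (chain_star k l)) z"
  shows "cochain_eval u z = 0"
proof -
  have "homology_basis (Suc (Suc 0)) (sub (chain_star k l)) {k..<l} sphere_cycle"
    using chain_star_homology [OF kl] by blast
  then obtain c where "bounds (Suc (Suc 0)) (sub (chain_star k l)) (z - comb {k..<l} c sphere_cycle)"
    using z by (rule homology_basis_span)
  then have "cochain_eval u z = cochain_eval u (comb {k..<l} c sphere_cycle)"
    by (rule cocycle_homologous [OF u bounds_X])
  then show ?thesis by (simp add: cochain_eval_comb 0)
qed

lemma disk_difference:
  assumes u: "cocycle (Suc (Suc 0)) X u"
  shows "cochain_eval u (disk 1 \<mu> - disk (n + 1) \<mu>) = (\<Sum>i=1..n. edge_pairing i \<mu> * cochain_eval u (sphere_cycle i))"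
  using cocycle_homologous [OF u disk_relation [of \<mu>]] by (simp only: cochain_eval_comb)

text \<open>The loop \<open>(0, 1)\<close> already bounds over the edge \<open>E (n + 2)\<close>, which joins the last vertex to the first,
  and \<open>(1, 0)\<close> over the edge \<open>E (n + 1)\<close>. So the disks of these loops at the two end points of the
  edge are homologous.\<close>

lemma disk_last:
  assumes u: "cocycle (Suc (Suc 0)) X u"
  shows "cochain_eval u (disk (n + 2) (0, 1)) = cochain_eval u (disk 1 (0, 1))"
    and "cochain_eval u (disk (n + 2) (1, 0)) = cochain_eval u (disk (n + 1) (1, 0))"
proof -
  have nx: "nxt (n + 2) = 1" "nxt (n + 1) = n + 2" by (simp_all add: nxt_def)
  have 1: "edge_pairing (n + 2) (0, 1) = 0" "edge_pairing (n + 1) (1, 0) = 0"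
    unfolding pairing_last by simp_all
  have "bounds (Suc (Suc 0)) X (disk (n + 2) (0, 1) - disk 1 (0, 1))"
    using disk_edge_relation [OF last_edges(2), of "(0, 1)"] unfolding 1 nx by simp
  then show "cochain_eval u (disk (n + 2) (0, 1)) = cochain_eval u (disk 1 (0, 1))"
    by (rule cocycle_homologous [OF u])
  have "bounds (Suc (Suc 0)) X (disk (n + 1) (1, 0) - disk (n + 2) (1, 0))"
    using disk_edge_relation [OF last_edges(1), of "(1, 0)"] unfolding 1 nx by simp
  then show "cochain_eval u (disk (n + 2) (1, 0)) = cochain_eval u (disk (n + 1) (1, 0))"
    by (rule cocycle_homologous [OF u, symmetric])
qed

lemma cup_tor:
  "cochain_eval (cup_cochain (Suc 0) (Suc 0) X \<phi> \<psi>) tor =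
    cochain_eval \<phi> (loop (1, 0)) * cochain_eval \<psi> (loop (0, 1)) -
    cochain_eval \<phi> (loop (0, 1)) * cochain_eval \<psi> (loop (1, 0))"
proof -
  have inc: "continuous_map torus_space X inc"
    using continuous_map_inc [of "{}"] by (simp add: continuous_map_in_subtopology)
  have t: "singular_chain (Suc 0 + Suc 0) torus_space torus_cycle"
    using torus_cycle_cycle by (simp add: singular_cycle)
  have l: "cochain_eval (\<lambda>s. \<theta> (simplex_map (Suc 0) inc s)) (torus_loop \<mu>) = cochain_eval \<theta> (loop \<mu>)" for \<theta> \<mu>
    unfolding loop_def using torus_loop_cycle [of \<mu>]
    by (simp add: cochain_eval_chain_map [of "Suc 0" torus_space] singular_cycle)
  show ?thesis
    using cup_cochain_chain_map [OF inc t, of \<phi> \<psi>] by (simp add: tor_def cup_torus_cycle l)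
qed

text \<open>The cocycles are replaced by cohomologous ones: \<open>u'\<close>, which vanishes on the stars of the vertices
  \<open>i + 1\<close> to \<open>n + 1\<close>, and \<open>w'\<close>, which vanishes on those of the vertices 1 to \<open>j\<close>. Every star but the
  last one is among these, as \<open>i \<le> j\<close>, so the product lives on the star of the smooth vertex. There
  it is computed by pushing it to the boundary twice, as explained at the beginning.\<close>

proposition cup_fundamental_cycle:
  assumes u: "cocycle (Suc (Suc 0)) X u" and w: "cocycle (Suc (Suc 0)) X w"
    and ij: "1 \<le> i" "i \<le> j" "j \<le> n"
    and u0: "\<And>k. k \<in> {i + 1..n} \<Longrightarrow> cochain_eval u (sphere_cycle k) = 0"
    and w0: "\<And>k. k \<in> {1..<j} \<Longrightarrow> cochain_eval w (sphere_cycle k) = 0"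
  shows "\<exists>u' w'. cocycle (Suc (Suc 0)) X u' \<and> cocycle (Suc (Suc 0)) X w' \<and>
    (\<forall>z. cycle (Suc (Suc 0)) X z \<longrightarrow> cochain_eval u' z = cochain_eval u z) \<and>
    (\<forall>z. cycle (Suc (Suc 0)) X z \<longrightarrow> cochain_eval w' z = cochain_eval w z) \<and>
    cochain_eval (cup_cochain (Suc (Suc 0)) (Suc (Suc 0)) X u' w') fundamental_cycle =
      - cochain_eval u (disk 1 (0, 1) - disk (n + 1) (0, 1)) * cochain_eval w (disk 1 (1, 0) - disk (n + 1) (1, 0))"
proof -
  let ?V1 = "chain_star 1 j" and ?V2 = "chain_star (i + 1) (n + 1)" and ?N = "star (n + 2)"
  let ?W = "chain_star 1 (n + 1)"
  have V12: "?V1 \<union> ?V2 = ?W"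
  proof -
    have "{1..j} \<union> {i + 1..n + 1} = {1..n + 1}" using ij by auto
    then show ?thesis unfolding chain_star_def by (metis UN_Un)
  qed
  have "1 \<le> j" using ij by simp
  note h1 = chain_star_homology [OF order_refl this, THEN conjunct2, THEN conjunct1]
  have V1: "homology_basis (Suc 0) (sub ?V1) {} (\<lambda>_::unit. 0)" using h1 ij by simp
  have V2: "homology_basis (Suc 0) (sub ?V2) {} (\<lambda>_::unit. 0)"
    using chain_star_homology [of "i + 1" "n + 1"] ij by simp
  have uV2: "cochain_eval u z = 0" if "cycle (Suc (Suc 0)) (sub ?V2) z" for z
    by (rule cocycle_vanishes_on_chain_star [OF u _ _ _ _ that]) (use ij u0 in auto)
  have wV1: "cochain_eval w z = 0" if "cycle (Suc (Suc 0)) (sub ?V1) z" for z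
    by (rule cocycle_vanishes_on_chain_star [OF w _ _ _ _ that]) (use ij w0 in auto)
  obtain u' where u': "cocycle (Suc (Suc 0)) X u'"
    "\<And>f. singular_simplex (Suc (Suc 0)) (sub ?V2) f \<Longrightarrow> u' f = 0"
    "\<And>z. cycle (Suc (Suc 0)) X z \<Longrightarrow> cochain_eval u' z = cochain_eval u z"
    using local_representative [OF V2 u uV2] by blast
  obtain w' where w': "cocycle (Suc (Suc 0)) X w'"
    "\<And>f. singular_simplex (Suc (Suc 0)) (sub ?V1) f \<Longrightarrow> w' f = 0"
    "\<And>z. cycle (Suc (Suc 0)) X z \<Longrightarrow> cochain_eval w' z = cochain_eval w z"
    using local_representative [OF V1 w wV1] by blast
  have primitive_on_N: "\<exists>\<beta>. singular_cochain (Suc 0) X \<beta> \<and>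
      (\<forall>f. singular_simplex (Suc (Suc 0)) (sub ?N) f \<longrightarrow> coboundary (Suc 0) X \<beta> f = y f)"
    if y: "cocycle (Suc (Suc 0)) X y" for y
  proof -
    have "cochain_eval y z = 0" if "cycle (Suc (Suc 0)) (sub ?N) z" for z
      by (rule cocycle_bounds [OF y bounds_X [OF star_bounds [OF last_edges(2) that]]])
    then show ?thesis
      using local_primitive [OF star_pos [OF last_edges(2), where h = "\<lambda>_::unit. 0"] y] by metis
  qed
  obtain \<beta> where \<beta>: "singular_cochain (Suc 0) X \<beta>"
    "\<And>f. singular_simplex (Suc (Suc 0)) (sub ?N) f \<Longrightarrow> coboundary (Suc 0) X \<beta> f = u' f"
    using primitive_on_N [OF u'(1)] by blast
  obtain \<gamma> where \<gamma>: "singular_cochain (Suc 0) X \<gamma>"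
    "\<And>f. singular_simplex (Suc (Suc 0)) (sub ?N) f \<Longrightarrow> coboundary (Suc 0) X \<gamma> f = w' f"
    using primitive_on_N [OF w'(1)] by blast
  let ?\<beta>' = "coboundary (Suc 0) X \<beta>" and ?\<gamma>' = "coboundary (Suc 0) X \<gamma>"
  let ?cup22 = "cup_cochain (Suc (Suc 0)) (Suc (Suc 0)) X" and ?cup12 = "cup_cochain (Suc 0) (Suc (Suc 0)) X"
    and ?cup11 = "cup_cochain (Suc 0) (Suc 0) X" and ?cup21 = "cup_cochain (Suc (Suc 0)) (Suc 0) X"
  have sub1: "edge_star (n + 1) \<subseteq> ?N" "edge_star (n + 2) \<subseteq> ?N"
    using corner_sub(1) by (auto simp: corner_def)
  have prv_n: "prv (n + 1) = n" "prv 1 = n + 2" using n by (simp_all add: prv_def)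
  have "edge_star (n + 1) \<subseteq> star (n + 1)"
    unfolding edge_star_def star_def by (rule over_region_mono) simp
  moreover have "star (n + 1) \<subseteq> ?V2" unfolding chain_star_def by (rule UN_upper) (use ij in simp)
  ultimately have sub2: "edge_star (n + 1) \<subseteq> ?V2" "star (n + 1) \<subseteq> ?V2" by blast+
  have "edge_star (n + 2) \<subseteq> star 1"
    unfolding edge_star_def star_def prv_n by (rule over_region_mono) simp
  moreover have "star 1 \<subseteq> ?V1" unfolding chain_star_def by (rule UN_upper) (use ij in simp)
  ultimately have sub3: "edge_star (n + 2) \<subseteq> ?V1" "star 1 \<subseteq> ?V1" by blast+
  note s1 = solid [OF last_edges(1)] and s2 = solid [OF last_edges(2)]
  have s1N: "singular_chain (Suc (Suc (Suc 0))) (sub ?N) (solid (n + 1))"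
    by (rule singular_chain_mono [OF s1(1) sub1(1)])
  have s1V: "singular_chain (Suc (Suc (Suc 0))) (sub ?V2) (solid (n + 1))"
    by (rule singular_chain_mono [OF s1(1) sub2(1)])
  have s2V: "singular_chain (Suc (Suc (Suc 0))) (sub ?V1) (solid (n + 2))"
    by (rule singular_chain_mono [OF s2(1) sub3(1)])
  \<comment> \<open>The chain \<open>co_ball\<close> has the same boundary as a sum of chains in \<open>?V1\<close> and \<open>?V2\<close>, and differs
    from it by a boundary as there is no homology in degree 4. On the one summand \<open>w'\<close> vanishes,
    on the other \<open>u'\<close>.\<close>
  have out: "cochain_eval (?cup22 u' w') co_ball = 0"
  proof -
    have "bounds (Suc (Suc (Suc 0))) (sub ?W) (- solid (n + 2) + solid (n + 1))"
      using bounds_boundary [OF co_ball(1)] unfolding co_ball(2) corner_cycle_def by (simp add: add.commute)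
    then have "bounds (Suc (Suc (Suc 0))) (sub (?V1 \<union> ?V2)) (- solid (n + 2) + solid (n + 1))" unfolding V12 .
    moreover have "singular_chain (Suc (Suc (Suc 0))) (sub ?V1) (- solid (n + 2))"
      using s2V by (simp add: singular_chain_minus)
    ultimately obtain x y where x: "singular_chain (Suc (Suc (Suc (Suc 0)))) (sub ?V1) x"
      and y: "singular_chain (Suc (Suc (Suc (Suc 0)))) (sub ?V2) y"
      and xy: "chain_boundary (Suc (Suc (Suc (Suc 0)))) (x + y) = - solid (n + 2) + solid (n + 1)"
      using small_boundary_exists [OF openin_chain_star [of 1 j] openin_chain_star [of "i + 1" "n + 1"] _ s1V] by blast
    have "singular_chain (Suc (Suc (Suc (Suc 0)))) (sub ?W) (x + y)"
      unfolding V12 [symmetric] by (rule singular_chain_Un [OF x y])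
    then have "cycle (Suc (Suc (Suc (Suc 0)))) (sub ?W) (co_ball - (x + y))"
      using co_ball xy by (simp add: singular_cycle singular_chain_diff chain_boundary_diff corner_cycle_def)
    then have "bounds (Suc (Suc (Suc (Suc 0)))) X (co_ball - (x + y))"
      by (rule bounds_X [OF homology_basis_emptyD [OF long_chain_homology(4)]])
    moreover have "cocycle (Suc (Suc 0) + Suc (Suc 0)) X (?cup22 u' w')"
      using cup_cocycle [of u' "Suc (Suc 0)" X w' "Suc (Suc 0)"] u'(1) w'(1) by simp
    ultimately have "cochain_eval (?cup22 u' w') co_ball = cochain_eval (?cup22 u' w') (x + y)"
      by (intro cocycle_homologous [of "Suc (Suc (Suc (Suc 0)))" X]) simp_all
    also have "\<dots> = 0"
      using cup_cochain_vanish [of "Suc (Suc 0)" "Suc (Suc 0)" X ?V1 x u' w'] x w'(2)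
        cup_cochain_vanish [of "Suc (Suc 0)" "Suc (Suc 0)" X ?V2 y u' w'] y u'(2)
      by (simp add: cochain_eval_add)
    finally show ?thesis .
  qed
  \<comment> \<open>Near the smooth vertex, \<open>u'\<close> is the coboundary of \<open>\<beta>\<close> and \<open>w'\<close> that of \<open>\<gamma>\<close>. By the Leibniz rule
    the value on the ball is that of \<open>\<beta> \<union> w'\<close> on the 3-sphere. One solid torus does not contribute,
    because \<open>w'\<close> vanishes there; on the other one \<open>u'\<close> vanishes, so that \<open>\<beta> \<union> w'\<close> is there, up to
    sign, the coboundary of \<open>\<beta> \<union> \<gamma>\<close>.\<close>
  have ball_in: "cochain_eval (?cup22 u' w') corner_ball = - cochain_eval (?cup11 \<beta> \<gamma>) tor"
  proof -
    have "cochain_eval (?cup22 u' w') corner_ball = cochain_eval (?cup22 ?\<beta>' w') corner_ball"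
      by (rule cup_cochain_cong [of _ _ X ?N]) (use corner_ball(1) \<beta>(2) in simp_all)
    also have "?cup22 ?\<beta>' w' = coboundary (Suc (Suc (Suc 0))) X (?cup12 \<beta> w')"
      using coboundary_cup_cochain [of "Suc 0" "Suc (Suc 0)" X \<beta> w'] w'(1) by simp
    also have "cochain_eval \<dots> corner_ball = cochain_eval (?cup12 \<beta> w') corner_cycle"
      using corner_ball by (simp add: cochain_eval_coboundary singular_chain_subtopology)
    also have "\<dots> = cochain_eval (?cup12 \<beta> w') (solid (n + 1)) - cochain_eval (?cup12 \<beta> w') (solid (n + 2))"
      by (simp add: corner_cycle_def cochain_eval_diff)
    also have "cochain_eval (?cup12 \<beta> w') (solid (n + 2)) = 0"
      by (rule cup_cochain_vanish [of _ _ X ?V1]) (use s2V w'(2) in simp_all)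
    also have "cochain_eval (?cup12 \<beta> w') (solid (n + 1)) = cochain_eval (?cup12 \<beta> ?\<gamma>') (solid (n + 1))"
      by (rule cup_cochain_cong [of _ _ X ?N]) (use s1N \<gamma>(2) in simp_all)
    also have "\<dots> = cochain_eval (?cup21 ?\<beta>' \<gamma>) (solid (n + 1))
        - cochain_eval (coboundary (Suc (Suc 0)) X (?cup11 \<beta> \<gamma>)) (solid (n + 1))"
      using coboundary_cup_cochain [of "Suc 0" "Suc 0" X \<beta> \<gamma>]
      by (simp add: cochain_eval_minus_cochain)
    also have "cochain_eval (?cup21 ?\<beta>' \<gamma>) (solid (n + 1)) = 0"
    proof (rule cup_cochain_vanish [of _ _ X "?N \<inter> ?V2"])
      show "singular_chain (Suc (Suc 0) + Suc 0) (sub (?N \<inter> ?V2)) (solid (n + 1))"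
        using singular_chain_Int [OF s1N s1V] by simp
      have "?\<beta>' f = 0" if "singular_simplex (Suc (Suc 0)) (sub (?N \<inter> ?V2)) f" for f
        using \<beta>(2) [of f] u'(2) [of f] that by (auto simp: singular_simplex_subtopology)
      then show "(\<forall>f. singular_simplex (Suc (Suc 0)) (sub (?N \<inter> ?V2)) f \<longrightarrow> ?\<beta>' f = 0) \<or>
          (\<forall>f. singular_simplex (Suc 0) (sub (?N \<inter> ?V2)) f \<longrightarrow> \<gamma> f = 0)" by blast
    qed
    also have "cochain_eval (coboundary (Suc (Suc 0)) X (?cup11 \<beta> \<gamma>)) (solid (n + 1)) = cochain_eval (?cup11 \<beta> \<gamma>) tor"
      using s1 by (simp add: cochain_eval_coboundary singular_chain_subtopology)
    finally show ?thesis by simp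
  qed
  \<comment> \<open>The primitives take on a loop the value of the cocycles on a disk which it bounds.\<close>
  have dN: "cochain_eval \<beta> (loop \<mu>) = cochain_eval u' (disk (n + 2) \<mu>)"
    "cochain_eval \<gamma> (loop \<mu>) = cochain_eval w' (disk (n + 2) \<mu>)" for \<mu>
  proof -
    note d = disk [OF last_edges(2), of \<mu>]
    have "cochain_eval ?\<beta>' (disk (n + 2) \<mu>) = cochain_eval u' (disk (n + 2) \<mu>)"
      by (rule cochain_eval_cong [OF d(1) \<beta>(2)])
    then show "cochain_eval \<beta> (loop \<mu>) = cochain_eval u' (disk (n + 2) \<mu>)"
      using cochain_eval_coboundary [OF disk_chain_X [OF last_edges(2)], of \<beta> \<mu>] d(2) by simp
    have "cochain_eval ?\<gamma>' (disk (n + 2) \<mu>) = cochain_eval w' (disk (n + 2) \<mu>)"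
      by (rule cochain_eval_cong [OF d(1) \<gamma>(2)])
    then show "cochain_eval \<gamma> (loop \<mu>) = cochain_eval w' (disk (n + 2) \<mu>)"
      using cochain_eval_coboundary [OF disk_chain_X [OF last_edges(2)], of \<gamma> \<mu>] d(2) by simp
  qed
  have u0': "cochain_eval u' (disk (n + 1) \<mu>) = 0" for \<mu>
    using cochain_eval_cong [OF singular_chain_mono [OF disk(1) [OF last_edges(1)] sub2(2)], of u' "\<lambda>f. 0" \<mu>] u'(2)
    by simp
  have one: "1 \<in> {1..n + 2}" by simp
  have w0': "cochain_eval w' (disk 1 \<mu>) = 0" for \<mu>
    using cochain_eval_cong [OF singular_chain_mono [OF disk(1) [OF one] sub3(2)], of w' "\<lambda>f. 0" \<mu>] w'(2)
    by simp
  have dcyc: "cycle (Suc (Suc 0)) X (disk 1 \<mu> - disk (n + 1) \<mu>)" for \<mu>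
    using disk_chain_X [OF one, of \<mu>] disk_chain_X [OF last_edges(1), of \<mu>] disk(2) [OF one, of \<mu>] disk(2) [OF last_edges(1), of \<mu>]
    by (simp add: singular_cycle singular_chain_diff chain_boundary_diff)
  have \<beta>10: "cochain_eval \<beta> (loop (1, 0)) = 0"
    unfolding dN disk_last(2) [OF u'(1)] by (rule u0')
  have \<beta>01: "cochain_eval \<beta> (loop (0, 1)) = cochain_eval u (disk 1 (0, 1) - disk (n + 1) (0, 1))"
    unfolding dN disk_last(1) [OF u'(1)] u'(3) [OF dcyc, symmetric] by (simp add: cochain_eval_diff u0' [unfolded Suc_eq_plus1 [symmetric]] u0')
  have \<gamma>10: "cochain_eval \<gamma> (loop (1, 0)) = - cochain_eval w (disk 1 (1, 0) - disk (n + 1) (1, 0))"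
    unfolding dN disk_last(2) [OF w'(1)] w'(3) [OF dcyc, symmetric] by (simp only: cochain_eval_diff w0')
  have "cochain_eval (?cup22 u' w') fundamental_cycle =
      - cochain_eval u (disk 1 (0, 1) - disk (n + 1) (0, 1)) * cochain_eval w (disk 1 (1, 0) - disk (n + 1) (1, 0))"
    unfolding fundamental_cycle_def cochain_eval_diff out ball_in cup_tor \<beta>10 \<beta>01 \<gamma>10 by (simp add: algebra_simps)
  then show ?thesis using u' w' by blast
qed

text \<open>The value of \<open>u k\<close> on the difference of the disks with boundary \<open>\<mu>\<close> is the coefficient of the \<open>k\<close>-th
  sphere in \<open>disk_relation\<close>, the determinant of \<open>\<lambda> (E k)\<close> and \<open>\<mu>\<close>.\<close>

lemma cup_dual_basis:
  assumes u: "\<And>i. i \<in> {1..n} \<Longrightarrow> cocycle (Suc (Suc 0)) X (u i)"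
    and dual: "\<And>i k. i \<in> {1..n} \<Longrightarrow> k \<in> {1..n} \<Longrightarrow> cochain_eval (u i) (sphere_cycle k) = (if i = k then 1 else 0)"
    and \<nu>: "cocycle (Suc (Suc (Suc (Suc 0)))) X \<nu>" "cochain_eval \<nu> fundamental_cycle = 1"
    and ij: "1 \<le> i" "i \<le> j" "j \<le> n"
  shows "cup_product (Suc (Suc 0)) (Suc (Suc 0)) X (cohomology_class (Suc (Suc 0)) X (u i)) (cohomology_class (Suc (Suc 0)) X (u j))
    = cohomology_class (Suc (Suc (Suc (Suc 0)))) X \<nu> [^]\<^bsub>reduced_cohomology_group (Suc (Suc (Suc (Suc 0)))) X\<^esub> (a i * b j)"
proof -
  have i: "i \<in> {1..n}" and j: "j \<in> {1..n}" using ij by auto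
  have eval: "cochain_eval (u k) (disk 1 \<mu> - disk (n + 1) \<mu>) = edge_pairing k \<mu>" if k: "k \<in> {1..n}" for k \<mu>
  proof -
    have "(\<Sum>l=1..n. edge_pairing l \<mu> * cochain_eval (u k) (sphere_cycle l)) = (\<Sum>l=1..n. if l = k then edge_pairing l \<mu> else 0)"
      by (rule sum.cong [OF refl]) (auto simp: dual [OF k])
    then show ?thesis using disk_difference [OF u [OF k], of \<mu>] k by simp
  qed
  obtain x y where x: "cocycle (Suc (Suc 0)) X x" "\<And>z. cycle (Suc (Suc 0)) X z \<Longrightarrow> cochain_eval x z = cochain_eval (u i) z"
    and y: "cocycle (Suc (Suc 0)) X y" "\<And>z. cycle (Suc (Suc 0)) X z \<Longrightarrow> cochain_eval y z = cochain_eval (u j) z"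
    and xy: "cochain_eval (cup_cochain (Suc (Suc 0)) (Suc (Suc 0)) X x y) fundamental_cycle =
      - cochain_eval (u i) (disk 1 (0, 1) - disk (n + 1) (0, 1)) * cochain_eval (u j) (disk 1 (1, 0) - disk (n + 1) (1, 0))"
    using cup_fundamental_cycle [OF u [OF i] u [OF j] ij] dual ij by fastforce
  have cyc: "cycle (Suc (Suc 0)) X (sphere_cycle k)" if "k \<in> {1..n}" for k
    using homology_basisD(2) [OF X_2 that] .
  have cx: "cohomology_class (Suc (Suc 0)) X (u i) = cohomology_class (Suc (Suc 0)) X x"
    using cohomology_class_eq_iff_values [OF X_1 X_2 u [OF i] x(1)] x(2) cyc by simp
  have cy: "cohomology_class (Suc (Suc 0)) X (u j) = cohomology_class (Suc (Suc 0)) X y"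
    using cohomology_class_eq_iff_values [OF X_1 X_2 u [OF j] y(1)] y(2) cyc by simp
  let ?c = "cup_cochain (Suc (Suc 0)) (Suc (Suc 0)) X x y"
  have c: "cocycle (Suc (Suc (Suc (Suc 0)))) X ?c"
    using cup_cocycle [of x "Suc (Suc 0)" X y "Suc (Suc 0)"] x(1) y(1) by simp
  have val: "cochain_eval ?c fundamental_cycle = a i * b j"
    unfolding xy eval [OF i] eval [OF j] by (simp add: edge_pairing_def)
  have "cup_product (Suc (Suc 0)) (Suc (Suc 0)) X (cohomology_class (Suc (Suc 0)) X (u i)) (cohomology_class (Suc (Suc 0)) X (u j))
      = cohomology_class (Suc (Suc (Suc (Suc 0)))) X ?c"
    unfolding cx cy using cup_product_cohomology_class [OF _ _ x(1) y(1)] by simp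
  also have "\<dots> = cohomology_class (Suc (Suc (Suc (Suc 0)))) X (\<lambda>f. a i * b j * \<nu> f)"
    unfolding cohomology_class_eq_iff_values [OF X_3 X_4 c cocycle_scale [OF \<nu>(1)]]
    using val \<nu>(2) by (simp add: cochain_eval_def sum_distrib_left [symmetric] mult.left_commute)
  also have "\<dots> = cohomology_class (Suc (Suc (Suc (Suc 0)))) X \<nu> [^]\<^bsub>reduced_cohomology_group (Suc (Suc (Suc (Suc 0)))) X\<^esub> (a i * b j)"
    by (rule cohomology_class_int_pow [OF \<nu>(1), symmetric])
  finally show ?thesis .
qed

lemma X_basis: "\<exists>I (h :: nat \<Rightarrow> orbifold_point chain). homology_basis p X I h"
proof -
  have z: "homology_basis q X {} (\<lambda>_::nat. 0)" if "homology_basis q X {} (\<lambda>_::unit. 0)" for q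
    using that by (simp add: homology_basis_def)
  have s: "homology_basis q X {0} (\<lambda>_::nat. c)" if "homology_basis q X {()} (\<lambda>_. c)" for q c
    using that by (rule homology_basis_reindex [where f = "\<lambda>_. ()"]) (auto simp: bij_betw_def)
  consider "p = 0" | "p = Suc 0" | "p = Suc (Suc 0)" | "p = Suc (Suc (Suc 0))" | "p = Suc (Suc (Suc (Suc 0)))"
    | q where "p = Suc (Suc (Suc (Suc (Suc q))))"
    by (metis not0_implies_Suc)
  then show ?thesis
    by cases (use s [OF X_0] z [OF X_1] X_2 z [OF X_3] s [OF X_4] z [OF X_5] in blast)+
qed

lemma torsion_free_X: "torsion_free (reduced_cohomology_group k X)"
proof (cases k)
  case 0
  obtain s where "pt = frag_of s" using pt_frag by blast
  then show ?thesis using torsion_free_trivial_group trivial_reduced_cohomology_0 [of X s] X_0 0 by simp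
next
  case (Suc p)
  obtain I J and h h' :: "nat \<Rightarrow> orbifold_point chain"
    where "homology_basis p X I h" "homology_basis (Suc p) X J h'"
    using X_basis by metis
  then show ?thesis unfolding Suc by (rule torsion_free_reduced_cohomology)
qed

lemma trivial_X:
  assumes "k \<noteq> 2" "k \<noteq> 4"
  shows "trivial_group (reduced_cohomology_group k X)"
proof (cases k)
  case 0
  obtain s where "pt = frag_of s" using pt_frag by blast
  then show ?thesis using trivial_reduced_cohomology_0 [of X s] X_0 0 by simp
next
  case (Suc p)
  obtain I and h :: "nat \<Rightarrow> orbifold_point chain" where h: "homology_basis p X I h"
    using X_basis by metis
  have "p = 0 \<or> p = Suc (Suc 0) \<or> p \<ge> 4" using assms Suc by auto
  then consider "p = 0" | "p = Suc (Suc 0)" | q where "p = Suc (Suc (Suc (Suc q)))"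
    by (metis add_Suc add_0 le_Suc_ex numeral_eq_Suc pred_numeral_simps BitM.simps)
  then have "homology_basis (Suc p) X {} (\<lambda>_::unit. 0)"
    by cases (simp_all only: X_1 X_3 X_5)
  then show ?thesis unfolding Suc by (rule trivial_reduced_cohomology [OF h])
qed

proposition cohomology_basis:
  "\<exists>u v. int_basis (reduced_cohomology_group 2 X) {1..n} u \<and>
     int_basis (reduced_cohomology_group 4 X) {()} (\<lambda>_. v) \<and>
     (\<forall>i j. 1 \<le> i \<and> i \<le> j \<and> j \<le> n \<longrightarrow>
        cup_product 2 2 X (u i) (u j) = v [^]\<^bsub>reduced_cohomology_group 4 X\<^esub> (a i * b j))"
proof -
  have "\<exists>\<phi>. cocycle (Suc (Suc 0)) X \<phi> \<and> (\<forall>k\<in>{1..n}. cochain_eval \<phi> (sphere_cycle k) = (if i = k then 1 else 0))" for i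
    using cocycle_with_values [OF X_2, of "\<lambda>k. if i = k then 1 else 0"] by metis
  then obtain u where u: "\<And>i. cocycle (Suc (Suc 0)) X (u i)"
    "\<And>i k. k \<in> {1..n} \<Longrightarrow> cochain_eval (u i) (sphere_cycle k) = (if i = k then 1 else 0)"
    by metis
  obtain \<nu> where \<nu>: "cocycle (Suc (Suc (Suc (Suc 0)))) X \<nu>" "cochain_eval \<nu> fundamental_cycle = 1"
    using cocycle_with_values [OF X_4, of "\<lambda>_. 1"] by auto
  have two: "2 = Suc (Suc 0)" and four: "4 = Suc (Suc (Suc (Suc 0)))" by simp_all
  show ?thesis
  proof (intro exI conjI allI impI)
    show "int_basis (reduced_cohomology_group 2 X) {1..n} (\<lambda>i. cohomology_class (Suc (Suc 0)) X (u i))"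
      unfolding two by (rule int_basis_of_dual_cocycles [OF X_1 X_2]) (use u in auto)
    show "int_basis (reduced_cohomology_group 4 X) {()} (\<lambda>_. cohomology_class (Suc (Suc (Suc (Suc 0)))) X \<nu>)"
      unfolding four by (rule int_basis_of_dual_cocycles [OF X_3 X_4]) (use \<nu> in auto)
    fix i j assume "1 \<le> i \<and> i \<le> j \<and> j \<le> n"
    then show "cup_product 2 2 X (cohomology_class (Suc (Suc 0)) X (u i)) (cohomology_class (Suc (Suc 0)) X (u j))
        = cohomology_class (Suc (Suc (Suc (Suc 0)))) X \<nu> [^]\<^bsub>reduced_cohomology_group 4 X\<^esub> (a i * b j)"
      unfolding two four by (intro cup_dual_basis) (use u \<nu> in auto)
  qed
qed

end

theorem theorem1p1:
  fixes n :: nat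
    and P :: "(real^2) set"
    and E :: "nat \<Rightarrow> (real^2) set"
    and vtx :: "nat \<Rightarrow> real^2"
    and lam :: "(real^2) set \<Rightarrow> int \<times> int"
    and a b :: "nat \<Rightarrow> int"
  assumes "n \<ge> 1"
    and "labelled_polygon P (n + 2) E vtx"
    and "characteristic_function P lam"
    and "\<And>i. i \<in> {1..n + 2} \<Longrightarrow> lam (E i) = (a i, b i)"
    and "smooth_vertex (n + 2) E lam (n + 2)"
    and "lam (E (n + 1)) = (1, 0)"
    and "lam (E (n + 2)) = (0, 1)"
  defines "X \<equiv> toric_orbifold P lam"
  shows "(\<forall>k. torsion_free (reduced_cohomology_group k X)) \<and>
    (\<exists>u v.
       int_basis (reduced_cohomology_group 2 X) {1..n} u \<and>
       int_basis (reduced_cohomology_group 4 X) {()} (\<lambda>_. v) \<and>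
       (\<forall>k. k \<noteq> 2 \<and> k \<noteq> 4 \<longrightarrow> trivial_group (reduced_cohomology_group k X)) \<and>
       (\<forall>i j. 1 \<le> i \<and> i \<le> j \<and> j \<le> n \<longrightarrow>
          cup_product 2 2 X (u i) (u j) = v [^]\<^bsub>reduced_cohomology_group 4 X\<^esub> (a i * b j)))"
proof -
  interpret T: toric_polygon n P E vtx lam a b
    by unfold_locales (fact assms)+
  have X: "X = T.X" by (simp add: X_def T.X_def)
  show ?thesis
    unfolding X using T.torsion_free_X T.trivial_X T.cohomology_basis by blast
qed

end
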